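(* Let $G$ be a countable abelian group, $\mathscr C$ a locally restricted $G$-finitary 2-category, $\mathbf M$ a $G$-finitary 2-representation of $\mathscr C$, $\mathtt i$ an object of $\mathscr C$ and $S\in\mathbf M(\mathtt i)$. Let $A^S=[S,S]\in\underline{\mathscr C}(\mathtt i,\mathtt i)$ and $A^S_0=[S,S]_0\in\underline{\mathscr C_0}(\mathtt i,\mathtt i)$ be the associated coalgebra 1-morphisms. Then $A^S\cong A^S_0$ in $\underline{\mathscr C}$. In addition, one can choose a representative of the isomorphism class of $A^S$ in $\underline{\mathscr C}$ such that, when considered as a coalgebra 1-morphism, its counit and comultiplication 2-morphisms have components homogeneous of degree zero.
   Context: $\Bbbk$ is an algebraically closed field. For a $G$-graded vector space $V$, $V[\![g]\!]_h=V_{h-g}$. A $G$-graded finitary category is an additive idempotent complete category enriched in $G$-graded $\Bbbk$-vector spaces with finite-dimensional homogeneous components (and degree-zero maps), with finitely many isomorphism classes of indecomposables. Its $G$-envelope has objects $X[\![g]\!]$ ($X$ an object, $g\in G$) with $\mathrm{Hom}(X[\![g]\!],Y[\![h]\!])=\mathrm{Hom}(X,Y)[\![h-g]\!]$; such an envelope is called a $G$-finitary category. A $G$-graded functor preserves degrees of morphisms and satisfies $F(X[\![g]\!])=F(X)[\![g]\!]$. A locally $G$-finitary 2-category is the $G$-envelope (taken hom-category-wise, with $X[\![g]\!]\circ Y[\![h]\!]=(XY)[\![g+h]\!]$) of a 2-category with countably many objects whose hom-categories are $G$-graded finitary, whose horizontal and vertical compositions respect degree, and whose identity 1-morphisms are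 indecomposable. It is restricted if all spaces of 2-morphisms are (totally) finite-dimensional. A $G$-finitary 2-representation is a strict $G$-graded 2-functor (preserving degrees of 2-morphisms and shifts) from $\mathscr C$ to the 2-category of $G$-finitary categories, $\Bbbk$-linear additive $G$-graded functors and natural transformations. $\mathscr C_0$ has the same objects and 1-morphisms as $\mathscr C$ but only the 2-morphisms homogeneous of degree zero; $\mathbf M_0(\mathtt i)$ has the objects of $\mathbf M(\mathtt i)$ and only the degree-zero morphisms, and is a 2-representation of $\mathscr C_0$. The categories $\mathscr C_0(\mathtt i,\mathtt j)$ and $\mathbf M_0(\mathtt i)$ are understood to be additive and idempotent complete. Injective fan Freyd abelianisation $\underline{\mathcal A}$ of an additive category $\mathcal A$: objects are tuples $(X,k,Y_i,f_i)_{i\ge1}$ with $f_i:X\to Y_i$ in $\mathcal A$ and $Y_i=0$ for $i>k$ (identified if they differ only in $k$); morphisms $(X,k,Y_i,f_i)\to(X',k',Y'_i,f'_i)$ are tuples $(g,h_{ij})$, $g:X\to X'$, $h_{ij}:Y_i\to Y'_j$, with $f'_ig=\sum_jh_{ji}f_j$, modulo those for which there are $q_i:Y_i\to X'$ with $\sum_iq_if_i=g$. The entries $g,h_{ij}$ are the components of the morphism; "components homogeneous of degree zero" means the morphism has a representing tuple of degree-zero morphisms. $\underline{\mathscr C}$ and $\underline{\mathscr C_0}$ have the objects of $\mathscr C$, hom-categories $\underline{\mathscr C(\mathtt i,\mathtt j)}$, $\underline{\mathscr C_0(\mathtt i,\mathtt j)}$, and composition $(X,k,Y_i,f_i)\circ(X',k',Y'_i,f'_i)=(XX',k+k',Z_l,\gamma_l)$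 with $Z_l=Y_lX'$, $\gamma_l=f_l\circ_H\mathrm{id}_{X'}$ for $l\le k$, $Z_{k+l}=XY'_l$, $\gamma_{k+l}=\mathrm{id}_X\circ_Hf'_l$ for $1\le l\le k'$. They act on $\underline{\mathbf M}$, resp. $\underline{\mathbf M_0}$ (componentwise abelianisations) analogously. There is a natural functor $\underline{\mathscr C_0}\to\underline{\mathscr C}$ induced by the inclusion $\mathscr C_0\subseteq\mathscr C$, through which $A_0^S$ is viewed in $\underline{\mathscr C}$. The functor $F\mapsto\mathrm{Hom}_{\mathbf M}(S,FS)$ from $\mathscr C(\mathtt i,\mathtt i)$ to finite-dimensional $\Bbbk$-vector spaces extends uniquely to a left exact functor on $\underline{\mathscr C}(\mathtt i,\mathtt i)$, which is represented by an object $[S,S]$: $\mathrm{Hom}_{\underline{\mathbf M}}(S,HS)\cong\mathrm{Hom}_{\underline{\mathscr C}}([S,S],H)$. Likewise $[S,S]_0$ satisfies $\mathrm{Hom}_{\underline{\mathbf M_0}}(S,HS)\cong\mathrm{Hom}_{\underline{\mathscr C_0}}([S,S]_0,H)$ for $H\in\underline{\mathscr C_0}(\mathtt i,\mathtt i)$. These are coalgebra 1-morphisms (comonads): with $\mathrm{coev}:S\to[S,S]S$ corresponding to the identity of $[S,S]$, the comultiplication corresponds to $([S,S]\mathrm{coev})\circ\mathrm{coev}:S\to[S,S][S,S]S$, and the counit $[S,S]\to\mathbf 1_{\mathtt i}$ corresponds to $\mathrm{id}_S$; similarly for $[S,S]_0$. *)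

theory Defs
  imports
    "HOL-Computational_Algebra.Polynomial"
    "HOL-Library.Countable_Set"
begin

section \<open>Linear and graded categories\<close>

text \<open>
  Morphism spaces are subspaces of one ambient vector space, and morphism spaces of different pairs
  of objects may overlap; dom and cod are therefore never read off a morphism. Every small linear
  category has this form up to isomorphism (take the direct sum of all morphism spaces), and it is
  what makes \<open>Hom(X[g],Y[h])\<close> and \<open>Hom(X,Y)\<close> equal as sets in the envelope below.
\<close>

record ('o, 'm, 'k) lin_cat =
  Obj :: "'o set"
  Hom :: "'o \<Rightarrow> 'o \<Rightarrow> 'm set"
  Idm :: "'o \<Rightarrow> 'm"
  Comp :: "'m \<Rightarrow> 'm \<Rightarrow> 'm"
  Scale :: "'k \<Rightarrow> 'm \<Rightarrow> 'm"

locale linear_category =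
  fixes \<A> :: "('o, 'm::ab_group_add, 'k::field) lin_cat"
  assumes Scale_vector_space: "vector_space (Scale \<A>)"
    and Hom_subspace: "\<lbrakk>X \<in> Obj \<A>; Y \<in> Obj \<A>\<rbrakk> \<Longrightarrow> module.subspace (Scale \<A>) (Hom \<A> X Y)"
    and Idm_in: "X \<in> Obj \<A> \<Longrightarrow> Idm \<A> X \<in> Hom \<A> X X"
    and Comp_in: "\<lbrakk>X \<in> Obj \<A>; Y \<in> Obj \<A>; Z \<in> Obj \<A>; f \<in> Hom \<A> X Y; g \<in> Hom \<A> Y Z\<rbrakk>
      \<Longrightarrow> Comp \<A> g f \<in> Hom \<A> X Z"
    and Comp_Idm: "\<lbrakk>X \<in> Obj \<A>; Y \<in> Obj \<A>; f \<in> Hom \<A> X Y\<rbrakk> \<Longrightarrow> Comp \<A> f (Idm \<A> X) = f"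
    and Idm_Comp: "\<lbrakk>X \<in> Obj \<A>; Y \<in> Obj \<A>; f \<in> Hom \<A> X Y\<rbrakk> \<Longrightarrow> Comp \<A> (Idm \<A> Y) f = f"
    and Comp_assoc: "\<lbrakk>W \<in> Obj \<A>; X \<in> Obj \<A>; Y \<in> Obj \<A>; Z \<in> Obj \<A>;
        f \<in> Hom \<A> W X; g \<in> Hom \<A> X Y; h \<in> Hom \<A> Y Z\<rbrakk>
      \<Longrightarrow> Comp \<A> (Comp \<A> h g) f = Comp \<A> h (Comp \<A> g f)"
    and Comp_add_left: "\<lbrakk>X \<in> Obj \<A>; Y \<in> Obj \<A>; Z \<in> Obj \<A>; f \<in> Hom \<A> X Y;
        g \<in> Hom \<A> Y Z; g' \<in> Hom \<A> Y Z\<rbrakk> \<Longrightarrow> Comp \<A> (g + g') f = Comp \<A> g f + Comp \<A> g' f"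
    and Comp_add_right: "\<lbrakk>X \<in> Obj \<A>; Y \<in> Obj \<A>; Z \<in> Obj \<A>; f \<in> Hom \<A> X Y; f' \<in> Hom \<A> X Y;
        g \<in> Hom \<A> Y Z\<rbrakk> \<Longrightarrow> Comp \<A> g (f + f') = Comp \<A> g f + Comp \<A> g f'"
    and Comp_scale_left: "\<lbrakk>X \<in> Obj \<A>; Y \<in> Obj \<A>; Z \<in> Obj \<A>; f \<in> Hom \<A> X Y; g \<in> Hom \<A> Y Z\<rbrakk>
      \<Longrightarrow> Comp \<A> (Scale \<A> a g) f = Scale \<A> a (Comp \<A> g f)"
    and Comp_scale_right: "\<lbrakk>X \<in> Obj \<A>; Y \<in> Obj \<A>; Z \<in> Obj \<A>; f \<in> Hom \<A> X Y; g \<in> Hom \<A> Y Z\<rbrakk>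
      \<Longrightarrow> Comp \<A> g (Scale \<A> a f) = Scale \<A> a (Comp \<A> g f)"

definition isomorphic :: "('o, 'm, 'k) lin_cat \<Rightarrow> 'o \<Rightarrow> 'o \<Rightarrow> bool" where
  "isomorphic \<A> X Y \<longleftrightarrow> (\<exists>f \<in> Hom \<A> X Y. \<exists>g \<in> Hom \<A> Y X.
     Comp \<A> g f = Idm \<A> X \<and> Comp \<A> f g = Idm \<A> Y)"

definition zero_object :: "('o, 'm::zero, 'k) lin_cat \<Rightarrow> 'o \<Rightarrow> bool" where
  "zero_object \<A> Z \<longleftrightarrow> Z \<in> Obj \<A> \<and> (\<forall>X \<in> Obj \<A>. Hom \<A> X Z = {0} \<and> Hom \<A> Z X = {0})"

definition biproduct :: "('o, 'm::ab_group_add, 'k) lin_cat \<Rightarrow> 'o \<Rightarrow> 'o \<Rightarrow> 'o \<Rightarrow> bool" where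
  "biproduct \<A> X Y P \<longleftrightarrow> P \<in> Obj \<A> \<and>
     (\<exists>i1 \<in> Hom \<A> X P. \<exists>i2 \<in> Hom \<A> Y P. \<exists>p1 \<in> Hom \<A> P X. \<exists>p2 \<in> Hom \<A> P Y.
        Comp \<A> p1 i1 = Idm \<A> X \<and> Comp \<A> p2 i2 = Idm \<A> Y \<and>
        Comp \<A> p1 i2 = 0 \<and> Comp \<A> p2 i1 = 0 \<and>
        Comp \<A> i1 p1 + Comp \<A> i2 p2 = Idm \<A> P)"

definition additive_category :: "('o, 'm::ab_group_add, 'k) lin_cat \<Rightarrow> bool" where
  "additive_category \<A> \<longleftrightarrow> (\<exists>Z. zero_object \<A> Z) \<and>
     (\<forall>X \<in> Obj \<A>. \<forall>Y \<in> Obj \<A>. \<exists>P. biproduct \<A> X Y P)"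

definition splits :: "('o, 'm, 'k) lin_cat \<Rightarrow> 'o \<Rightarrow> 'm \<Rightarrow> bool" where
  "splits \<A> X e \<longleftrightarrow> (\<exists>Y \<in> Obj \<A>. \<exists>p \<in> Hom \<A> X Y. \<exists>i \<in> Hom \<A> Y X.
     Comp \<A> p i = Idm \<A> Y \<and> Comp \<A> i p = e)"

definition idempotent_complete :: "('o, 'm, 'k) lin_cat \<Rightarrow> bool" where
  "idempotent_complete \<A> \<longleftrightarrow>
     (\<forall>X \<in> Obj \<A>. \<forall>e \<in> Hom \<A> X X. Comp \<A> e e = e \<longrightarrow> splits \<A> X e)"

definition indecomposable :: "('o, 'm::ab_group_add, 'k) lin_cat \<Rightarrow> 'o \<Rightarrow> bool" where
  "indecomposable \<A> X \<longleftrightarrow> X \<in> Obj \<A> \<and> \<not> zero_object \<A> X \<and>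
     (\<forall>Y \<in> Obj \<A>. \<forall>Z \<in> Obj \<A>. biproduct \<A> Y Z X \<longrightarrow> zero_object \<A> Y \<or> zero_object \<A> Z)"

definition finite_dim :: "('k::field \<Rightarrow> 'm::ab_group_add \<Rightarrow> 'm) \<Rightarrow> 'm set \<Rightarrow> bool" where
  "finite_dim s V \<longleftrightarrow> (\<exists>B. finite B \<and> V = module.span s B)"

text \<open>\<open>HomD \<A> X Y d\<close> is the space of homogeneous morphisms of degree \<open>d\<close>.\<close>

record ('o, 'm, 'k, 'g) gr_cat =
  GObj :: "'o set"
  HomD :: "'o \<Rightarrow> 'o \<Rightarrow> 'g \<Rightarrow> 'm set"
  GIdm :: "'o \<Rightarrow> 'm"
  GComp :: "'m \<Rightarrow> 'm \<Rightarrow> 'm"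
  GScale :: "'k \<Rightarrow> 'm \<Rightarrow> 'm"

definition total_cat :: "('o, 'm::ab_group_add, 'k::field, 'g) gr_cat \<Rightarrow> ('o, 'm, 'k) lin_cat" where
  "total_cat \<A> = \<lparr>Obj = GObj \<A>, Hom = (\<lambda>X Y. module.span (GScale \<A>) (\<Union>d. HomD \<A> X Y d)),
     Idm = GIdm \<A>, Comp = GComp \<A>, Scale = GScale \<A>\<rparr>"

definition degree_zero_cat :: "('o, 'm, 'k, 'g::zero) gr_cat \<Rightarrow> ('o, 'm, 'k) lin_cat" where
  "degree_zero_cat \<A> = \<lparr>Obj = GObj \<A>, Hom = (\<lambda>X Y. HomD \<A> X Y 0),
     Idm = GIdm \<A>, Comp = GComp \<A>, Scale = GScale \<A>\<rparr>"

locale graded_category = linear_category "total_cat \<A>"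
  for \<A> :: "('o, 'm::ab_group_add, 'k::field, 'g::ab_group_add) gr_cat" +
  assumes HomD_subspace: "\<lbrakk>X \<in> GObj \<A>; Y \<in> GObj \<A>\<rbrakk>
      \<Longrightarrow> module.subspace (GScale \<A>) (HomD \<A> X Y d)"
    and HomD_direct: "\<lbrakk>X \<in> GObj \<A>; Y \<in> GObj \<A>; \<And>d. x d \<in> HomD \<A> X Y d;
        finite {d. x d \<noteq> 0}; (\<Sum>d | x d \<noteq> 0. x d) = 0\<rbrakk> \<Longrightarrow> x d = 0"
    and Idm_degree: "X \<in> GObj \<A> \<Longrightarrow> GIdm \<A> X \<in> HomD \<A> X X 0"
    and Comp_degree: "\<lbrakk>X \<in> GObj \<A>; Y \<in> GObj \<A>; Z \<in> GObj \<A>;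
        f \<in> HomD \<A> X Y d; g \<in> HomD \<A> Y Z e\<rbrakk> \<Longrightarrow> GComp \<A> g f \<in> HomD \<A> X Z (e + d)"

text \<open>
  Direct sums, isomorphisms and indecomposables refer to the category of all morphisms. Idempotents
  are those of the enriched category, hence of degree zero; their splittings may have any degree.
  This is the weakest reading of idempotent completeness.
\<close>

definition G_graded_finitary ::
  "('o, 'm::ab_group_add, 'k::field, 'g::ab_group_add) gr_cat \<Rightarrow> bool" where
  "G_graded_finitary \<A> \<longleftrightarrow> graded_category \<A> \<and>
     (\<forall>X \<in> GObj \<A>. \<forall>Y \<in> GObj \<A>. \<forall>d. finite_dim (GScale \<A>) (HomD \<A> X Y d)) \<and>
     additive_category (total_cat \<A>) \<and>
     (\<forall>X \<in> GObj \<A>. \<forall>e \<in> HomD \<A> X X 0. GComp \<A> e e = e \<longrightarrow> splits (total_cat \<A>) X e) \<and>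
     (\<exists>T. finite T \<and> T \<subseteq> GObj \<A> \<and>
        (\<forall>X. indecomposable (total_cat \<A>) X \<longrightarrow> (\<exists>Y \<in> T. isomorphic (total_cat \<A>) X Y)))"

text \<open>The pair \<open>(X, g)\<close> stands for \<open>X[g]\<close>. The degree convention comes from \<open>V[g]\<^sub>d = V\<^sub>d\<^sub>-\<^sub>g\<close>.\<close>

definition envelope ::
  "('o, 'm, 'k, 'g::ab_group_add) gr_cat \<Rightarrow> ('o \<times> 'g, 'm, 'k, 'g) gr_cat" where
  "envelope \<A> = \<lparr>GObj = GObj \<A> \<times> UNIV,
     HomD = (\<lambda>(X, g) (Y, h) d. HomD \<A> X Y (d - (h - g))),
     GIdm = (\<lambda>(X, g). GIdm \<A> X), GComp = GComp \<A>, GScale = GScale \<A>\<rparr>"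

definition shift :: "'o \<times> 'g::ab_group_add \<Rightarrow> 'g \<Rightarrow> 'o \<times> 'g" where
  "shift X h = (fst X, snd X + h)"

definition G_finitary_category ::
  "('o \<times> 'g, 'm::ab_group_add, 'k::field, 'g::ab_group_add) gr_cat \<Rightarrow> bool" where
  "G_finitary_category \<A> \<longleftrightarrow> (\<exists>\<D>. G_graded_finitary \<D> \<and> \<A> = envelope \<D>)"

text \<open>
  In \<open>degree_zero_cat (envelope \<D>)\<close> the objects \<open>(X, g)\<close> and \<open>(X, h)\<close> are in general not isomorphic, so
  additivity and idempotent completeness of that category do not follow from those of \<open>\<D>\<close>; where
  they are wanted they are separate hypotheses.
\<close>

section \<open>2-categories and 2-representations\<close>

text \<open>
  The type parameter \<open>'c\<close> is the type of hom-categories, linear or graded.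
  For \<open>F : i \<rightarrow> j\<close> and \<open>F' : j \<rightarrow> k\<close>, the composite \<open>F'F\<close> is \<open>HComp1 \<C> F' F\<close>.
\<close>

record ('i, 'f, 'm, 'c) two_cat =
  Ob :: "'i set"
  HomCat :: "'i \<Rightarrow> 'i \<Rightarrow> 'c"
  Unit1 :: "'i \<Rightarrow> 'f"
  HComp1 :: "'f \<Rightarrow> 'f \<Rightarrow> 'f"
  HComp2 :: "'m \<Rightarrow> 'm \<Rightarrow> 'm"

type_synonym ('i, 'f, 'm, 'k) lin_two_cat = "('i, 'f, 'm, ('f, 'm, 'k) lin_cat) two_cat"
type_synonym ('i, 'f, 'm, 'k, 'g) gr_two_cat = "('i, 'f, 'm, ('f, 'm, 'k, 'g) gr_cat) two_cat"

definition map_hom_cats ::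
  "('c \<Rightarrow> 'd) \<Rightarrow> ('i, 'f, 'm, 'c) two_cat \<Rightarrow> ('i, 'f, 'm, 'd) two_cat" where
  "map_hom_cats T \<C> = \<lparr>Ob = Ob \<C>, HomCat = (\<lambda>i j. T (HomCat \<C> i j)), Unit1 = Unit1 \<C>,
     HComp1 = HComp1 \<C>, HComp2 = HComp2 \<C>\<rparr>"

locale graded_two_category =
  fixes \<C> :: "('i, 'f, 'm::ab_group_add, 'k::field, 'g::ab_group_add) gr_two_cat"
  assumes hom_graded: "\<lbrakk>i \<in> Ob \<C>; j \<in> Ob \<C>\<rbrakk> \<Longrightarrow> graded_category (HomCat \<C> i j)"
    and Unit1_in: "i \<in> Ob \<C> \<Longrightarrow> Unit1 \<C> i \<in> GObj (HomCat \<C> i i)"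
    and HComp1_in: "\<lbrakk>i \<in> Ob \<C>; j \<in> Ob \<C>; k \<in> Ob \<C>;
        F \<in> GObj (HomCat \<C> i j); G \<in> GObj (HomCat \<C> j k)\<rbrakk> \<Longrightarrow> HComp1 \<C> G F \<in> GObj (HomCat \<C> i k)"
    and HComp2_degree: "\<lbrakk>i \<in> Ob \<C>; j \<in> Ob \<C>; k \<in> Ob \<C>;
        F \<in> GObj (HomCat \<C> i j); F' \<in> GObj (HomCat \<C> i j);
        G \<in> GObj (HomCat \<C> j k); G' \<in> GObj (HomCat \<C> j k);
        \<alpha> \<in> HomD (HomCat \<C> i j) F F' d; \<beta> \<in> HomD (HomCat \<C> j k) G G' e\<rbrakk>
      \<Longrightarrow> HComp2 \<C> \<beta> \<alpha> \<in> HomD (HomCat \<C> i k) (HComp1 \<C> G F) (HComp1 \<C> G' F') (e + d)"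
    and HComp2_add_left: "\<lbrakk>i \<in> Ob \<C>; j \<in> Ob \<C>; k \<in> Ob \<C>;
        F \<in> GObj (HomCat \<C> i j); F' \<in> GObj (HomCat \<C> i j);
        G \<in> GObj (HomCat \<C> j k); G' \<in> GObj (HomCat \<C> j k);
        \<alpha> \<in> Hom (total_cat (HomCat \<C> i j)) F F'; \<beta> \<in> Hom (total_cat (HomCat \<C> j k)) G G';
        \<beta>' \<in> Hom (total_cat (HomCat \<C> j k)) G G'\<rbrakk>
      \<Longrightarrow> HComp2 \<C> (\<beta> + \<beta>') \<alpha> = HComp2 \<C> \<beta> \<alpha> + HComp2 \<C> \<beta>' \<alpha>"
    and HComp2_add_right: "\<lbrakk>i \<in> Ob \<C>; j \<in> Ob \<C>; k \<in> Ob \<C>;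
        F \<in> GObj (HomCat \<C> i j); F' \<in> GObj (HomCat \<C> i j);
        G \<in> GObj (HomCat \<C> j k); G' \<in> GObj (HomCat \<C> j k);
        \<alpha> \<in> Hom (total_cat (HomCat \<C> i j)) F F'; \<alpha>' \<in> Hom (total_cat (HomCat \<C> i j)) F F';
        \<beta> \<in> Hom (total_cat (HomCat \<C> j k)) G G'\<rbrakk>
      \<Longrightarrow> HComp2 \<C> \<beta> (\<alpha> + \<alpha>') = HComp2 \<C> \<beta> \<alpha> + HComp2 \<C> \<beta> \<alpha>'"
    and HComp2_scale_left: "\<lbrakk>i \<in> Ob \<C>; j \<in> Ob \<C>; k \<in> Ob \<C>;
        F \<in> GObj (HomCat \<C> i j); F' \<in> GObj (HomCat \<C> i j);
        G \<in> GObj (HomCat \<C> j k); G' \<in> GObj (HomCat \<C> j k);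
        \<alpha> \<in> Hom (total_cat (HomCat \<C> i j)) F F'; \<beta> \<in> Hom (total_cat (HomCat \<C> j k)) G G'\<rbrakk>
      \<Longrightarrow> HComp2 \<C> (GScale (HomCat \<C> j k) a \<beta>) \<alpha> = GScale (HomCat \<C> i k) a (HComp2 \<C> \<beta> \<alpha>)"
    and HComp2_scale_right: "\<lbrakk>i \<in> Ob \<C>; j \<in> Ob \<C>; k \<in> Ob \<C>;
        F \<in> GObj (HomCat \<C> i j); F' \<in> GObj (HomCat \<C> i j);
        G \<in> GObj (HomCat \<C> j k); G' \<in> GObj (HomCat \<C> j k);
        \<alpha> \<in> Hom (total_cat (HomCat \<C> i j)) F F'; \<beta> \<in> Hom (total_cat (HomCat \<C> j k)) G G'\<rbrakk>
      \<Longrightarrow> HComp2 \<C> \<beta> (GScale (HomCat \<C> i j) a \<alpha>) = GScale (HomCat \<C> i k) a (HComp2 \<C> \<beta> \<alpha>)"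
    and HComp2_Idm: "\<lbrakk>i \<in> Ob \<C>; j \<in> Ob \<C>; k \<in> Ob \<C>;
        F \<in> GObj (HomCat \<C> i j); G \<in> GObj (HomCat \<C> j k)\<rbrakk>
      \<Longrightarrow> HComp2 \<C> (GIdm (HomCat \<C> j k) G) (GIdm (HomCat \<C> i j) F)
        = GIdm (HomCat \<C> i k) (HComp1 \<C> G F)"
    and interchange: "\<lbrakk>i \<in> Ob \<C>; j \<in> Ob \<C>; k \<in> Ob \<C>;
        F \<in> GObj (HomCat \<C> i j); F' \<in> GObj (HomCat \<C> i j); F'' \<in> GObj (HomCat \<C> i j);
        G \<in> GObj (HomCat \<C> j k); G' \<in> GObj (HomCat \<C> j k); G'' \<in> GObj (HomCat \<C> j k);
        \<alpha> \<in> Hom (total_cat (HomCat \<C> i j)) F F'; \<alpha>' \<in> Hom (total_cat (HomCat \<C> i j)) F' F'';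
        \<beta> \<in> Hom (total_cat (HomCat \<C> j k)) G G'; \<beta>' \<in> Hom (total_cat (HomCat \<C> j k)) G' G''\<rbrakk>
      \<Longrightarrow> HComp2 \<C> (GComp (HomCat \<C> j k) \<beta>' \<beta>) (GComp (HomCat \<C> i j) \<alpha>' \<alpha>)
        = GComp (HomCat \<C> i k) (HComp2 \<C> \<beta>' \<alpha>') (HComp2 \<C> \<beta> \<alpha>)"
    and HComp1_assoc: "\<lbrakk>i \<in> Ob \<C>; j \<in> Ob \<C>; k \<in> Ob \<C>; l \<in> Ob \<C>;
        F \<in> GObj (HomCat \<C> i j); G \<in> GObj (HomCat \<C> j k); H \<in> GObj (HomCat \<C> k l)\<rbrakk>
      \<Longrightarrow> HComp1 \<C> (HComp1 \<C> H G) F = HComp1 \<C> H (HComp1 \<C> G F)"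
    and HComp1_Unit1: "\<lbrakk>i \<in> Ob \<C>; j \<in> Ob \<C>; F \<in> GObj (HomCat \<C> i j)\<rbrakk>
      \<Longrightarrow> HComp1 \<C> F (Unit1 \<C> i) = F"
    and Unit1_HComp1: "\<lbrakk>i \<in> Ob \<C>; j \<in> Ob \<C>; F \<in> GObj (HomCat \<C> i j)\<rbrakk>
      \<Longrightarrow> HComp1 \<C> (Unit1 \<C> j) F = F"
    and HComp2_assoc: "\<lbrakk>i \<in> Ob \<C>; j \<in> Ob \<C>; k \<in> Ob \<C>; l \<in> Ob \<C>;
        F \<in> GObj (HomCat \<C> i j); F' \<in> GObj (HomCat \<C> i j);
        G \<in> GObj (HomCat \<C> j k); G' \<in> GObj (HomCat \<C> j k);
        H \<in> GObj (HomCat \<C> k l); H' \<in> GObj (HomCat \<C> k l);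
        \<alpha> \<in> Hom (total_cat (HomCat \<C> i j)) F F'; \<beta> \<in> Hom (total_cat (HomCat \<C> j k)) G G';
        \<gamma> \<in> Hom (total_cat (HomCat \<C> k l)) H H'\<rbrakk>
      \<Longrightarrow> HComp2 \<C> (HComp2 \<C> \<gamma> \<beta>) \<alpha> = HComp2 \<C> \<gamma> (HComp2 \<C> \<beta> \<alpha>)"
    and HComp2_Unit1: "\<lbrakk>i \<in> Ob \<C>; j \<in> Ob \<C>; F \<in> GObj (HomCat \<C> i j); F' \<in> GObj (HomCat \<C> i j);
        \<alpha> \<in> Hom (total_cat (HomCat \<C> i j)) F F'\<rbrakk>
      \<Longrightarrow> HComp2 \<C> \<alpha> (GIdm (HomCat \<C> i i) (Unit1 \<C> i)) = \<alpha>"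
    and Unit1_HComp2: "\<lbrakk>i \<in> Ob \<C>; j \<in> Ob \<C>; F \<in> GObj (HomCat \<C> i j); F' \<in> GObj (HomCat \<C> i j);
        \<alpha> \<in> Hom (total_cat (HomCat \<C> i j)) F F'\<rbrakk>
      \<Longrightarrow> HComp2 \<C> (GIdm (HomCat \<C> j j) (Unit1 \<C> j)) \<alpha> = \<alpha>"

definition envelope2 ::
  "('i, 'f, 'm, 'k, 'g::ab_group_add) gr_two_cat \<Rightarrow> ('i, 'f \<times> 'g, 'm, 'k, 'g) gr_two_cat" where
  "envelope2 \<D> = \<lparr>Ob = Ob \<D>, HomCat = (\<lambda>i j. envelope (HomCat \<D> i j)),
     Unit1 = (\<lambda>i. (Unit1 \<D> i, 0)),
     HComp1 = (\<lambda>(X, g) (Y, h). (HComp1 \<D> X Y, g + h)),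
     HComp2 = HComp2 \<D>\<rparr>"

definition locally_G_finitary_2category ::
  "('i, 'f \<times> 'g, 'm::ab_group_add, 'k::field, 'g::ab_group_add) gr_two_cat \<Rightarrow> bool" where
  "locally_G_finitary_2category \<C> \<longleftrightarrow> (\<exists>\<D>. graded_two_category \<D> \<and> countable (Ob \<D>) \<and>
     (\<forall>i \<in> Ob \<D>. \<forall>j \<in> Ob \<D>. G_graded_finitary (HomCat \<D> i j)) \<and>
     (\<forall>i \<in> Ob \<D>. indecomposable (total_cat (HomCat \<D> i i)) (Unit1 \<D> i)) \<and>
     \<C> = envelope2 \<D>)"

definition restricted :: "('i, 'f, 'm::ab_group_add, 'k::field, 'g) gr_two_cat \<Rightarrow> bool" where
  "restricted \<C> \<longleftrightarrow> (\<forall>i \<in> Ob \<C>. \<forall>j \<in> Ob \<C>. \<forall>F \<in> GObj (HomCat \<C> i j). \<forall>G \<in> GObj (HomCat \<C> i j).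
     finite_dim (GScale (HomCat \<C> i j)) (Hom (total_cat (HomCat \<C> i j)) F G))"

text \<open>
  For a 1-morphism \<open>F : i \<rightarrow> j\<close>, the functor \<open>M(F)\<close> sends \<open>X\<close> to \<open>MObj M i j F X\<close> and \<open>f : X \<rightarrow> Y\<close> to
  \<open>MMor M i j F X Y f\<close>; for \<open>\<alpha> : F \<rightarrow> G\<close>, the component of \<open>M(\<alpha>)\<close> at \<open>X\<close> is \<open>MNat M i j F G \<alpha> X\<close>.
  Source and target are arguments because a morphism does not determine them.
\<close>

record ('i, 'f, 'm, 'x, 'n, 'c) two_rep =
  MCat :: "'i \<Rightarrow> 'c"
  MObj :: "'i \<Rightarrow> 'i \<Rightarrow> 'f \<Rightarrow> 'x \<Rightarrow> 'x"
  MMor :: "'i \<Rightarrow> 'i \<Rightarrow> 'f \<Rightarrow> 'x \<Rightarrow> 'x \<Rightarrow> 'n \<Rightarrow> 'n"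
  MNat :: "'i \<Rightarrow> 'i \<Rightarrow> 'f \<Rightarrow> 'f \<Rightarrow> 'm \<Rightarrow> 'x \<Rightarrow> 'n"

type_synonym ('i, 'f, 'm, 'x, 'n, 'k) lin_two_rep =
  "('i, 'f, 'm, 'x, 'n, ('x, 'n, 'k) lin_cat) two_rep"
type_synonym ('i, 'f, 'm, 'x, 'n, 'k, 'g) gr_two_rep =
  "('i, 'f, 'm, 'x, 'n, ('x, 'n, 'k, 'g) gr_cat) two_rep"

definition map_rep_cats ::
  "('c \<Rightarrow> 'd) \<Rightarrow> ('i, 'f, 'm, 'x, 'n, 'c) two_rep \<Rightarrow> ('i, 'f, 'm, 'x, 'n, 'd) two_rep" where
  "map_rep_cats T M = \<lparr>MCat = (\<lambda>i. T (MCat M i)), MObj = MObj M, MMor = MMor M, MNat = MNat M\<rparr>"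

locale G_finitary_2representation =
  fixes \<C> :: "('i, 'f \<times> 'g, 'm::ab_group_add, 'k::field, 'g::ab_group_add) gr_two_cat"
    and M :: "('i, 'f \<times> 'g, 'm, 'x \<times> 'g, 'n::ab_group_add, 'k, 'g) gr_two_rep"
  assumes M_finitary: "i \<in> Ob \<C> \<Longrightarrow> G_finitary_category (MCat M i)"
    and MObj_in: "\<lbrakk>i \<in> Ob \<C>; j \<in> Ob \<C>; F \<in> GObj (HomCat \<C> i j); X \<in> GObj (MCat M i)\<rbrakk>
      \<Longrightarrow> MObj M i j F X \<in> GObj (MCat M j)"
    and MMor_degree: "\<lbrakk>i \<in> Ob \<C>; j \<in> Ob \<C>; F \<in> GObj (HomCat \<C> i j);
        X \<in> GObj (MCat M i); Y \<in> GObj (MCat M i); f \<in> HomD (MCat M i) X Y d\<rbrakk>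
      \<Longrightarrow> MMor M i j F X Y f \<in> HomD (MCat M j) (MObj M i j F X) (MObj M i j F Y) d"
    and MMor_add: "\<lbrakk>i \<in> Ob \<C>; j \<in> Ob \<C>; F \<in> GObj (HomCat \<C> i j);
        X \<in> GObj (MCat M i); Y \<in> GObj (MCat M i);
        f \<in> Hom (total_cat (MCat M i)) X Y; f' \<in> Hom (total_cat (MCat M i)) X Y\<rbrakk>
      \<Longrightarrow> MMor M i j F X Y (f + f') = MMor M i j F X Y f + MMor M i j F X Y f'"
    and MMor_scale: "\<lbrakk>i \<in> Ob \<C>; j \<in> Ob \<C>; F \<in> GObj (HomCat \<C> i j);
        X \<in> GObj (MCat M i); Y \<in> GObj (MCat M i); f \<in> Hom (total_cat (MCat M i)) X Y\<rbrakk>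
      \<Longrightarrow> MMor M i j F X Y (GScale (MCat M i) a f) = GScale (MCat M j) a (MMor M i j F X Y f)"
    and MMor_Idm: "\<lbrakk>i \<in> Ob \<C>; j \<in> Ob \<C>; F \<in> GObj (HomCat \<C> i j); X \<in> GObj (MCat M i)\<rbrakk>
      \<Longrightarrow> MMor M i j F X X (GIdm (MCat M i) X) = GIdm (MCat M j) (MObj M i j F X)"
    and MMor_Comp: "\<lbrakk>i \<in> Ob \<C>; j \<in> Ob \<C>; F \<in> GObj (HomCat \<C> i j);
        X \<in> GObj (MCat M i); Y \<in> GObj (MCat M i); Z \<in> GObj (MCat M i);
        f \<in> Hom (total_cat (MCat M i)) X Y; g \<in> Hom (total_cat (MCat M i)) Y Z\<rbrakk>
      \<Longrightarrow> MMor M i j F X Z (GComp (MCat M i) g f)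
        = GComp (MCat M j) (MMor M i j F Y Z g) (MMor M i j F X Y f)"
    and MObj_shift: "\<lbrakk>i \<in> Ob \<C>; j \<in> Ob \<C>; F \<in> GObj (HomCat \<C> i j); X \<in> GObj (MCat M i)\<rbrakk>
      \<Longrightarrow> MObj M i j F (shift X s) = shift (MObj M i j F X) s"
    and MNat_degree: "\<lbrakk>i \<in> Ob \<C>; j \<in> Ob \<C>; F \<in> GObj (HomCat \<C> i j); G \<in> GObj (HomCat \<C> i j);
        \<alpha> \<in> HomD (HomCat \<C> i j) F G d; X \<in> GObj (MCat M i)\<rbrakk>
      \<Longrightarrow> MNat M i j F G \<alpha> X \<in> HomD (MCat M j) (MObj M i j F X) (MObj M i j G X) d"
    and MNat_natural: "\<lbrakk>i \<in> Ob \<C>; j \<in> Ob \<C>; F \<in> GObj (HomCat \<C> i j); G \<in> GObj (HomCat \<C> i j);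
        \<alpha> \<in> Hom (total_cat (HomCat \<C> i j)) F G;
        X \<in> GObj (MCat M i); Y \<in> GObj (MCat M i); f \<in> Hom (total_cat (MCat M i)) X Y\<rbrakk>
      \<Longrightarrow> GComp (MCat M j) (MNat M i j F G \<alpha> Y) (MMor M i j F X Y f)
        = GComp (MCat M j) (MMor M i j G X Y f) (MNat M i j F G \<alpha> X)"
    and MNat_add: "\<lbrakk>i \<in> Ob \<C>; j \<in> Ob \<C>; F \<in> GObj (HomCat \<C> i j); G \<in> GObj (HomCat \<C> i j);
        \<alpha> \<in> Hom (total_cat (HomCat \<C> i j)) F G; \<beta> \<in> Hom (total_cat (HomCat \<C> i j)) F G; X \<in> GObj (MCat M i)\<rbrakk>
      \<Longrightarrow> MNat M i j F G (\<alpha> + \<beta>) X = MNat M i j F G \<alpha> X + MNat M i j F G \<beta> X"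
    and MNat_scale: "\<lbrakk>i \<in> Ob \<C>; j \<in> Ob \<C>; F \<in> GObj (HomCat \<C> i j); G \<in> GObj (HomCat \<C> i j);
        \<alpha> \<in> Hom (total_cat (HomCat \<C> i j)) F G; X \<in> GObj (MCat M i)\<rbrakk>
      \<Longrightarrow> MNat M i j F G (GScale (HomCat \<C> i j) a \<alpha>) X = GScale (MCat M j) a (MNat M i j F G \<alpha> X)"
    and MNat_Idm: "\<lbrakk>i \<in> Ob \<C>; j \<in> Ob \<C>; F \<in> GObj (HomCat \<C> i j); X \<in> GObj (MCat M i)\<rbrakk>
      \<Longrightarrow> MNat M i j F F (GIdm (HomCat \<C> i j) F) X = GIdm (MCat M j) (MObj M i j F X)"
    and MNat_Comp: "\<lbrakk>i \<in> Ob \<C>; j \<in> Ob \<C>;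
        F \<in> GObj (HomCat \<C> i j); G \<in> GObj (HomCat \<C> i j); H \<in> GObj (HomCat \<C> i j);
        \<alpha> \<in> Hom (total_cat (HomCat \<C> i j)) F G; \<beta> \<in> Hom (total_cat (HomCat \<C> i j)) G H; X \<in> GObj (MCat M i)\<rbrakk>
      \<Longrightarrow> MNat M i j F H (GComp (HomCat \<C> i j) \<beta> \<alpha>) X
        = GComp (MCat M j) (MNat M i j G H \<beta> X) (MNat M i j F G \<alpha> X)"
    and MObj_Unit1: "\<lbrakk>i \<in> Ob \<C>; X \<in> GObj (MCat M i)\<rbrakk> \<Longrightarrow> MObj M i i (Unit1 \<C> i) X = X"
    and MMor_Unit1: "\<lbrakk>i \<in> Ob \<C>; X \<in> GObj (MCat M i); Y \<in> GObj (MCat M i);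
        f \<in> Hom (total_cat (MCat M i)) X Y\<rbrakk> \<Longrightarrow> MMor M i i (Unit1 \<C> i) X Y f = f"
    and MObj_HComp1: "\<lbrakk>i \<in> Ob \<C>; j \<in> Ob \<C>; k \<in> Ob \<C>;
        F \<in> GObj (HomCat \<C> i j); G \<in> GObj (HomCat \<C> j k); X \<in> GObj (MCat M i)\<rbrakk>
      \<Longrightarrow> MObj M i k (HComp1 \<C> G F) X = MObj M j k G (MObj M i j F X)"
    and MMor_HComp1: "\<lbrakk>i \<in> Ob \<C>; j \<in> Ob \<C>; k \<in> Ob \<C>;
        F \<in> GObj (HomCat \<C> i j); G \<in> GObj (HomCat \<C> j k);
        X \<in> GObj (MCat M i); Y \<in> GObj (MCat M i); f \<in> Hom (total_cat (MCat M i)) X Y\<rbrakk>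
      \<Longrightarrow> MMor M i k (HComp1 \<C> G F) X Y f
        = MMor M j k G (MObj M i j F X) (MObj M i j F Y) (MMor M i j F X Y f)"
    and MNat_HComp2: "\<lbrakk>i \<in> Ob \<C>; j \<in> Ob \<C>; k \<in> Ob \<C>;
        F \<in> GObj (HomCat \<C> i j); F' \<in> GObj (HomCat \<C> i j);
        G \<in> GObj (HomCat \<C> j k); G' \<in> GObj (HomCat \<C> j k);
        \<alpha> \<in> Hom (total_cat (HomCat \<C> i j)) F F'; \<beta> \<in> Hom (total_cat (HomCat \<C> j k)) G G';
        X \<in> GObj (MCat M i)\<rbrakk>
      \<Longrightarrow> MNat M i k (HComp1 \<C> G F) (HComp1 \<C> G' F') (HComp2 \<C> \<beta> \<alpha>) X
        = GComp (MCat M k) (MNat M j k G G' \<beta> (MObj M i j F' X))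
            (MMor M j k G (MObj M i j F X) (MObj M i j F' X) (MNat M i j F F' \<alpha> X))"
    and MObj_shift1: "\<lbrakk>i \<in> Ob \<C>; j \<in> Ob \<C>; F \<in> GObj (HomCat \<C> i j); X \<in> GObj (MCat M i)\<rbrakk>
      \<Longrightarrow> MObj M i j (shift F s) X = shift (MObj M i j F X) s"
    and MMor_shift1: "\<lbrakk>i \<in> Ob \<C>; j \<in> Ob \<C>; F \<in> GObj (HomCat \<C> i j);
        X \<in> GObj (MCat M i); Y \<in> GObj (MCat M i); f \<in> Hom (total_cat (MCat M i)) X Y\<rbrakk>
      \<Longrightarrow> MMor M i j (shift F s) X Y f = MMor M i j F X Y f"

text \<open>The action of \<open>\<C>\<close> on \<open>\<C>(i,-)\<close> by composition.\<close>

definition principal ::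
  "('i, 'f, 'm, 'k) lin_two_cat \<Rightarrow> 'i \<Rightarrow> ('i, 'f, 'm, 'f, 'm, 'k) lin_two_rep" where
  "principal \<C> i = \<lparr>MCat = (\<lambda>j. HomCat \<C> i j),
     MObj = (\<lambda>j k F X. HComp1 \<C> F X),
     MMor = (\<lambda>j k F X Y f. HComp2 \<C> (Idm (HomCat \<C> j k) F) f),
     MNat = (\<lambda>j k F G \<alpha> X. HComp2 \<C> \<alpha> (Idm (HomCat \<C> i j) X))\<rparr>"

section \<open>Injective fan Freyd abelianisation\<close>

text \<open>
  The object \<open>(X, k, Y\<^sub>i, f\<^sub>i)\<close> is encoded as \<open>(X, [(Y\<^sub>1, f\<^sub>1), \<dots>, (Y\<^sub>k, f\<^sub>k)])\<close>, i.e. the zero objects \<open>Y\<^sub>i\<close>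
  with \<open>i > k\<close> are dropped; indices start at 0. Fans that differ only by trailing zero objects are
  isomorphic rather than equal, which keeps the composition below well-defined and strictly
  associative.
\<close>

type_synonym ('o, 'm) fan = "'o \<times> ('o \<times> 'm) list"

abbreviation apex :: "('o, 'm) fan \<Rightarrow> 'o" where "apex P \<equiv> fst P"
abbreviation width :: "('o, 'm) fan \<Rightarrow> nat" where "width P \<equiv> length (snd P)"
abbreviation tgt :: "('o, 'm) fan \<Rightarrow> nat \<Rightarrow> 'o" where "tgt P i \<equiv> fst (snd P ! i)"
abbreviation leg :: "('o, 'm) fan \<Rightarrow> nat \<Rightarrow> 'm" where "leg P i \<equiv> snd (snd P ! i)"

definition fan_Obj :: "('o, 'm, 'k) lin_cat \<Rightarrow> ('o, 'm) fan set" where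
  "fan_Obj \<A> = {P. apex P \<in> Obj \<A> \<and>
     (\<forall>i < width P. tgt P i \<in> Obj \<A> \<and> leg P i \<in> Hom \<A> (apex P) (tgt P i))}"

text \<open>Tuples \<open>(g, h)\<close> with \<open>h i j : Y\<^sub>i \<rightarrow> Y'\<^sub>j\<close>; values of \<open>h\<close> outside the two widths are irrelevant.\<close>

type_synonym 'm fan_tuple = "'m \<times> (nat \<Rightarrow> nat \<Rightarrow> 'm)"

definition fan_tuples ::
  "('o, 'm::ab_group_add, 'k) lin_cat \<Rightarrow> ('o, 'm) fan \<Rightarrow> ('o, 'm) fan \<Rightarrow> 'm fan_tuple set" where
  "fan_tuples \<A> P Q = {(g, h). g \<in> Hom \<A> (apex P) (apex Q) \<and>
     (\<forall>i < width P. \<forall>j < width Q. h i j \<in> Hom \<A> (tgt P i) (tgt Q j)) \<and>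
     (\<forall>i < width Q. Comp \<A> (leg Q i) g = (\<Sum>j < width P. Comp \<A> (h j i) (leg P j)))}"

definition fan_null ::
  "('o, 'm::ab_group_add, 'k) lin_cat \<Rightarrow> ('o, 'm) fan \<Rightarrow> ('o, 'm) fan \<Rightarrow> 'm set" where
  "fan_null \<A> P Q = {\<Sum>i < width P. Comp \<A> (q i) (leg P i) | q.
     \<forall>i < width P. q i \<in> Hom \<A> (tgt P i) (apex Q)}"

definition fan_rel ::
  "('o, 'm::ab_group_add, 'k) lin_cat \<Rightarrow> ('o, 'm) fan \<Rightarrow> ('o, 'm) fan
    \<Rightarrow> ('m fan_tuple \<times> 'm fan_tuple) set" where
  "fan_rel \<A> P Q = {(s, t). s \<in> fan_tuples \<A> P Q \<and> t \<in> fan_tuples \<A> P Q \<and>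
     fst s - fst t \<in> fan_null \<A> P Q}"

definition fan_Hom ::
  "('o, 'm::ab_group_add, 'k) lin_cat \<Rightarrow> ('o, 'm) fan \<Rightarrow> ('o, 'm) fan \<Rightarrow> 'm fan_tuple set set" where
  "fan_Hom \<A> P Q = fan_tuples \<A> P Q // fan_rel \<A> P Q"

definition fan_Id :: "('o, 'm::ab_group_add, 'k) lin_cat \<Rightarrow> ('o, 'm) fan \<Rightarrow> 'm fan_tuple set" where
  "fan_Id \<A> P = fan_rel \<A> P P `` {(Idm \<A> (apex P), \<lambda>i j. if i = j then Idm \<A> (tgt P i) else 0)}"

text \<open>\<open>fan_Comp \<A> P Q R d c\<close> is the composite of \<open>c : P \<rightarrow> Q\<close> and \<open>d : Q \<rightarrow> R\<close>.\<close>

definition fan_Comp ::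
  "('o, 'm::ab_group_add, 'k) lin_cat \<Rightarrow> ('o, 'm) fan \<Rightarrow> ('o, 'm) fan \<Rightarrow> ('o, 'm) fan
    \<Rightarrow> 'm fan_tuple set \<Rightarrow> 'm fan_tuple set \<Rightarrow> 'm fan_tuple set" where
  "fan_Comp \<A> P Q R d c = (\<Union>(g', h') \<in> d. \<Union>(g, h) \<in> c. fan_rel \<A> P R ``
     {(Comp \<A> g' g, \<lambda>i l. \<Sum>j < width Q. Comp \<A> (h' j l) (h i j))})"

definition fan_add ::
  "('o, 'm::ab_group_add, 'k) lin_cat \<Rightarrow> ('o, 'm) fan \<Rightarrow> ('o, 'm) fan
    \<Rightarrow> 'm fan_tuple set \<Rightarrow> 'm fan_tuple set \<Rightarrow> 'm fan_tuple set" where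
  "fan_add \<A> P Q c d = (\<Union>(g, h) \<in> c. \<Union>(g', h') \<in> d. fan_rel \<A> P Q ``
     {(g + g', \<lambda>i j. h i j + h' i j)})"

definition fan_scale ::
  "('o, 'm::ab_group_add, 'k) lin_cat \<Rightarrow> ('o, 'm) fan \<Rightarrow> ('o, 'm) fan
    \<Rightarrow> 'k \<Rightarrow> 'm fan_tuple set \<Rightarrow> 'm fan_tuple set" where
  "fan_scale \<A> P Q a c = (\<Union>(g, h) \<in> c. fan_rel \<A> P Q ``
     {(Scale \<A> a g, \<lambda>i j. Scale \<A> a (h i j))})"

definition fan_iso ::
  "('o, 'm::ab_group_add, 'k) lin_cat \<Rightarrow> ('o, 'm) fan \<Rightarrow> ('o, 'm) fan \<Rightarrow> 'm fan_tuple set \<Rightarrow> bool" where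
  "fan_iso \<A> P Q c \<longleftrightarrow> c \<in> fan_Hom \<A> P Q \<and> (\<exists>d \<in> fan_Hom \<A> Q P.
     fan_Comp \<A> P Q P d c = fan_Id \<A> P \<and> fan_Comp \<A> Q P Q c d = fan_Id \<A> Q)"

definition fan_isomorphic ::
  "('o, 'm::ab_group_add, 'k) lin_cat \<Rightarrow> ('o, 'm) fan \<Rightarrow> ('o, 'm) fan \<Rightarrow> bool" where
  "fan_isomorphic \<A> P Q \<longleftrightarrow> (\<exists>c. fan_iso \<A> P Q c)"

definition homogeneous_zero ::
  "('o, 'm, 'k, 'g::zero) gr_cat \<Rightarrow> ('o, 'm) fan \<Rightarrow> ('o, 'm) fan \<Rightarrow> 'm fan_tuple set \<Rightarrow> bool" where
  "homogeneous_zero \<A> P Q c \<longleftrightarrow> (\<exists>(g, h) \<in> c. g \<in> HomD \<A> (apex P) (apex Q) 0 \<and>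
     (\<forall>i < width P. \<forall>j < width Q. h i j \<in> HomD \<A> (tgt P i) (tgt Q j) 0))"

text \<open>
  The functor induced by the inclusion of the degree-zero part is the identity on fans: a fan with
  homogeneous legs of degree zero is, as it stands, a fan over the whole category.
\<close>

lemma fan_Obj_degree_zero:
  assumes "graded_category \<A>"
  shows "fan_Obj (degree_zero_cat \<A>) \<subseteq> fan_Obj (total_cat \<A>)"
proof -
  interpret graded_category \<A> by fact
  interpret V: vector_space "GScale \<A>" using Scale_vector_space by (simp add: total_cat_def)
  have "HomD \<A> X Y 0 \<subseteq> V.span (\<Union>d. HomD \<A> X Y d)" for X Y
    by (auto intro: V.span_base)
  then show ?thesis by (auto simp: fan_Obj_def degree_zero_cat_def total_cat_def)
qed

section \<open>The action of the abelianised 2-category\<close>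

text \<open>
  Fans \<open>H\<close> over \<open>\<C>(i,j)\<close> act on fans \<open>P\<close> over \<open>M(i)\<close>: \<open>act_obj\<close> gives \<open>HP\<close>, \<open>act_mor\<close> gives \<open>Hc : HP \<rightarrow> HP'\<close> for
  \<open>c : P \<rightarrow> P'\<close>, and \<open>act_nat\<close> gives the component \<open>HP \<rightarrow> H'P\<close> at \<open>P\<close> of \<open>c : H \<rightarrow> H'\<close>. The legs of \<open>HP\<close>
  are those coming from \<open>H\<close> followed by those coming from \<open>P\<close>; the matrices \<open>h\<close> are block diagonal
  with respect to this decomposition.
\<close>

definition act_obj ::
  "('i, 'f, 'm, 'x, 'n, 'c) two_rep \<Rightarrow> 'i \<Rightarrow> 'i \<Rightarrow> ('f, 'm) fan \<Rightarrow> ('x, 'n) fan \<Rightarrow> ('x, 'n) fan" where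
  "act_obj M i j H P = (MObj M i j (apex H) (apex P),
     map (\<lambda>(Y, f). (MObj M i j Y (apex P), MNat M i j (apex H) Y f (apex P))) (snd H) @
     map (\<lambda>(Q, p). (MObj M i j (apex H) Q, MMor M i j (apex H) (apex P) Q p)) (snd P))"

definition act_mor ::
  "('i, 'f, 'm, 'x, 'n::ab_group_add, 'k) lin_two_rep \<Rightarrow> 'i \<Rightarrow> 'i \<Rightarrow> ('f, 'm) fan
    \<Rightarrow> ('x, 'n) fan \<Rightarrow> ('x, 'n) fan \<Rightarrow> 'n fan_tuple set \<Rightarrow> 'n fan_tuple set" where
  "act_mor M i j H P P' c = (\<Union>(g, h) \<in> c.
     fan_rel (MCat M j) (act_obj M i j H P) (act_obj M i j H P') ``
       {(MMor M i j (apex H) (apex P) (apex P') g,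
         \<lambda>a b. if a < width H \<and> b < width H
               then (if a = b then MMor M i j (tgt H a) (apex P) (apex P') g else 0)
               else if width H \<le> a \<and> width H \<le> b
               then MMor M i j (apex H) (tgt P (a - width H)) (tgt P' (b - width H))
                      (h (a - width H) (b - width H))
               else 0)})"

definition act_nat ::
  "('i, 'f, 'm, 'x, 'n::ab_group_add, 'k) lin_two_rep \<Rightarrow> 'i \<Rightarrow> 'i \<Rightarrow> ('f, 'm) fan
    \<Rightarrow> ('f, 'm) fan \<Rightarrow> 'm fan_tuple set \<Rightarrow> ('x, 'n) fan \<Rightarrow> 'n fan_tuple set" where
  "act_nat M i j H H' c P = (\<Union>(g, h) \<in> c.
     fan_rel (MCat M j) (act_obj M i j H P) (act_obj M i j H' P) ``
       {(MNat M i j (apex H) (apex H') g (apex P),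
         \<lambda>a b. if a < width H \<and> b < width H'
               then MNat M i j (tgt H a) (tgt H' b) (h a b) (apex P)
               else if width H \<le> a \<and> width H' \<le> b
               then (if a - width H = b - width H'
                     then MNat M i j (apex H) (apex H') g (tgt P (a - width H)) else 0)
               else 0)})"

text \<open>
  Composition of 1-morphisms in the abelianised \<open>\<C>(i,i)\<close> is its action on itself. For
  \<open>c : H \<rightarrow> H'\<close> and \<open>d : K \<rightarrow> K'\<close> the horizontal composite is \<open>(cK')(Hd) : HK \<rightarrow> H'K'\<close>.
\<close>

abbreviation fan_HComp ::
  "('i, 'f, 'm, 'k) lin_two_cat \<Rightarrow> 'i \<Rightarrow> ('f, 'm) fan \<Rightarrow> ('f, 'm) fan \<Rightarrow> ('f, 'm) fan" where
  "fan_HComp \<C> i H K \<equiv> act_obj (principal \<C> i) i i H K"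

abbreviation fan_whisker_left ::
  "('i, 'f, 'm::ab_group_add, 'k) lin_two_cat \<Rightarrow> 'i \<Rightarrow> ('f, 'm) fan \<Rightarrow> ('f, 'm) fan \<Rightarrow> ('f, 'm) fan
    \<Rightarrow> 'm fan_tuple set \<Rightarrow> 'm fan_tuple set" where
  "fan_whisker_left \<C> i H K K' d \<equiv> act_mor (principal \<C> i) i i H K K' d"

abbreviation fan_whisker_right ::
  "('i, 'f, 'm::ab_group_add, 'k) lin_two_cat \<Rightarrow> 'i \<Rightarrow> ('f, 'm) fan \<Rightarrow> ('f, 'm) fan
    \<Rightarrow> 'm fan_tuple set \<Rightarrow> ('f, 'm) fan \<Rightarrow> 'm fan_tuple set" where
  "fan_whisker_right \<C> i H H' c K \<equiv> act_nat (principal \<C> i) i i H H' c K"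

abbreviation fan_unit :: "('i, 'f, 'm, 'k) lin_two_cat \<Rightarrow> 'i \<Rightarrow> ('f, 'm) fan" where
  "fan_unit \<C> i \<equiv> (Unit1 \<C> i, [])"

definition coalgebra ::
  "('i, 'f, 'm::ab_group_add, 'k) lin_two_cat \<Rightarrow> 'i \<Rightarrow> ('f, 'm) fan
    \<Rightarrow> 'm fan_tuple set \<Rightarrow> 'm fan_tuple set \<Rightarrow> bool" where
  "coalgebra \<C> i A \<delta> \<epsilon> \<longleftrightarrow>
     (let \<A> = HomCat \<C> i i; I = fan_unit \<C> i; AA = fan_HComp \<C> i A A; AAA = fan_HComp \<C> i A AA in
      A \<in> fan_Obj \<A> \<and> \<delta> \<in> fan_Hom \<A> A AA \<and> \<epsilon> \<in> fan_Hom \<A> A I \<and>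
      fan_Comp \<A> A AA AAA (fan_whisker_right \<C> i A AA \<delta> A) \<delta>
        = fan_Comp \<A> A AA AAA (fan_whisker_left \<C> i A A AA \<delta>) \<delta> \<and>
      fan_Comp \<A> A AA A (fan_whisker_right \<C> i A I \<epsilon> A) \<delta> = fan_Id \<A> A \<and>
      fan_Comp \<A> A AA A (fan_whisker_left \<C> i A A I \<epsilon>) \<delta> = fan_Id \<A> A)"

definition coalgebra_iso ::
  "('i, 'f, 'm::ab_group_add, 'k) lin_two_cat \<Rightarrow> 'i
    \<Rightarrow> ('f, 'm) fan \<Rightarrow> 'm fan_tuple set \<Rightarrow> 'm fan_tuple set
    \<Rightarrow> ('f, 'm) fan \<Rightarrow> 'm fan_tuple set \<Rightarrow> 'm fan_tuple set \<Rightarrow> 'm fan_tuple set \<Rightarrow> bool" where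
  "coalgebra_iso \<C> i A \<delta> \<epsilon> B \<delta>' \<epsilon>' \<theta> \<longleftrightarrow>
     (let \<A> = HomCat \<C> i i; I = fan_unit \<C> i; AA = fan_HComp \<C> i A A; AB = fan_HComp \<C> i A B;
          BB = fan_HComp \<C> i B B in
      fan_iso \<A> A B \<theta> \<and>
      fan_Comp \<A> A B BB \<delta>' \<theta>
        = fan_Comp \<A> A AA BB
            (fan_Comp \<A> AA AB BB (fan_whisker_right \<C> i A B \<theta> B) (fan_whisker_left \<C> i A A B \<theta>)) \<delta> \<and>
      fan_Comp \<A> A B I \<epsilon>' \<theta> = \<epsilon>)"

section \<open>Internal homs\<close>

text \<open>
  \<open>internal_hom \<C> M i S A \<phi>\<close>: the fan \<open>A\<close> over \<open>\<C>(i,i)\<close> is \<open>[S,S]\<close>, with representing natural linear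
  isomorphism \<open>\<phi> H : Hom(A, H) \<rightarrow> Hom(S, HS)\<close>. The object \<open>S\<close> is viewed as the fan \<open>(S, [])\<close>.
\<close>

definition internal_hom ::
  "('i, 'f, 'm::ab_group_add, 'k) lin_two_cat
    \<Rightarrow> ('i, 'f, 'm, 'x, 'n::ab_group_add, 'k) lin_two_rep \<Rightarrow> 'i \<Rightarrow> 'x
    \<Rightarrow> ('f, 'm) fan \<Rightarrow> (('f, 'm) fan \<Rightarrow> 'm fan_tuple set \<Rightarrow> 'n fan_tuple set) \<Rightarrow> bool" where
  "internal_hom \<C> M i S A \<phi> \<longleftrightarrow>
     (let \<A> = HomCat \<C> i i; \<B> = MCat M i; S' = (S, []) in
      A \<in> fan_Obj \<A> \<and>
      (\<forall>H \<in> fan_Obj \<A>.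
         bij_betw (\<phi> H) (fan_Hom \<A> A H) (fan_Hom \<B> S' (act_obj M i i H S')) \<and>
         (\<forall>c \<in> fan_Hom \<A> A H. \<forall>d \<in> fan_Hom \<A> A H.
            \<phi> H (fan_add \<A> A H c d) = fan_add \<B> S' (act_obj M i i H S') (\<phi> H c) (\<phi> H d)) \<and>
         (\<forall>a. \<forall>c \<in> fan_Hom \<A> A H.
            \<phi> H (fan_scale \<A> A H a c) = fan_scale \<B> S' (act_obj M i i H S') a (\<phi> H c))) \<and>
      (\<forall>H \<in> fan_Obj \<A>. \<forall>H' \<in> fan_Obj \<A>. \<forall>c \<in> fan_Hom \<A> A H. \<forall>\<psi> \<in> fan_Hom \<A> H H'.
         \<phi> H' (fan_Comp \<A> A H H' \<psi> c)
           = fan_Comp \<B> S' (act_obj M i i H S') (act_obj M i i H' S')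
               (act_nat M i i H H' \<psi> S') (\<phi> H c)))"

definition coev ::
  "('i, 'f, 'm::ab_group_add, 'k) lin_two_cat \<Rightarrow> 'i \<Rightarrow> ('f, 'm) fan
    \<Rightarrow> (('f, 'm) fan \<Rightarrow> 'm fan_tuple set \<Rightarrow> 'n fan_tuple set) \<Rightarrow> 'n fan_tuple set" where
  "coev \<C> i A \<phi> = \<phi> A (fan_Id (HomCat \<C> i i) A)"

definition comult ::
  "('i, 'f, 'm::ab_group_add, 'k) lin_two_cat
    \<Rightarrow> ('i, 'f, 'm, 'x, 'n::ab_group_add, 'k) lin_two_rep \<Rightarrow> 'i \<Rightarrow> 'x
    \<Rightarrow> ('f, 'm) fan \<Rightarrow> (('f, 'm) fan \<Rightarrow> 'm fan_tuple set \<Rightarrow> 'n fan_tuple set)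
    \<Rightarrow> 'm fan_tuple set" where
  "comult \<C> M i S A \<phi> =
     (let \<A> = HomCat \<C> i i; S' = (S, []); AA = fan_HComp \<C> i A A;
          AS = act_obj M i i A S'; AAS = act_obj M i i A AS in
      inv_into (fan_Hom \<A> A AA) (\<phi> AA)
        (fan_Comp (MCat M i) S' AS AAS (act_mor M i i A S' AS (coev \<C> i A \<phi>)) (coev \<C> i A \<phi>)))"

definition counit ::
  "('i, 'f, 'm::ab_group_add, 'k) lin_two_cat
    \<Rightarrow> ('i, 'f, 'm, 'x, 'n::ab_group_add, 'k) lin_two_rep \<Rightarrow> 'i \<Rightarrow> 'x
    \<Rightarrow> ('f, 'm) fan \<Rightarrow> (('f, 'm) fan \<Rightarrow> 'm fan_tuple set \<Rightarrow> 'n fan_tuple set)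
    \<Rightarrow> 'm fan_tuple set" where
  "counit \<C> M i S A \<phi> = inv_into (fan_Hom (HomCat \<C> i i) A (fan_unit \<C> i)) (\<phi> (fan_unit \<C> i))
     (fan_Id (MCat M i) (S, []))"

end

theory Submission
  imports Defs
begin

text \<open>
  By the Yoneda lemma, \<open>[S,S]\<close> is a fan \<open>A\<close> with apex \<open>X\<close> together with \<open>u : S \<rightarrow> XS\<close> such that, for every
  1-morphism \<open>Z\<close>, the map \<open>g \<mapsto> (gS)u\<close> from \<open>Hom(X,Z)\<close> to \<open>Hom(S,ZS)\<close> is onto, and its kernel consists of the
  morphisms that factor through the legs of \<open>A\<close>. If this holds in degree zero, it holds in all
  degrees: split morphisms into homogeneous components and replace \<open>Z\<close> by its shifts. Hence the
  degree-zero \<open>[S,S]\<^sub>0\<close> also represents the functor over the whole 2-category, and its comultiplication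
  and counit, being solutions of \<open>(dS)u = (Xu)u\<close> and \<open>(eS)u = id\<close>, can be found in degree zero. Two
  morphisms out of \<open>A\<close> agree as soon as they agree after \<open>(-S)u\<close>, which gives the coalgebra laws and
  the isomorphism with \<open>[S,S]\<close>.
\<close>

section \<open>Morphisms of fans through their apex components\<close>

text \<open>A morphism of fans is a class of tuples, but the relation looks only at the apex
  component; the matrix merely witnesses that certain factorizations exist. All computations are
  therefore made with apex components: \<open>fan_maps\<close> are the admissible ones,
  \<open>null_maps\<close> is what is divided out, and the unions over representatives in
  \<open>fan_Comp\<close>, \<open>act_mor\<close> and \<open>act_nat\<close> are resolved once. One
  notion of strict action covers \<C>(i,i) acting on M(i) and on itself, over all morphisms as well
  as over those of degree zero, so that horizontal composition of fans is a special case of the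
  action. The obstacle in comparing the two settings is that a class over the degree-zero part is in
  general only a subset of a class over the whole category. What is carried over is hence the
  element u and the representatives d and e, never a class and never the bijection \<phi>.\<close>

context linear_category
begin

interpretation V: vector_space "Scale \<A>"
  by (rule Scale_vector_space)

lemma zero_in_Hom: "\<lbrakk>X \<in> Obj \<A>; Y \<in> Obj \<A>\<rbrakk> \<Longrightarrow> 0 \<in> Hom \<A> X Y"
  by (simp add: Hom_subspace V.subspace_0)

lemma add_in_Hom:
  "\<lbrakk>X \<in> Obj \<A>; Y \<in> Obj \<A>; f \<in> Hom \<A> X Y; g \<in> Hom \<A> X Y\<rbrakk> \<Longrightarrow> f + g \<in> Hom \<A> X Y"
  by (simp add: Hom_subspace V.subspace_add)

lemma diff_in_Hom:
  "\<lbrakk>X \<in> Obj \<A>; Y \<in> Obj \<A>; f \<in> Hom \<A> X Y; g \<in> Hom \<A> X Y\<rbrakk> \<Longrightarrow> f - g \<in> Hom \<A> X Y"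
  by (simp add: Hom_subspace V.subspace_diff)

lemma sum_in_Hom:
  "\<lbrakk>X \<in> Obj \<A>; Y \<in> Obj \<A>; \<And>a. a \<in> I \<Longrightarrow> f a \<in> Hom \<A> X Y\<rbrakk> \<Longrightarrow> sum f I \<in> Hom \<A> X Y"
  by (simp add: Hom_subspace V.subspace_sum)

lemma Comp_0_left:
  assumes "X \<in> Obj \<A>" "Y \<in> Obj \<A>" "Z \<in> Obj \<A>" "f \<in> Hom \<A> X Y"
  shows "Comp \<A> 0 f = 0"
  using Comp_add_left[OF assms zero_in_Hom zero_in_Hom] assms by simp

lemma Comp_0_right:
  assumes "X \<in> Obj \<A>" "Y \<in> Obj \<A>" "Z \<in> Obj \<A>" "g \<in> Hom \<A> Y Z"
  shows "Comp \<A> g 0 = 0"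
  using Comp_add_right[OF assms(1-3) zero_in_Hom zero_in_Hom assms(4)] assms by simp

lemma Comp_diff_left:
  assumes "X \<in> Obj \<A>" "Y \<in> Obj \<A>" "Z \<in> Obj \<A>" "f \<in> Hom \<A> X Y"
    and "g \<in> Hom \<A> Y Z" "g' \<in> Hom \<A> Y Z"
  shows "Comp \<A> (g - g') f = Comp \<A> g f - Comp \<A> g' f"
  using Comp_add_left[OF assms(1-4) diff_in_Hom[OF assms(2,3,5,6)] assms(6)]
  by (simp add: algebra_simps)

lemma Comp_diff_right:
  assumes "X \<in> Obj \<A>" "Y \<in> Obj \<A>" "Z \<in> Obj \<A>" "f \<in> Hom \<A> X Y" "f' \<in> Hom \<A> X Y"
    and "g \<in> Hom \<A> Y Z"
  shows "Comp \<A> g (f - f') = Comp \<A> g f - Comp \<A> g f'"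
  using Comp_add_right[OF assms(1-3) diff_in_Hom[OF assms(1,2,4,5)] assms(5,6)]
  by (simp add: algebra_simps)

lemma Comp_sum_left:
  assumes "X \<in> Obj \<A>" "Y \<in> Obj \<A>" "Z \<in> Obj \<A>" "f \<in> Hom \<A> X Y"
    and "\<And>a. a \<in> I \<Longrightarrow> g a \<in> Hom \<A> Y Z"
  shows "Comp \<A> (\<Sum>a\<in>I. g a) f = (\<Sum>a\<in>I. Comp \<A> (g a) f)"
  using assms(5)
  by (induction I rule: infinite_finite_induct)
    (simp_all add: Comp_0_left[OF assms(1-4)] Comp_add_left[OF assms(1-4)] sum_in_Hom assms)

lemma Comp_sum_right:
  assumes "X \<in> Obj \<A>" "Y \<in> Obj \<A>" "Z \<in> Obj \<A>" "g \<in> Hom \<A> Y Z"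
    and "\<And>a. a \<in> I \<Longrightarrow> f a \<in> Hom \<A> X Y"
  shows "Comp \<A> g (\<Sum>a\<in>I. f a) = (\<Sum>a\<in>I. Comp \<A> g (f a))"
  using assms(5)
  by (induction I rule: infinite_finite_induct)
    (simp_all add: Comp_0_right[OF assms(1-4)] Comp_add_right[OF assms(1-3) _ _ assms(4)] sum_in_Hom assms)

end

text \<open>Agrees with \<open>fan_null\<close>, but takes a bare object as its target, so that it
  can also express that a composite with a leg of another fan factors through the legs of P.\<close>

definition null_maps ::
  "('o, 'm::ab_group_add, 'k) lin_cat \<Rightarrow> ('o, 'm) fan \<Rightarrow> 'o \<Rightarrow> 'm set" where
  "null_maps \<A> P Z = {\<Sum>i < width P. Comp \<A> (q i) (leg P i) | q.
     \<forall>i < width P. q i \<in> Hom \<A> (tgt P i) Z}"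

text \<open>These are the apex components of tuples: row by row, the matrix of a tuple is a choice
  of factorization of each \<open>Comp \<A> (leg Q i) g\<close> through the legs of P.\<close>

definition fan_maps ::
  "('o, 'm::ab_group_add, 'k) lin_cat \<Rightarrow> ('o, 'm) fan \<Rightarrow> ('o, 'm) fan \<Rightarrow> 'm set" where
  "fan_maps \<A> P Q = {g \<in> Hom \<A> (apex P) (apex Q).
     \<forall>i < width Q. Comp \<A> (leg Q i) g \<in> null_maps \<A> P (tgt Q i)}"

text \<open>The matrices of the members are unconstrained beyond being matrices of tuples, so a
  class is given by an apex component modulo \<open>null_maps\<close>.\<close>

definition fan_class ::
  "('o, 'm::ab_group_add, 'k) lin_cat \<Rightarrow> ('o, 'm) fan \<Rightarrow> ('o, 'm) fan \<Rightarrow> 'm \<Rightarrow> 'm fan_tuple set" where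
  "fan_class \<A> P Q g = {t \<in> fan_tuples \<A> P Q. fst t - g \<in> null_maps \<A> P (apex Q)}"

lemma fan_null_eq: "fan_null \<A> P Q = null_maps \<A> P (apex Q)"
  by (simp add: fan_null_def null_maps_def)

lemma fan_ObjD:
  assumes "P \<in> fan_Obj \<A>"
  shows "apex P \<in> Obj \<A>" "i < width P \<Longrightarrow> tgt P i \<in> Obj \<A>"
    "i < width P \<Longrightarrow> leg P i \<in> Hom \<A> (apex P) (tgt P i)"
  using assms by (auto simp: fan_Obj_def)

lemma null_mapsI:
  "\<lbrakk>n = (\<Sum>i < width P. Comp \<A> (q i) (leg P i)); \<And>i. i < width P \<Longrightarrow> q i \<in> Hom \<A> (tgt P i) Z\<rbrakk>
    \<Longrightarrow> n \<in> null_maps \<A> P Z"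
  by (auto simp: null_maps_def)

lemma null_mapsE:
  assumes "n \<in> null_maps \<A> P Z"
  obtains q where "n = (\<Sum>i < width P. Comp \<A> (q i) (leg P i))"
    "\<And>i. i < width P \<Longrightarrow> q i \<in> Hom \<A> (tgt P i) Z"
  using assms by (auto simp: null_maps_def)

context linear_category
begin

lemma null_maps_in_Hom:
  assumes P: "P \<in> fan_Obj \<A>" and Z: "Z \<in> Obj \<A>" and n: "n \<in> null_maps \<A> P Z"
  shows "n \<in> Hom \<A> (apex P) Z"
proof -
  from n obtain q where q: "n = (\<Sum>i < width P. Comp \<A> (q i) (leg P i))"
    "\<And>i. i < width P \<Longrightarrow> q i \<in> Hom \<A> (tgt P i) Z" by (rule null_mapsE) blast
  show ?thesis
    unfolding q(1) by (rule sum_in_Hom) (use fan_ObjD[OF P] q(2) Z in \<open>auto intro!: Comp_in[of _ "tgt P _"]\<close>)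
qed

lemma null_maps_0:
  assumes P: "P \<in> fan_Obj \<A>" and Z: "Z \<in> Obj \<A>"
  shows "0 \<in> null_maps \<A> P Z"
proof (rule null_mapsI)
  show "0 = (\<Sum>i < width P. Comp \<A> 0 (leg P i))"
    by (rule sum.neutral[symmetric])
      (use P Z in \<open>auto intro: Comp_0_left[of "apex P" "tgt P _" Z] dest: fan_ObjD\<close>)
qed (use P Z in \<open>auto intro: zero_in_Hom dest: fan_ObjD\<close>)

lemma null_maps_add:
  assumes P: "P \<in> fan_Obj \<A>" and Z: "Z \<in> Obj \<A>"
    and "m \<in> null_maps \<A> P Z" "n \<in> null_maps \<A> P Z"
  shows "m + n \<in> null_maps \<A> P Z"
proof -
  from assms(3) obtain q where q: "m = (\<Sum>i < width P. Comp \<A> (q i) (leg P i))"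
    "\<And>i. i < width P \<Longrightarrow> q i \<in> Hom \<A> (tgt P i) Z" by (rule null_mapsE) blast
  from assms(4) obtain r where r: "n = (\<Sum>i < width P. Comp \<A> (r i) (leg P i))"
    "\<And>i. i < width P \<Longrightarrow> r i \<in> Hom \<A> (tgt P i) Z" by (rule null_mapsE) blast
  show ?thesis
  proof (rule null_mapsI)
    show "m + n = (\<Sum>i < width P. Comp \<A> (q i + r i) (leg P i))"
      unfolding q(1) r(1) sum.distrib[symmetric]
      by (rule sum.cong) (use fan_ObjD[OF P] q(2) r(2) Z in \<open>auto intro!: Comp_add_left[symmetric, of "apex P" "tgt P _" Z]\<close>)
  qed (auto intro!: add_in_Hom simp: fan_ObjD[OF P] q r Z)
qed

lemma null_maps_diff:
  assumes P: "P \<in> fan_Obj \<A>" and Z: "Z \<in> Obj \<A>"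
    and "m \<in> null_maps \<A> P Z" "n \<in> null_maps \<A> P Z"
  shows "m - n \<in> null_maps \<A> P Z"
proof -
  from assms(3) obtain q where q: "m = (\<Sum>i < width P. Comp \<A> (q i) (leg P i))"
    "\<And>i. i < width P \<Longrightarrow> q i \<in> Hom \<A> (tgt P i) Z" by (rule null_mapsE) blast
  from assms(4) obtain r where r: "n = (\<Sum>i < width P. Comp \<A> (r i) (leg P i))"
    "\<And>i. i < width P \<Longrightarrow> r i \<in> Hom \<A> (tgt P i) Z" by (rule null_mapsE) blast
  show ?thesis
  proof (rule null_mapsI)
    show "m - n = (\<Sum>i < width P. Comp \<A> (q i - r i) (leg P i))"
      unfolding q(1) r(1) sum_subtractf[symmetric]
      by (rule sum.cong) (use fan_ObjD[OF P] q(2) r(2) Z in \<open>auto intro!: Comp_diff_left[symmetric, of "apex P" "tgt P _" Z]\<close>)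
  qed (auto intro!: diff_in_Hom simp: fan_ObjD[OF P] q r Z)
qed

lemma null_maps_uminus:
  assumes P: "P \<in> fan_Obj \<A>" and Z: "Z \<in> Obj \<A>" and n: "n \<in> null_maps \<A> P Z"
  shows "- n \<in> null_maps \<A> P Z"
  using null_maps_diff[OF P Z null_maps_0[OF P Z] n] by simp

lemma null_maps_sum:
  assumes P: "P \<in> fan_Obj \<A>" and Z: "Z \<in> Obj \<A>"
    and "\<And>a. a \<in> I \<Longrightarrow> n a \<in> null_maps \<A> P Z"
  shows "sum n I \<in> null_maps \<A> P Z"
  using assms(3)
  by (induction I rule: infinite_finite_induct) (auto intro: null_maps_0 null_maps_add P Z)

lemma null_maps_Comp:
  assumes P: "P \<in> fan_Obj \<A>" and Z: "Z \<in> Obj \<A>" and W: "W \<in> Obj \<A>"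
    and n: "n \<in> null_maps \<A> P Z" and g: "g \<in> Hom \<A> Z W"
  shows "Comp \<A> g n \<in> null_maps \<A> P W"
proof -
  from n obtain q where q: "n = (\<Sum>i < width P. Comp \<A> (q i) (leg P i))"
    "\<And>i. i < width P \<Longrightarrow> q i \<in> Hom \<A> (tgt P i) Z" by (rule null_mapsE) blast
  show ?thesis
  proof (rule null_mapsI)
    have "Comp \<A> g n = (\<Sum>i < width P. Comp \<A> g (Comp \<A> (q i) (leg P i)))"
      unfolding q(1) by (rule Comp_sum_right[OF fan_ObjD(1)[OF P] Z W g])
        (use fan_ObjD[OF P] q(2) Z in \<open>auto intro!: Comp_in[of _ "tgt P _"]\<close>)
    also have "\<dots> = (\<Sum>i < width P. Comp \<A> (Comp \<A> g (q i)) (leg P i))"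
      by (rule sum.cong) (use fan_ObjD[OF P] q(2) g Z W in
          \<open>auto intro!: Comp_assoc[symmetric, of "apex P" "tgt P _" Z W]\<close>)
    finally show "Comp \<A> g n = (\<Sum>i < width P. Comp \<A> (Comp \<A> g (q i)) (leg P i))" .
  qed (auto intro!: Comp_in[OF _ Z W] simp: fan_ObjD[OF P] q g)
qed

lemma null_maps_leg:
  assumes P: "P \<in> fan_Obj \<A>" and Z: "Z \<in> Obj \<A>" and "j < width P" and q: "q \<in> Hom \<A> (tgt P j) Z"
  shows "Comp \<A> q (leg P j) \<in> null_maps \<A> P Z"
proof (rule null_mapsI)
  have "(\<Sum>i < width P. Comp \<A> (if i = j then q else 0) (leg P i))
      = (\<Sum>i < width P. if i = j then Comp \<A> q (leg P j) else 0)"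
    by (rule sum.cong) (use P Z in \<open>auto intro!: Comp_0_left[of "apex P" "tgt P _" Z] dest: fan_ObjD\<close>)
  then show "Comp \<A> q (leg P j) = (\<Sum>i < width P. Comp \<A> (if i = j then q else 0) (leg P i))"
    using assms by simp
qed (use assms in \<open>auto intro: zero_in_Hom dest: fan_ObjD\<close>)

lemma fan_maps_in_Hom: "g \<in> fan_maps \<A> P Q \<Longrightarrow> g \<in> Hom \<A> (apex P) (apex Q)"
  by (simp add: fan_maps_def)

text \<open>The other half of the ideal property. Unlike postcomposition, precomposition needs g to
  be a fan map: after moving g inside, each leg of Q followed by g has to be rewritten through the
  legs of P.\<close>

lemma null_maps_Comp_fan_maps:
  assumes P: "P \<in> fan_Obj \<A>" and Q: "Q \<in> fan_Obj \<A>" and Z: "Z \<in> Obj \<A>"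
    and n: "n \<in> null_maps \<A> Q Z" and g: "g \<in> fan_maps \<A> P Q"
  shows "Comp \<A> n g \<in> null_maps \<A> P Z"
proof -
  from n obtain q where q: "n = (\<Sum>i < width Q. Comp \<A> (q i) (leg Q i))"
    "\<And>i. i < width Q \<Longrightarrow> q i \<in> Hom \<A> (tgt Q i) Z" by (rule null_mapsE) blast
  note gH = fan_maps_in_Hom[OF g]
  have "Comp \<A> n g = (\<Sum>i < width Q. Comp \<A> (Comp \<A> (q i) (leg Q i)) g)"
    unfolding q(1) by (intro Comp_sum_left[OF _ _ Z gH] Comp_in[OF _ fan_ObjD(2)[OF Q]])
      (auto simp: fan_ObjD[OF P] fan_ObjD[OF Q] q Z)
  also have "\<dots> = (\<Sum>i < width Q. Comp \<A> (q i) (Comp \<A> (leg Q i) g))"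
    by (rule sum.cong) (auto intro!: Comp_assoc[OF fan_ObjD(1)[OF P] fan_ObjD(1,2)[OF Q] Z gH]
      simp: fan_ObjD[OF Q] q)
  also have "\<dots> \<in> null_maps \<A> P Z"
    using g by (intro null_maps_sum[OF P Z] null_maps_Comp[OF P fan_ObjD(2)[OF Q] Z])
      (auto simp: fan_maps_def q)
  finally show ?thesis .
qed

lemma null_subset_fan_maps:
  assumes P: "P \<in> fan_Obj \<A>" and Q: "Q \<in> fan_Obj \<A>" and n: "n \<in> null_maps \<A> P (apex Q)"
  shows "n \<in> fan_maps \<A> P Q"
  using null_maps_in_Hom[OF P _ n] null_maps_Comp[OF P _ _ n] fan_ObjD[OF Q]
  by (simp add: fan_maps_def)

lemma fan_maps_Idm:
  assumes P: "P \<in> fan_Obj \<A>"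
  shows "Idm \<A> (apex P) \<in> fan_maps \<A> P P"
proof -
  have "Comp \<A> (leg P i) (Idm \<A> (apex P)) = Comp \<A> (Idm \<A> (tgt P i)) (leg P i)" if "i < width P" for i
    using fan_ObjD[OF P] that Comp_Idm[of "apex P" "tgt P i"] Idm_Comp[of "apex P" "tgt P i"] by simp
  then show ?thesis
    using fan_ObjD[OF P] by (auto simp: fan_maps_def Idm_in intro!: null_maps_leg P)
qed

lemma fan_maps_Comp:
  assumes P: "P \<in> fan_Obj \<A>" and Q: "Q \<in> fan_Obj \<A>" and R: "R \<in> fan_Obj \<A>"
    and g: "g \<in> fan_maps \<A> P Q" and g': "g' \<in> fan_maps \<A> Q R"
  shows "Comp \<A> g' g \<in> fan_maps \<A> P R"
proof -
  have "Comp \<A> (leg R i) (Comp \<A> g' g) \<in> null_maps \<A> P (tgt R i)" if "i < width R" for i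
  proof -
    have "Comp \<A> (leg R i) (Comp \<A> g' g) = Comp \<A> (Comp \<A> (leg R i) g') g"
      using that by (intro Comp_assoc[symmetric, OF fan_ObjD(1)[OF P] fan_ObjD(1)[OF Q] fan_ObjD(1,2)[OF R]])
        (auto simp: fan_ObjD[OF R] fan_maps_in_Hom g g')
    also have "\<dots> \<in> null_maps \<A> P (tgt R i)"
      using that g' by (intro null_maps_Comp_fan_maps[OF P Q fan_ObjD(2)[OF R] _ g]) (auto simp: fan_maps_def)
    finally show ?thesis .
  qed
  then show ?thesis
    using fan_maps_in_Hom[OF g] fan_maps_in_Hom[OF g'] fan_ObjD[OF P] fan_ObjD[OF Q] fan_ObjD[OF R]
    by (auto simp: fan_maps_def intro: Comp_in)
qed

lemma fan_maps_iff_tuple: "g \<in> fan_maps \<A> P Q \<longleftrightarrow> (\<exists>h. (g, h) \<in> fan_tuples \<A> P Q)"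
proof
  assume g: "g \<in> fan_maps \<A> P Q"
  then have "\<forall>i \<in> {..<width Q}. \<exists>q. Comp \<A> (leg Q i) g = (\<Sum>j < width P. Comp \<A> (q j) (leg P j)) \<and>
      (\<forall>j < width P. q j \<in> Hom \<A> (tgt P j) (tgt Q i))"
    unfolding fan_maps_def null_maps_def by blast
  from bchoice[OF this] obtain h where "\<forall>i < width Q. Comp \<A> (leg Q i) g = (\<Sum>j < width P. Comp \<A> (h i j) (leg P j)) \<and>
      (\<forall>j < width P. h i j \<in> Hom \<A> (tgt P j) (tgt Q i))"
    by auto
  \<comment> \<open>The choice is made for each target leg and is thus indexed by that leg first,
    whereas tuples are indexed by the source leg first.\<close>
  then have "(g, \<lambda>j i. h i j) \<in> fan_tuples \<A> P Q"
    using g by (auto simp: fan_tuples_def fan_maps_def)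
  then show "\<exists>h. (g, h) \<in> fan_tuples \<A> P Q" by blast
next
  assume "\<exists>h. (g, h) \<in> fan_tuples \<A> P Q"
  then show "g \<in> fan_maps \<A> P Q"
    by (auto simp: fan_maps_def fan_tuples_def null_maps_def)
qed

text \<open>The class of a fan map contains a tuple with that very apex component, so equal classes
  force a null difference; conversely \<open>null_maps\<close> is closed under addition and
  subtraction.\<close>

lemma fan_class_eq_iff:
  assumes P: "P \<in> fan_Obj \<A>" and Q: "Q \<in> fan_Obj \<A>"
    and g: "g \<in> fan_maps \<A> P Q"
  shows "fan_class \<A> P Q g = fan_class \<A> P Q g' \<longleftrightarrow> g - g' \<in> null_maps \<A> P (apex Q)"
proof
  assume *: "fan_class \<A> P Q g = fan_class \<A> P Q g'"
  obtain h where "(g, h) \<in> fan_tuples \<A> P Q" using g fan_maps_iff_tuple by blast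
  then have "(g, h) \<in> fan_class \<A> P Q g"
    using null_maps_0[OF P fan_ObjD(1)[OF Q]] by (simp add: fan_class_def)
  then show "g - g' \<in> null_maps \<A> P (apex Q)" unfolding * by (simp add: fan_class_def)
next
  assume *: "g - g' \<in> null_maps \<A> P (apex Q)"
  have "x - g \<in> null_maps \<A> P (apex Q) \<longleftrightarrow> x - g' \<in> null_maps \<A> P (apex Q)" for x
    using null_maps_add[OF P fan_ObjD(1)[OF Q] _ *, of "x - g"]
      null_maps_diff[OF P fan_ObjD(1)[OF Q] _ *, of "x - g'"] by auto
  then show "fan_class \<A> P Q g = fan_class \<A> P Q g'" by (simp add: fan_class_def)
qed

lemma fan_rel_Image:
  assumes P: "P \<in> fan_Obj \<A>" and Q: "Q \<in> fan_Obj \<A>" and "t \<in> fan_tuples \<A> P Q"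
  shows "fan_rel \<A> P Q `` {t} = fan_class \<A> P Q (fst t)"
proof -
  have "x - y \<in> null_maps \<A> P (apex Q) \<longleftrightarrow> y - x \<in> null_maps \<A> P (apex Q)" for x y
    using null_maps_uminus[OF P fan_ObjD(1)[OF Q], of "x - y"]
      null_maps_uminus[OF P fan_ObjD(1)[OF Q], of "y - x"] by auto
  then show ?thesis
    using assms by (auto simp: fan_rel_def fan_class_def fan_null_eq)
qed

lemma fan_Hom_eq:
  assumes P: "P \<in> fan_Obj \<A>" and Q: "Q \<in> fan_Obj \<A>"
  shows "fan_Hom \<A> P Q = fan_class \<A> P Q ` fan_maps \<A> P Q"
proof -
  have "fan_Hom \<A> P Q = (\<lambda>t. fan_class \<A> P Q (fst t)) ` fan_tuples \<A> P Q"
    using fan_rel_Image[OF P Q] by (auto simp: fan_Hom_def quotient_def)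
  also have "\<dots> = fan_class \<A> P Q ` (fst ` fan_tuples \<A> P Q)" by (simp add: image_image)
  also have "fst ` fan_tuples \<A> P Q = fan_maps \<A> P Q" by (force simp: fan_maps_iff_tuple image_iff)
  finally show ?thesis .
qed

lemma fan_class_in_Hom:
  "\<lbrakk>P \<in> fan_Obj \<A>; Q \<in> fan_Obj \<A>; g \<in> fan_maps \<A> P Q\<rbrakk> \<Longrightarrow> fan_class \<A> P Q g \<in> fan_Hom \<A> P Q"
  by (simp add: fan_Hom_eq)

text \<open>Operations on classes are defined as unions over all representatives. Such a union
  collapses as soon as every representative contributes the same set, because a class of a fan map
  is nonempty.\<close>

lemma UN_fan_class:
  assumes P: "P \<in> fan_Obj \<A>" and Q: "Q \<in> fan_Obj \<A>" and g: "g \<in> fan_maps \<A> P Q"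
    and F: "\<And>g' h'. \<lbrakk>(g', h') \<in> fan_tuples \<A> P Q; g' \<in> fan_maps \<A> P Q; g' - g \<in> null_maps \<A> P (apex Q)\<rbrakk>
      \<Longrightarrow> F (g', h') = K"
  shows "(\<Union>t \<in> fan_class \<A> P Q g. F t) = K"
proof -
  obtain h where "(g, h) \<in> fan_tuples \<A> P Q" using g fan_maps_iff_tuple by blast
  then have "(g, h) \<in> fan_class \<A> P Q g"
    using null_maps_0[OF P fan_ObjD(1)[OF Q]] by (simp add: fan_class_def)
  moreover have "F t = K" if "t \<in> fan_class \<A> P Q g" for t
    using F[of "fst t" "snd t"] that fan_maps_iff_tuple[of "fst t" P Q] by (cases t) (auto simp: fan_class_def)
  ultimately show ?thesis by blast
qed

lemma fan_Id_eq:
  assumes P: "P \<in> fan_Obj \<A>"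
  shows "fan_Id \<A> P = fan_class \<A> P P (Idm \<A> (apex P))"
proof -
  have "(\<Sum>j < width P. Comp \<A> (if j = i then Idm \<A> (tgt P j) else 0) (leg P j)) = leg P i"
    if i: "i < width P" for i
  proof -
    have "(\<Sum>j < width P. Comp \<A> (if j = i then Idm \<A> (tgt P j) else 0) (leg P j))
       = (\<Sum>j < width P. if j = i then leg P i else 0)"
      by (rule sum.cong) (use fan_ObjD[OF P] i in \<open>auto intro!: Comp_0_left[of "apex P" "tgt P _" "tgt P _"] Idm_Comp[of "apex P" "tgt P _"]\<close>)
    then show ?thesis using i by simp
  qed
  moreover have "Comp \<A> (leg P i) (Idm \<A> (apex P)) = leg P i" if "i < width P" for i
    using fan_ObjD[OF P] that Comp_Idm by blast
  ultimately have "(Idm \<A> (apex P), \<lambda>i j. if i = j then Idm \<A> (tgt P i) else 0) \<in> fan_tuples \<A> P P"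
    using fan_ObjD[OF P] by (auto simp: fan_tuples_def Idm_in zero_in_Hom)
  from fan_rel_Image[OF P P this] show ?thesis by (simp add: fan_Id_def)
qed

text \<open>The matrix is a matrix product: the leg equations of the second tuple and then of the
  first are inserted, and the two sums are exchanged.\<close>

lemma fan_tuples_Comp:
  assumes P: "P \<in> fan_Obj \<A>" and Q: "Q \<in> fan_Obj \<A>" and R: "R \<in> fan_Obj \<A>"
    and t: "(g, h) \<in> fan_tuples \<A> P Q" and t': "(g', h') \<in> fan_tuples \<A> Q R"
  shows "(Comp \<A> g' g, \<lambda>i l. \<Sum>j < width Q. Comp \<A> (h' j l) (h i j)) \<in> fan_tuples \<A> P R"
proof -
  note o = fan_ObjD[OF P] fan_ObjD[OF Q] fan_ObjD[OF R]
  have m: "g \<in> Hom \<A> (apex P) (apex Q)" "g' \<in> Hom \<A> (apex Q) (apex R)"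
    "\<And>i j. \<lbrakk>i < width P; j < width Q\<rbrakk> \<Longrightarrow> h i j \<in> Hom \<A> (tgt P i) (tgt Q j)"
    "\<And>i j. \<lbrakk>i < width Q; j < width R\<rbrakk> \<Longrightarrow> h' i j \<in> Hom \<A> (tgt Q i) (tgt R j)"
    and e: "\<And>i. i < width Q \<Longrightarrow> Comp \<A> (leg Q i) g = (\<Sum>j < width P. Comp \<A> (h j i) (leg P j))"
    and e': "\<And>i. i < width R \<Longrightarrow> Comp \<A> (leg R i) g' = (\<Sum>j < width Q. Comp \<A> (h' j i) (leg Q j))"
    using t t' by (auto simp: fan_tuples_def)
  have "Comp \<A> (leg R l) (Comp \<A> g' g)
      = (\<Sum>i < width P. Comp \<A> (\<Sum>j < width Q. Comp \<A> (h' j l) (h i j)) (leg P i))" if l: "l < width R" for l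
  proof -
    have "Comp \<A> (leg R l) (Comp \<A> g' g) = Comp \<A> (Comp \<A> (leg R l) g') g"
      by (rule Comp_assoc[symmetric, of "apex P" "apex Q" "apex R" "tgt R l"]) (use o m l in auto)
    also have "\<dots> = (\<Sum>j < width Q. Comp \<A> (Comp \<A> (h' j l) (leg Q j)) g)"
      unfolding e'[OF l]
      by (rule Comp_sum_left[of "apex P" "apex Q" "tgt R l"])
        (use o m l in \<open>auto intro!: Comp_in[of _ "tgt Q _"]\<close>)
    also have "\<dots> = (\<Sum>j < width Q. \<Sum>i < width P. Comp \<A> (Comp \<A> (h' j l) (h i j)) (leg P i))"
    proof (rule sum.cong[OF refl])
      fix j assume "j \<in> {..<width Q}"
      then have j: "j < width Q" by simp
      have "Comp \<A> (Comp \<A> (h' j l) (leg Q j)) g = Comp \<A> (h' j l) (Comp \<A> (leg Q j) g)"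
        by (rule Comp_assoc[of "apex P" "apex Q" "tgt Q j" "tgt R l"]) (use o m l j in auto)
      also have "\<dots> = (\<Sum>i < width P. Comp \<A> (h' j l) (Comp \<A> (h i j) (leg P i)))"
        unfolding e[OF j]
        by (rule Comp_sum_right[of "apex P" "tgt Q j" "tgt R l"])
          (use o m l j in \<open>auto intro!: Comp_in[of _ "tgt P _"]\<close>)
      also have "\<dots> = (\<Sum>i < width P. Comp \<A> (Comp \<A> (h' j l) (h i j)) (leg P i))"
        by (rule sum.cong[OF refl], rule Comp_assoc[symmetric, of "apex P" "tgt P _" "tgt Q j" "tgt R l"])
          (use o m l j in auto)
      finally show "Comp \<A> (Comp \<A> (h' j l) (leg Q j)) g
        = (\<Sum>i < width P. Comp \<A> (Comp \<A> (h' j l) (h i j)) (leg P i))" .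
    qed
    also have "\<dots> = (\<Sum>i < width P. \<Sum>j < width Q. Comp \<A> (Comp \<A> (h' j l) (h i j)) (leg P i))"
      by (rule sum.swap)
    also have "\<dots> = (\<Sum>i < width P. Comp \<A> (\<Sum>j < width Q. Comp \<A> (h' j l) (h i j)) (leg P i))"
      by (rule sum.cong[OF refl], rule Comp_sum_left[symmetric, of "apex P" "tgt P _" "tgt R l"])
        (use o m l in \<open>auto intro!: Comp_in[of _ "tgt Q _"]\<close>)
    finally show ?thesis .
  qed
  moreover have "Comp \<A> g' g \<in> Hom \<A> (apex P) (apex R)"
    by (rule Comp_in[of _ "apex Q"]) (use o m in auto)
  moreover have "(\<Sum>j < width Q. Comp \<A> (h' j l) (h i j)) \<in> Hom \<A> (tgt P i) (tgt R l)"
    if "i < width P" "l < width R" for i l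
    by (rule sum_in_Hom) (use o m that in \<open>auto intro!: Comp_in[of _ "tgt Q _"]\<close>)
  ultimately show ?thesis by (simp add: fan_tuples_def)
qed

lemma fan_Comp_eq:
  assumes P: "P \<in> fan_Obj \<A>" and Q: "Q \<in> fan_Obj \<A>" and R: "R \<in> fan_Obj \<A>"
    and g: "g \<in> fan_maps \<A> P Q" and g': "g' \<in> fan_maps \<A> Q R"
  shows "fan_Comp \<A> P Q R (fan_class \<A> Q R g') (fan_class \<A> P Q g) = fan_class \<A> P R (Comp \<A> g' g)"
  unfolding fan_Comp_def
proof (intro UN_fan_class[OF Q R g'] UN_fan_class[OF P Q g], simp only: case_prod_conv,
    intro UN_fan_class[OF P Q g], simp only: case_prod_conv)
  fix b hb a ha
  assume b: "(b, hb) \<in> fan_tuples \<A> Q R" "b \<in> fan_maps \<A> Q R" "b - g' \<in> null_maps \<A> Q (apex R)"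
    and a: "(a, ha) \<in> fan_tuples \<A> P Q" "a \<in> fan_maps \<A> P Q" "a - g \<in> null_maps \<A> P (apex Q)"
  note o = fan_ObjD[OF P] fan_ObjD[OF Q] fan_ObjD[OF R]
  note aH = fan_maps_in_Hom[OF a(2)] and bH = fan_maps_in_Hom[OF b(2)]
    and gH = fan_maps_in_Hom[OF g] and g'H = fan_maps_in_Hom[OF g']
  \<comment> \<open>The two summands are null for different reasons: the first because a is a fan
    map, the second because null maps are closed under postcomposition.\<close>
  have "Comp \<A> b a - Comp \<A> g' g = Comp \<A> (b - g') a + Comp \<A> g' (a - g)"
    using Comp_diff_left[OF o(1) o(4) o(7) aH bH g'H] Comp_diff_right[OF o(1) o(4) o(7) aH gH g'H] by simp
  also have "\<dots> \<in> null_maps \<A> P (apex R)"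
    by (intro null_maps_add P o null_maps_Comp_fan_maps[OF P Q _ b(3) a(2)] null_maps_Comp[OF P _ _ a(3) g'H])
  finally have *: "Comp \<A> b a - Comp \<A> g' g \<in> null_maps \<A> P (apex R)" .
  show "fan_rel \<A> P R `` {(Comp \<A> b a, \<lambda>i l. \<Sum>j<width Q. Comp \<A> (hb j l) (ha i j))}
      = fan_class \<A> P R (Comp \<A> g' g)"
    using fan_rel_Image[OF P R fan_tuples_Comp[OF P Q R a(1) b(1)]] *
      fan_class_eq_iff[OF P R fan_maps_Comp[OF P Q R a(2) b(2)]] by simp
qed

end

section \<open>Strict actions\<close>

text \<open>The endomorphism part of a 2-category at one object, stated over a linear hom-category,
  so that both the category of all morphisms and its degree-zero part are instances.\<close>

locale strict_monoidal =
  fixes C :: "('i, 'f, 'm::ab_group_add, 'k::field) lin_two_cat" and i :: 'i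
  assumes linear_hom: "linear_category (HomCat C i i)"
    and unit_in: "Unit1 C i \<in> Obj (HomCat C i i)"
    and hcomp1_in: "\<lbrakk>F \<in> Obj (HomCat C i i); G \<in> Obj (HomCat C i i)\<rbrakk>
      \<Longrightarrow> HComp1 C G F \<in> Obj (HomCat C i i)"
    and hcomp2_in: "\<lbrakk>F \<in> Obj (HomCat C i i); F' \<in> Obj (HomCat C i i);
        G \<in> Obj (HomCat C i i); G' \<in> Obj (HomCat C i i);
        \<alpha> \<in> Hom (HomCat C i i) F F'; \<beta> \<in> Hom (HomCat C i i) G G'\<rbrakk>
      \<Longrightarrow> HComp2 C \<beta> \<alpha> \<in> Hom (HomCat C i i) (HComp1 C G F) (HComp1 C G' F')"
    and hcomp2_add_left: "\<lbrakk>F \<in> Obj (HomCat C i i); F' \<in> Obj (HomCat C i i);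
        G \<in> Obj (HomCat C i i); G' \<in> Obj (HomCat C i i);
        \<alpha> \<in> Hom (HomCat C i i) F F'; \<beta> \<in> Hom (HomCat C i i) G G'; \<beta>' \<in> Hom (HomCat C i i) G G'\<rbrakk>
      \<Longrightarrow> HComp2 C (\<beta> + \<beta>') \<alpha> = HComp2 C \<beta> \<alpha> + HComp2 C \<beta>' \<alpha>"
    and hcomp2_add_right: "\<lbrakk>F \<in> Obj (HomCat C i i); F' \<in> Obj (HomCat C i i);
        G \<in> Obj (HomCat C i i); G' \<in> Obj (HomCat C i i);
        \<alpha> \<in> Hom (HomCat C i i) F F'; \<alpha>' \<in> Hom (HomCat C i i) F F'; \<beta> \<in> Hom (HomCat C i i) G G'\<rbrakk>
      \<Longrightarrow> HComp2 C \<beta> (\<alpha> + \<alpha>') = HComp2 C \<beta> \<alpha> + HComp2 C \<beta> \<alpha>'"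
    and hcomp2_Idm: "\<lbrakk>F \<in> Obj (HomCat C i i); G \<in> Obj (HomCat C i i)\<rbrakk>
      \<Longrightarrow> HComp2 C (Idm (HomCat C i i) G) (Idm (HomCat C i i) F) = Idm (HomCat C i i) (HComp1 C G F)"
    and hcomp2_Comp: "\<lbrakk>F \<in> Obj (HomCat C i i); F' \<in> Obj (HomCat C i i); F'' \<in> Obj (HomCat C i i);
        G \<in> Obj (HomCat C i i); G' \<in> Obj (HomCat C i i); G'' \<in> Obj (HomCat C i i);
        \<alpha> \<in> Hom (HomCat C i i) F F'; \<alpha>' \<in> Hom (HomCat C i i) F' F'';
        \<beta> \<in> Hom (HomCat C i i) G G'; \<beta>' \<in> Hom (HomCat C i i) G' G''\<rbrakk>
      \<Longrightarrow> HComp2 C (Comp (HomCat C i i) \<beta>' \<beta>) (Comp (HomCat C i i) \<alpha>' \<alpha>)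
        = Comp (HomCat C i i) (HComp2 C \<beta>' \<alpha>') (HComp2 C \<beta> \<alpha>)"
    and hcomp1_assoc: "\<lbrakk>F \<in> Obj (HomCat C i i); G \<in> Obj (HomCat C i i); H \<in> Obj (HomCat C i i)\<rbrakk>
      \<Longrightarrow> HComp1 C (HComp1 C H G) F = HComp1 C H (HComp1 C G F)"
    and hcomp1_unit: "F \<in> Obj (HomCat C i i) \<Longrightarrow> HComp1 C F (Unit1 C i) = F"
    and unit_hcomp1: "F \<in> Obj (HomCat C i i) \<Longrightarrow> HComp1 C (Unit1 C i) F = F"
    and hcomp2_assoc: "\<lbrakk>F \<in> Obj (HomCat C i i); F' \<in> Obj (HomCat C i i);
        G \<in> Obj (HomCat C i i); G' \<in> Obj (HomCat C i i);
        H \<in> Obj (HomCat C i i); H' \<in> Obj (HomCat C i i);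
        \<alpha> \<in> Hom (HomCat C i i) F F'; \<beta> \<in> Hom (HomCat C i i) G G'; \<gamma> \<in> Hom (HomCat C i i) H H'\<rbrakk>
      \<Longrightarrow> HComp2 C (HComp2 C \<gamma> \<beta>) \<alpha> = HComp2 C \<gamma> (HComp2 C \<beta> \<alpha>)"
    and hcomp2_unit: "\<lbrakk>F \<in> Obj (HomCat C i i); F' \<in> Obj (HomCat C i i); \<alpha> \<in> Hom (HomCat C i i) F F'\<rbrakk>
      \<Longrightarrow> HComp2 C \<alpha> (Idm (HomCat C i i) (Unit1 C i)) = \<alpha>"
    and unit_hcomp2: "\<lbrakk>F \<in> Obj (HomCat C i i); F' \<in> Obj (HomCat C i i); \<alpha> \<in> Hom (HomCat C i i) F F'\<rbrakk>
      \<Longrightarrow> HComp2 C (Idm (HomCat C i i) (Unit1 C i)) \<alpha> = \<alpha>"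
begin

sublocale A: linear_category "HomCat C i i"
  by (rule linear_hom)

end

text \<open>Instantiated both by the given 2-representation and by \<C>(i,i) acting on itself; every
  statement about the action then also gives one about horizontal composition and
  whiskering.\<close>

locale strict_action = strict_monoidal C i
  for C :: "('i, 'f, 'm::ab_group_add, 'k::field) lin_two_cat" and i :: 'i +
  fixes M :: "('i, 'f, 'm, 'x, 'n::ab_group_add, 'k) lin_two_rep"
  assumes linear_rep: "linear_category (MCat M i)"
    and act_in: "\<lbrakk>F \<in> Obj (HomCat C i i); X \<in> Obj (MCat M i)\<rbrakk> \<Longrightarrow> MObj M i i F X \<in> Obj (MCat M i)"
    and mor_in: "\<lbrakk>F \<in> Obj (HomCat C i i); X \<in> Obj (MCat M i); Y \<in> Obj (MCat M i); f \<in> Hom (MCat M i) X Y\<rbrakk>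
      \<Longrightarrow> MMor M i i F X Y f \<in> Hom (MCat M i) (MObj M i i F X) (MObj M i i F Y)"
    and mor_add: "\<lbrakk>F \<in> Obj (HomCat C i i); X \<in> Obj (MCat M i); Y \<in> Obj (MCat M i);
        f \<in> Hom (MCat M i) X Y; f' \<in> Hom (MCat M i) X Y\<rbrakk>
      \<Longrightarrow> MMor M i i F X Y (f + f') = MMor M i i F X Y f + MMor M i i F X Y f'"
    and mor_Idm: "\<lbrakk>F \<in> Obj (HomCat C i i); X \<in> Obj (MCat M i)\<rbrakk>
      \<Longrightarrow> MMor M i i F X X (Idm (MCat M i) X) = Idm (MCat M i) (MObj M i i F X)"
    and mor_Comp: "\<lbrakk>F \<in> Obj (HomCat C i i); X \<in> Obj (MCat M i); Y \<in> Obj (MCat M i); Z \<in> Obj (MCat M i);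
        f \<in> Hom (MCat M i) X Y; g \<in> Hom (MCat M i) Y Z\<rbrakk>
      \<Longrightarrow> MMor M i i F X Z (Comp (MCat M i) g f)
        = Comp (MCat M i) (MMor M i i F Y Z g) (MMor M i i F X Y f)"
    and nat_in: "\<lbrakk>F \<in> Obj (HomCat C i i); G \<in> Obj (HomCat C i i); \<alpha> \<in> Hom (HomCat C i i) F G; X \<in> Obj (MCat M i)\<rbrakk>
      \<Longrightarrow> MNat M i i F G \<alpha> X \<in> Hom (MCat M i) (MObj M i i F X) (MObj M i i G X)"
    and nat_natural: "\<lbrakk>F \<in> Obj (HomCat C i i); G \<in> Obj (HomCat C i i); \<alpha> \<in> Hom (HomCat C i i) F G;
        X \<in> Obj (MCat M i); Y \<in> Obj (MCat M i); f \<in> Hom (MCat M i) X Y\<rbrakk>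
      \<Longrightarrow> Comp (MCat M i) (MNat M i i F G \<alpha> Y) (MMor M i i F X Y f)
        = Comp (MCat M i) (MMor M i i G X Y f) (MNat M i i F G \<alpha> X)"
    and nat_add: "\<lbrakk>F \<in> Obj (HomCat C i i); G \<in> Obj (HomCat C i i); \<alpha> \<in> Hom (HomCat C i i) F G;
        \<beta> \<in> Hom (HomCat C i i) F G; X \<in> Obj (MCat M i)\<rbrakk>
      \<Longrightarrow> MNat M i i F G (\<alpha> + \<beta>) X = MNat M i i F G \<alpha> X + MNat M i i F G \<beta> X"
    and nat_Idm: "\<lbrakk>F \<in> Obj (HomCat C i i); X \<in> Obj (MCat M i)\<rbrakk>
      \<Longrightarrow> MNat M i i F F (Idm (HomCat C i i) F) X = Idm (MCat M i) (MObj M i i F X)"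
    and nat_Comp: "\<lbrakk>F \<in> Obj (HomCat C i i); G \<in> Obj (HomCat C i i); H \<in> Obj (HomCat C i i);
        \<alpha> \<in> Hom (HomCat C i i) F G; \<beta> \<in> Hom (HomCat C i i) G H; X \<in> Obj (MCat M i)\<rbrakk>
      \<Longrightarrow> MNat M i i F H (Comp (HomCat C i i) \<beta> \<alpha>) X
        = Comp (MCat M i) (MNat M i i G H \<beta> X) (MNat M i i F G \<alpha> X)"
    and act_unit: "X \<in> Obj (MCat M i) \<Longrightarrow> MObj M i i (Unit1 C i) X = X"
    and mor_unit: "\<lbrakk>X \<in> Obj (MCat M i); Y \<in> Obj (MCat M i); f \<in> Hom (MCat M i) X Y\<rbrakk>
      \<Longrightarrow> MMor M i i (Unit1 C i) X Y f = f"
    and act_hcomp1: "\<lbrakk>F \<in> Obj (HomCat C i i); G \<in> Obj (HomCat C i i); X \<in> Obj (MCat M i)\<rbrakk>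
      \<Longrightarrow> MObj M i i (HComp1 C G F) X = MObj M i i G (MObj M i i F X)"
    and mor_hcomp1: "\<lbrakk>F \<in> Obj (HomCat C i i); G \<in> Obj (HomCat C i i);
        X \<in> Obj (MCat M i); Y \<in> Obj (MCat M i); f \<in> Hom (MCat M i) X Y\<rbrakk>
      \<Longrightarrow> MMor M i i (HComp1 C G F) X Y f
        = MMor M i i G (MObj M i i F X) (MObj M i i F Y) (MMor M i i F X Y f)"
    and nat_hcomp2: "\<lbrakk>F \<in> Obj (HomCat C i i); F' \<in> Obj (HomCat C i i);
        G \<in> Obj (HomCat C i i); G' \<in> Obj (HomCat C i i);
        \<alpha> \<in> Hom (HomCat C i i) F F'; \<beta> \<in> Hom (HomCat C i i) G G'; X \<in> Obj (MCat M i)\<rbrakk>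
      \<Longrightarrow> MNat M i i (HComp1 C G F) (HComp1 C G' F') (HComp2 C \<beta> \<alpha>) X
        = Comp (MCat M i) (MNat M i i G G' \<beta> (MObj M i i F' X))
            (MMor M i i G (MObj M i i F X) (MObj M i i F' X) (MNat M i i F F' \<alpha> X))"

section \<open>The action of fans on fans: legs, block matrices and apex components\<close>

lemma sum_lessThan_add_split:
  fixes f :: "nat \<Rightarrow> 'a::comm_monoid_add"
  shows "(\<Sum>j < a + b. f j) = (\<Sum>j < a. f j) + (\<Sum>j < b. f (a + j))"
  by (induction b) (simp_all add: algebra_simps)

lemma act_obj_simps:
  "apex (act_obj M i i H P) = MObj M i i (apex H) (apex P)"
  "width (act_obj M i i H P) = width H + width P"
  "a < width H \<Longrightarrow> tgt (act_obj M i i H P) a = MObj M i i (tgt H a) (apex P)"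
  "a < width H \<Longrightarrow> leg (act_obj M i i H P) a = MNat M i i (apex H) (tgt H a) (leg H a) (apex P)"
  "b < width P \<Longrightarrow> tgt (act_obj M i i H P) (width H + b) = MObj M i i (apex H) (tgt P b)"
  "b < width P \<Longrightarrow> leg (act_obj M i i H P) (width H + b)
    = MMor M i i (apex H) (apex P) (tgt P b) (leg P b)"
  by (simp_all add: act_obj_def nth_append case_prod_unfold)

text \<open>Applied to the index of a leg of HP, this separates the legs coming from H from those
  coming from P.\<close>

lemma less_add_cases:
  fixes a :: nat
  assumes "a < m + n"
  obtains "a < m" | b where "a = m + b" "b < n"
  using assms by (metis add_less_cancel_left le_Suc_ex not_le)

text \<open>Functoriality and naturality are instances of the interchange law with identity
  2-morphisms in suitable places; compatibility with composites of 1-morphisms comes from strict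
  associativity.\<close>

lemma (in strict_monoidal) principal_action: "strict_action C i (principal C i)"
proof (intro strict_action.intro strict_action_axioms.intro strict_monoidal_axioms)
  fix F X Y Z f g
  assume o: "F \<in> Obj (HomCat C i i)" "X \<in> Obj (MCat (principal C i) i)" "Y \<in> Obj (MCat (principal C i) i)"
    "Z \<in> Obj (MCat (principal C i) i)"
    and fg: "f \<in> Hom (MCat (principal C i) i) X Y" "g \<in> Hom (MCat (principal C i) i) Y Z"
  then show "MMor (principal C i) i i F X Z (Comp (MCat (principal C i) i) g f)
    = Comp (MCat (principal C i) i) (MMor (principal C i) i i F Y Z g) (MMor (principal C i) i i F X Y f)"
    using hcomp2_Comp[of X Y Z F F F f g "Idm (HomCat C i i) F" "Idm (HomCat C i i) F"]
      A.Comp_Idm[of F F "Idm (HomCat C i i) F"]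
    by (simp add: principal_def A.Idm_in)
next
  fix F G H X \<alpha> \<beta>
  assume "F \<in> Obj (HomCat C i i)" "G \<in> Obj (HomCat C i i)" "H \<in> Obj (HomCat C i i)"
    "\<alpha> \<in> Hom (HomCat C i i) F G" "\<beta> \<in> Hom (HomCat C i i) G H" "X \<in> Obj (MCat (principal C i) i)"
  then show "MNat (principal C i) i i F H (Comp (HomCat C i i) \<beta> \<alpha>) X
    = Comp (MCat (principal C i) i) (MNat (principal C i) i i G H \<beta> X) (MNat (principal C i) i i F G \<alpha> X)"
    using hcomp2_Comp[of X X X F G H "Idm (HomCat C i i) X" "Idm (HomCat C i i) X" \<alpha> \<beta>]
      A.Comp_Idm[of X X "Idm (HomCat C i i) X"]
    by (simp add: principal_def A.Idm_in)
next
  fix F G \<alpha> X Y f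
  assume "F \<in> Obj (HomCat C i i)" "G \<in> Obj (HomCat C i i)" "\<alpha> \<in> Hom (HomCat C i i) F G"
    "X \<in> Obj (MCat (principal C i) i)" "Y \<in> Obj (MCat (principal C i) i)" "f \<in> Hom (MCat (principal C i) i) X Y"
  then show "Comp (MCat (principal C i) i) (MNat (principal C i) i i F G \<alpha> Y) (MMor (principal C i) i i F X Y f)
    = Comp (MCat (principal C i) i) (MMor (principal C i) i i G X Y f) (MNat (principal C i) i i F G \<alpha> X)"
    using hcomp2_Comp[of X Y Y F F G f "Idm (HomCat C i i) Y" "Idm (HomCat C i i) F" \<alpha>]
      hcomp2_Comp[of X X Y F G G "Idm (HomCat C i i) X" f \<alpha> "Idm (HomCat C i i) G"]
      A.Comp_Idm[of X Y f] A.Comp_Idm[of F G \<alpha>] A.Idm_Comp[of X Y f] A.Idm_Comp[of F G \<alpha>]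
    by (simp add: principal_def A.Idm_in)
next
  fix F G X Y f
  assume "F \<in> Obj (HomCat C i i)" "G \<in> Obj (HomCat C i i)"
    "X \<in> Obj (MCat (principal C i) i)" "Y \<in> Obj (MCat (principal C i) i)" "f \<in> Hom (MCat (principal C i) i) X Y"
  then show "MMor (principal C i) i i (HComp1 C G F) X Y f
    = MMor (principal C i) i i G (MObj (principal C i) i i F X) (MObj (principal C i) i i F Y)
        (MMor (principal C i) i i F X Y f)"
    using hcomp2_assoc[of X Y F F G G f "Idm (HomCat C i i) F" "Idm (HomCat C i i) G"]
    by (simp add: principal_def A.Idm_in hcomp2_Idm)
next
  fix F F' G G' \<alpha> \<beta> X
  assume *: "F \<in> Obj (HomCat C i i)" "F' \<in> Obj (HomCat C i i)" "G \<in> Obj (HomCat C i i)" "G' \<in> Obj (HomCat C i i)"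
    "\<alpha> \<in> Hom (HomCat C i i) F F'" "\<beta> \<in> Hom (HomCat C i i) G G'" "X \<in> Obj (MCat (principal C i) i)"
  then have X: "X \<in> Obj (HomCat C i i)" by (simp add: principal_def)
  have "HComp2 C (HComp2 C \<beta> \<alpha>) (Idm (HomCat C i i) X) = HComp2 C \<beta> (HComp2 C \<alpha> (Idm (HomCat C i i) X))"
    using * X by (intro hcomp2_assoc[of X X F F' G G']) (auto simp: A.Idm_in)
  \<comment> \<open>Identities are inserted on both sides of the horizontal composite to bring it
    into the form required by interchange.\<close>
  also have "\<dots> = HComp2 C (Comp (HomCat C i i) \<beta> (Idm (HomCat C i i) G))
      (Comp (HomCat C i i) (Idm (HomCat C i i) (HComp1 C F' X)) (HComp2 C \<alpha> (Idm (HomCat C i i) X)))"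
    using * X A.Comp_Idm[of G G' \<beta>]
      A.Idm_Comp[of "HComp1 C F X" "HComp1 C F' X" "HComp2 C \<alpha> (Idm (HomCat C i i) X)"]
    by (simp add: hcomp1_in hcomp2_in A.Idm_in)
  also have "\<dots> = Comp (HomCat C i i) (HComp2 C \<beta> (Idm (HomCat C i i) (HComp1 C F' X)))
      (HComp2 C (Idm (HomCat C i i) G) (HComp2 C \<alpha> (Idm (HomCat C i i) X)))"
    using * X by (intro hcomp2_Comp[of "HComp1 C F X" "HComp1 C F' X" "HComp1 C F' X" G G G'])
      (auto simp: hcomp1_in hcomp2_in A.Idm_in)
  finally show "MNat (principal C i) i i (HComp1 C G F) (HComp1 C G' F') (HComp2 C \<beta> \<alpha>) X
    = Comp (MCat (principal C i) i) (MNat (principal C i) i i G G' \<beta> (MObj (principal C i) i i F' X))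
       (MMor (principal C i) i i G (MObj (principal C i) i i F X) (MObj (principal C i) i i F' X)
         (MNat (principal C i) i i F F' \<alpha> X))"
    by (simp add: principal_def)
qed (simp_all add: principal_def linear_hom A.Idm_in hcomp1_in hcomp2_in hcomp2_add_left hcomp2_add_right
  hcomp2_Idm hcomp1_assoc unit_hcomp1 unit_hcomp2)

context strict_action
begin

sublocale B: linear_category "MCat M i"
  by (rule linear_rep)

abbreviation "\<A> \<equiv> HomCat C i i"
abbreviation "\<B> \<equiv> MCat M i"
abbreviation "ob \<equiv> MObj M i i"
abbreviation "mor \<equiv> MMor M i i"
abbreviation "nt \<equiv> MNat M i i"
abbreviation "actF \<equiv> act_obj M i i"

lemma mor_0:
  assumes "F \<in> Obj \<A>" "X \<in> Obj \<B>" "Y \<in> Obj \<B>"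
  shows "mor F X Y 0 = 0"
  using mor_add[OF assms B.zero_in_Hom B.zero_in_Hom] assms by simp

lemma mor_diff:
  assumes "F \<in> Obj \<A>" "X \<in> Obj \<B>" "Y \<in> Obj \<B>" "f \<in> Hom \<B> X Y" "f' \<in> Hom \<B> X Y"
  shows "mor F X Y (f - f') = mor F X Y f - mor F X Y f'"
  using mor_add[OF assms(1-3) B.diff_in_Hom[OF assms(2-5)] assms(5)] by simp

lemma mor_sum:
  assumes "F \<in> Obj \<A>" "X \<in> Obj \<B>" "Y \<in> Obj \<B>" "\<And>a. a \<in> I \<Longrightarrow> f a \<in> Hom \<B> X Y"
  shows "mor F X Y (\<Sum>a\<in>I. f a) = (\<Sum>a\<in>I. mor F X Y (f a))"
  using assms(4)
  by (induction I rule: infinite_finite_induct)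
    (simp_all add: mor_0 mor_add B.sum_in_Hom assms(1-3))

lemma nt_0:
  assumes "F \<in> Obj \<A>" "G \<in> Obj \<A>" "X \<in> Obj \<B>"
  shows "nt F G 0 X = 0"
  using nat_add[OF assms(1,2) A.zero_in_Hom A.zero_in_Hom] assms by simp

lemma nt_diff:
  assumes "F \<in> Obj \<A>" "G \<in> Obj \<A>" "f \<in> Hom \<A> F G" "f' \<in> Hom \<A> F G" "X \<in> Obj \<B>"
  shows "nt F G (f - f') X = nt F G f X - nt F G f' X"
  using nat_add[OF assms(1,2) A.diff_in_Hom[OF assms(1-4)] assms(4) assms(5)] by simp

lemma nt_sum:
  assumes "F \<in> Obj \<A>" "G \<in> Obj \<A>" "X \<in> Obj \<B>" "\<And>a. a \<in> I \<Longrightarrow> f a \<in> Hom \<A> F G"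
  shows "nt F G (\<Sum>a\<in>I. f a) X = (\<Sum>a\<in>I. nt F G (f a) X)"
  using assms(4)
  by (induction I rule: infinite_finite_induct)
    (simp_all add: nt_0 nat_add A.sum_in_Hom assms(1-3))

lemma act_obj_in:
  assumes H: "H \<in> fan_Obj \<A>" and P: "P \<in> fan_Obj \<B>"
  shows "actF H P \<in> fan_Obj \<B>"
proof -
  note o = fan_ObjD[OF H] fan_ObjD[OF P]
  have "tgt (actF H P) a \<in> Obj \<B> \<and> leg (actF H P) a \<in> Hom \<B> (apex (actF H P)) (tgt (actF H P) a)"
    if "a < width H + width P" for a
    using that by (rule less_add_cases) (use o in \<open>simp_all add: act_obj_simps act_in nat_in mor_in\<close>)
  then show ?thesis
    using o by (simp add: fan_Obj_def act_obj_simps act_in)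
qed

text \<open>The first \<open>width H\<close> legs of HP are the images of the legs of H under
  evaluation at the apex of P, so a factorization through the legs of H is carried over by
  functoriality. For null maps of P the legs from \<open>width H\<close> on play this part.\<close>

lemma null_maps_nt:
  assumes H: "H \<in> fan_Obj \<A>" and P: "P \<in> fan_Obj \<B>" and Z: "Z \<in> Obj \<A>"
    and n: "n \<in> null_maps \<A> H Z"
  shows "nt (apex H) Z n (apex P) \<in> null_maps \<B> (actF H P) (ob Z (apex P))"
proof -
  note o = fan_ObjD[OF H] fan_ObjD[OF P]
  from n obtain q where q: "n = (\<Sum>a < width H. Comp \<A> (q a) (leg H a))"
    "\<And>a. a < width H \<Longrightarrow> q a \<in> Hom \<A> (tgt H a) Z" by (rule null_mapsE) blast
  have "nt (apex H) Z n (apex P) = (\<Sum>a < width H. nt (apex H) Z (Comp \<A> (q a) (leg H a)) (apex P))"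
    unfolding q(1) by (rule nt_sum) (use o q(2) Z in \<open>auto intro!: A.Comp_in[of _ "tgt H _"]\<close>)
  also have "\<dots> = (\<Sum>a < width H. Comp \<B> (nt (tgt H a) Z (q a) (apex P)) (leg (actF H P) a))"
    by (rule sum.cong) (use o q(2) Z in \<open>auto intro!: nat_Comp simp: act_obj_simps\<close>)
  also have "\<dots> \<in> null_maps \<B> (actF H P) (ob Z (apex P))"
    by (intro B.null_maps_sum B.null_maps_leg act_obj_in H P)
      (use o q(2) Z in \<open>auto simp: act_obj_simps intro: act_in nat_in\<close>)
  finally show ?thesis .
qed

lemma null_maps_mor:
  assumes H: "H \<in> fan_Obj \<A>" and P: "P \<in> fan_Obj \<B>" and Z: "Z \<in> Obj \<B>"
    and n: "n \<in> null_maps \<B> P Z"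
  shows "mor (apex H) (apex P) Z n \<in> null_maps \<B> (actF H P) (ob (apex H) Z)"
proof -
  note o = fan_ObjD[OF H] fan_ObjD[OF P]
  from n obtain q where q: "n = (\<Sum>a < width P. Comp \<B> (q a) (leg P a))"
    "\<And>a. a < width P \<Longrightarrow> q a \<in> Hom \<B> (tgt P a) Z" by (rule null_mapsE) blast
  have "mor (apex H) (apex P) Z n = (\<Sum>a < width P. mor (apex H) (apex P) Z (Comp \<B> (q a) (leg P a)))"
    unfolding q(1) by (rule mor_sum) (use o q(2) Z in \<open>auto intro!: B.Comp_in[of _ "tgt P _"]\<close>)
  also have "\<dots> = (\<Sum>a < width P. Comp \<B> (mor (apex H) (tgt P a) Z (q a)) (leg (actF H P) (width H + a)))"
    by (rule sum.cong) (use o q(2) Z in \<open>auto intro!: mor_Comp simp: act_obj_simps\<close>)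
  also have "\<dots> \<in> null_maps \<B> (actF H P) (ob (apex H) Z)"
    by (intro B.null_maps_sum B.null_maps_leg act_obj_in H P)
      (use o q(2) Z in \<open>auto simp: act_obj_simps intro: act_in mor_in\<close>)
  finally show ?thesis .
qed

text \<open>The leg equations split by origin: on legs coming from H they are naturality of the leg
  of H with respect to g, on legs coming from P' they are the leg equations of (g, h) with the apex
  of H applied.\<close>

lemma act_mor_tuple:
  assumes H: "H \<in> fan_Obj \<A>" and P: "P \<in> fan_Obj \<B>" and P': "P' \<in> fan_Obj \<B>"
    and t: "(g, h) \<in> fan_tuples \<B> P P'"
  shows "(mor (apex H) (apex P) (apex P') g,
         \<lambda>a b. if a < width H \<and> b < width H
               then (if a = b then mor (tgt H a) (apex P) (apex P') g else 0)
               else if width H \<le> a \<and> width H \<le> b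
               then mor (apex H) (tgt P (a - width H)) (tgt P' (b - width H))
                      (h (a - width H) (b - width H))
               else 0) \<in> fan_tuples \<B> (actF H P) (actF H P')" (is "(?g, ?h) \<in> _")
proof -
  note o = fan_ObjD[OF H] fan_ObjD[OF P] fan_ObjD[OF P']
  note oH = act_obj_in[OF H P] and oH' = act_obj_in[OF H P']
  have g: "g \<in> Hom \<B> (apex P) (apex P')"
    and h: "\<And>a b. \<lbrakk>a < width P; b < width P'\<rbrakk> \<Longrightarrow> h a b \<in> Hom \<B> (tgt P a) (tgt P' b)"
    and e: "\<And>b. b < width P' \<Longrightarrow> Comp \<B> (leg P' b) g = (\<Sum>a < width P. Comp \<B> (h a b) (leg P a))"
    using t by (auto simp: fan_tuples_def)
  \<comment> \<open>The off-diagonal entry \<open>0\<close> is one and the same element in all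
    morphism spaces, so any object may serve as its codomain.\<close>
  have z: "Comp \<B> 0 (leg (actF H P) a) = 0" if "a < width H + width P" for a
    using that B.Comp_0_left[OF fan_ObjD(1)[OF oH] fan_ObjD(2)[OF oH] fan_ObjD(2)[OF oH] fan_ObjD(3)[OF oH]]
    by (simp add: act_obj_simps)
  have hin: "?h a b \<in> Hom \<B> (tgt (actF H P) a) (tgt (actF H P') b)"
    if a: "a < width H + width P" and b: "b < width H + width P'" for a b
    using a
  proof (rule less_add_cases)
    assume "a < width H"
    from b show ?thesis
      by (rule less_add_cases)
        (use \<open>a < width H\<close> o g in \<open>simp_all add: act_obj_simps mor_in B.zero_in_Hom act_in\<close>)
  next
    fix a' assume a': "a = width H + a'" "a' < width P"
    from b show ?thesis
      by (rule less_add_cases)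
        (use a' o h in \<open>simp_all add: act_obj_simps mor_in B.zero_in_Hom act_in\<close>)
  qed
  have eq: "Comp \<B> (leg (actF H P') b) ?g = (\<Sum>a < width H + width P. Comp \<B> (?h a b) (leg (actF H P) a))"
    if "b < width H + width P'" for b
    using that
  proof (rule less_add_cases)
    assume b: "b < width H"
    have "(\<Sum>a < width H. Comp \<B> (?h a b) (leg (actF H P) a))
        = (\<Sum>a < width H. if a = b then Comp \<B> (mor (tgt H b) (apex P) (apex P') g) (leg (actF H P) b) else 0)"
      by (rule sum.cong) (use b z in auto)
    moreover have "(\<Sum>a < width P. Comp \<B> (?h (width H + a) b) (leg (actF H P) (width H + a))) = 0"
      by (rule sum.neutral) (use b z in auto)
    moreover have "Comp \<B> (leg (actF H P') b) ?g = Comp \<B> (mor (tgt H b) (apex P) (apex P') g) (leg (actF H P) b)"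
      using nat_natural[of "apex H" "tgt H b" "leg H b" "apex P" "apex P'" g] o g b
      by (simp add: act_obj_simps)
    ultimately show ?thesis
      unfolding sum_lessThan_add_split using b by simp
  next
    fix b' assume b: "b = width H + b'" "b' < width P'"
    have "(\<Sum>a < width H. Comp \<B> (?h a b) (leg (actF H P) a)) = 0"
      by (rule sum.neutral) (use b z in auto)
    moreover have "(\<Sum>a < width P. Comp \<B> (?h (width H + a) b) (leg (actF H P) (width H + a)))
        = (\<Sum>a < width P. mor (apex H) (apex P) (tgt P' b') (Comp \<B> (h a b') (leg P a)))"
      by (rule sum.cong[OF refl]) (use b o h in \<open>auto simp: act_obj_simps intro!: mor_Comp[symmetric]\<close>)
    moreover have "\<dots> = mor (apex H) (apex P) (tgt P' b') (\<Sum>a < width P. Comp \<B> (h a b') (leg P a))"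
      by (rule mor_sum[symmetric]) (use b o h in \<open>auto intro!: B.Comp_in[of _ "tgt P _"]\<close>)
    moreover have "\<dots> = mor (apex H) (apex P) (tgt P' b') (Comp \<B> (leg P' b') g)"
      using e[OF b(2)] by simp
    moreover have "\<dots> = Comp \<B> (leg (actF H P') b) ?g"
      using b o g by (auto simp: act_obj_simps intro!: mor_Comp)
    ultimately show ?thesis
      unfolding sum_lessThan_add_split by simp
  qed
  have "?g \<in> Hom \<B> (apex (actF H P)) (apex (actF H P'))"
    using o g by (simp add: act_obj_simps mor_in)
  then show ?thesis
    using hin eq by (simp only: fan_tuples_def mem_Collect_eq case_prod_conv act_obj_simps(2)) blast
qed

text \<open>Compared with \<open>act_mor_tuple\<close> the two arguments change places: legs coming
  from H' use the leg equations of (g, h), evaluated at the apex of P, and legs coming from P use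
  naturality of g.\<close>

lemma act_nat_tuple:
  assumes H: "H \<in> fan_Obj \<A>" and H': "H' \<in> fan_Obj \<A>" and P: "P \<in> fan_Obj \<B>"
    and t: "(g, h) \<in> fan_tuples \<A> H H'"
  shows "(nt (apex H) (apex H') g (apex P),
         \<lambda>a b. if a < width H \<and> b < width H'
               then nt (tgt H a) (tgt H' b) (h a b) (apex P)
               else if width H \<le> a \<and> width H' \<le> b
               then (if a - width H = b - width H'
                     then nt (apex H) (apex H') g (tgt P (a - width H)) else 0)
               else 0) \<in> fan_tuples \<B> (actF H P) (actF H' P)" (is "(?g, ?h) \<in> _")
proof -
  note o = fan_ObjD[OF H] fan_ObjD[OF H'] fan_ObjD[OF P]
  note oH = act_obj_in[OF H P] and oH' = act_obj_in[OF H' P]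
  have g: "g \<in> Hom \<A> (apex H) (apex H')"
    and h: "\<And>a b. \<lbrakk>a < width H; b < width H'\<rbrakk> \<Longrightarrow> h a b \<in> Hom \<A> (tgt H a) (tgt H' b)"
    and e: "\<And>b. b < width H' \<Longrightarrow> Comp \<A> (leg H' b) g = (\<Sum>a < width H. Comp \<A> (h a b) (leg H a))"
    using t by (auto simp: fan_tuples_def)
  have z: "Comp \<B> 0 (leg (actF H P) a) = 0" if "a < width H + width P" for a
    using that B.Comp_0_left[OF fan_ObjD(1)[OF oH] fan_ObjD(2)[OF oH] fan_ObjD(2)[OF oH] fan_ObjD(3)[OF oH]]
    by (simp add: act_obj_simps)
  have hin: "?h a b \<in> Hom \<B> (tgt (actF H P) a) (tgt (actF H' P) b)"
    if a: "a < width H + width P" and b: "b < width H' + width P" for a b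
    using a
  proof (rule less_add_cases)
    assume "a < width H"
    from b show ?thesis
      by (rule less_add_cases)
        (use \<open>a < width H\<close> o h in \<open>simp_all add: act_obj_simps nat_in B.zero_in_Hom act_in\<close>)
  next
    fix a' assume a': "a = width H + a'" "a' < width P"
    from b show ?thesis
      by (rule less_add_cases)
        (use a' o g in \<open>simp_all add: act_obj_simps nat_in B.zero_in_Hom act_in\<close>)
  qed
  have eq: "Comp \<B> (leg (actF H' P) b) ?g = (\<Sum>a < width H + width P. Comp \<B> (?h a b) (leg (actF H P) a))"
    if "b < width H' + width P" for b
    using that
  proof (rule less_add_cases)
    assume b: "b < width H'"
    have "(\<Sum>a < width P. Comp \<B> (?h (width H + a) b) (leg (actF H P) (width H + a))) = 0"
      by (rule sum.neutral) (use b z in auto)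
    moreover have "(\<Sum>a < width H. Comp \<B> (?h a b) (leg (actF H P) a))
        = (\<Sum>a < width H. nt (apex H) (tgt H' b) (Comp \<A> (h a b) (leg H a)) (apex P))"
      by (rule sum.cong[OF refl]) (use b o h in \<open>auto simp: act_obj_simps intro!: nat_Comp[symmetric]\<close>)
    moreover have "\<dots> = nt (apex H) (tgt H' b) (\<Sum>a < width H. Comp \<A> (h a b) (leg H a)) (apex P)"
      by (rule nt_sum[symmetric]) (use b o h in \<open>auto intro!: A.Comp_in[of _ "tgt H _"]\<close>)
    moreover have "\<dots> = nt (apex H) (tgt H' b) (Comp \<A> (leg H' b) g) (apex P)"
      using e[OF b] by simp
    moreover have "\<dots> = Comp \<B> (leg (actF H' P) b) ?g"
      using b o g by (auto simp: act_obj_simps intro!: nat_Comp)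
    ultimately show ?thesis
      unfolding sum_lessThan_add_split by simp
  next
    fix b' assume b: "b = width H' + b'" "b' < width P"
    have "(\<Sum>a < width H. Comp \<B> (?h a b) (leg (actF H P) a)) = 0"
      by (rule sum.neutral) (use b z in auto)
    moreover have "(\<Sum>a < width P. Comp \<B> (?h (width H + a) b) (leg (actF H P) (width H + a)))
        = (\<Sum>a < width P. if a = b' then Comp \<B> (nt (apex H) (apex H') g (tgt P b')) (leg (actF H P) (width H + b')) else 0)"
      by (rule sum.cong) (use b z in auto)
    moreover have "Comp \<B> (leg (actF H' P) b) ?g
        = Comp \<B> (nt (apex H) (apex H') g (tgt P b')) (leg (actF H P) (width H + b'))"
      using nat_natural[of "apex H" "apex H'" g "apex P" "tgt P b'" "leg P b'"] o g b
      by (simp add: act_obj_simps)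
    ultimately show ?thesis
      unfolding sum_lessThan_add_split using b by simp
  qed
  have "?g \<in> Hom \<B> (apex (actF H P)) (apex (actF H' P))"
    using o g by (simp add: act_obj_simps nat_in)
  then show ?thesis
    using hin eq by (simp only: fan_tuples_def mem_Collect_eq case_prod_conv act_obj_simps(2)) blast
qed

lemma fan_maps_mor:
  assumes "H \<in> fan_Obj \<A>" "P \<in> fan_Obj \<B>" "P' \<in> fan_Obj \<B>" "g \<in> fan_maps \<B> P P'"
  shows "mor (apex H) (apex P) (apex P') g \<in> fan_maps \<B> (actF H P) (actF H P')"
  using act_mor_tuple[OF assms(1-3)] assms(4) unfolding B.fan_maps_iff_tuple by blast

lemma fan_maps_nt:
  assumes "H \<in> fan_Obj \<A>" "H' \<in> fan_Obj \<A>" "P \<in> fan_Obj \<B>" "g \<in> fan_maps \<A> H H'"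
  shows "nt (apex H) (apex H') g (apex P) \<in> fan_maps \<B> (actF H P) (actF H' P)"
  using act_nat_tuple[OF assms(1-3)] assms(4) unfolding A.fan_maps_iff_tuple B.fan_maps_iff_tuple by blast

lemma act_mor_eq:
  assumes H: "H \<in> fan_Obj \<A>" and P: "P \<in> fan_Obj \<B>" and P': "P' \<in> fan_Obj \<B>"
    and g: "g \<in> fan_maps \<B> P P'"
  shows "act_mor M i i H P P' (fan_class \<B> P P' g)
    = fan_class \<B> (actF H P) (actF H P') (mor (apex H) (apex P) (apex P') g)"
  unfolding act_mor_def
proof (rule B.UN_fan_class[OF P P' g], simp only: case_prod_conv)
  fix g' h' assume t: "(g', h') \<in> fan_tuples \<B> P P'" and g': "g' \<in> fan_maps \<B> P P'"
    and n: "g' - g \<in> null_maps \<B> P (apex P')"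
  note o = fan_ObjD(1)[OF H] fan_ObjD(1)[OF P] fan_ObjD(1)[OF P']
  have "fan_class \<B> (actF H P) (actF H P') (mor (apex H) (apex P) (apex P') g')
      = fan_class \<B> (actF H P) (actF H P') (mor (apex H) (apex P) (apex P') g)"
    using null_maps_mor[OF H P _ n] o g g'
    by (subst B.fan_class_eq_iff)
      (simp_all add: act_obj_in H P P' fan_maps_mor act_obj_simps mor_diff[symmetric] B.fan_maps_in_Hom)
  then show "fan_rel \<B> (actF H P) (actF H P') ``
       {(mor (apex H) (apex P) (apex P') g',
         \<lambda>a b. if a < width H \<and> b < width H
               then (if a = b then mor (tgt H a) (apex P) (apex P') g' else 0)
               else if width H \<le> a \<and> width H \<le> b
               then mor (apex H) (tgt P (a - width H)) (tgt P' (b - width H))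
                      (h' (a - width H) (b - width H))
               else 0)} = fan_class \<B> (actF H P) (actF H P') (mor (apex H) (apex P) (apex P') g)"
    by (subst B.fan_rel_Image[OF act_obj_in[OF H P] act_obj_in[OF H P'] act_mor_tuple[OF H P P' t]]) simp
qed

lemma act_nat_eq:
  assumes H: "H \<in> fan_Obj \<A>" and H': "H' \<in> fan_Obj \<A>" and P: "P \<in> fan_Obj \<B>"
    and g: "g \<in> fan_maps \<A> H H'"
  shows "act_nat M i i H H' (fan_class \<A> H H' g) P
    = fan_class \<B> (actF H P) (actF H' P) (nt (apex H) (apex H') g (apex P))"
  unfolding act_nat_def
proof (rule A.UN_fan_class[OF H H' g], simp only: case_prod_conv)
  fix g' h' assume t: "(g', h') \<in> fan_tuples \<A> H H'" and g': "g' \<in> fan_maps \<A> H H'"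
    and n: "g' - g \<in> null_maps \<A> H (apex H')"
  note o = fan_ObjD(1)[OF H] fan_ObjD(1)[OF H'] fan_ObjD(1)[OF P]
  have "fan_class \<B> (actF H P) (actF H' P) (nt (apex H) (apex H') g' (apex P))
      = fan_class \<B> (actF H P) (actF H' P) (nt (apex H) (apex H') g (apex P))"
    using null_maps_nt[OF H P _ n] o g g'
    by (subst B.fan_class_eq_iff)
      (simp_all add: act_obj_in H H' P fan_maps_nt act_obj_simps nt_diff[symmetric] A.fan_maps_in_Hom)
  then show "fan_rel \<B> (actF H P) (actF H' P) ``
       {(nt (apex H) (apex H') g' (apex P),
         \<lambda>a b. if a < width H \<and> b < width H'
               then nt (tgt H a) (tgt H' b) (h' a b) (apex P)
               else if width H \<le> a \<and> width H' \<le> b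
               then (if a - width H = b - width H'
                     then nt (apex H) (apex H') g' (tgt P (a - width H)) else 0)
               else 0)} = fan_class \<B> (actF H P) (actF H' P) (nt (apex H) (apex H') g (apex P))"
    by (subst B.fan_rel_Image[OF act_obj_in[OF H P] act_obj_in[OF H' P] act_nat_tuple[OF H H' P t]]) simp
qed

end

section \<open>Universal elements\<close>

text \<open>
  The pair \<open>(A, u)\<close> represents \<open>X \<mapsto> Hom(S, XS)\<close> on the 1-morphisms \<open>X\<close> themselves. Since a fan is the
  kernel of its legs, this already determines the functor on all fans.
\<close>

definition universal ::
  "('i, 'f, 'm::ab_group_add, 'k) lin_two_cat \<Rightarrow> ('i, 'f, 'm, 'x, 'n::ab_group_add, 'k) lin_two_rep
    \<Rightarrow> 'i \<Rightarrow> 'x \<Rightarrow> ('f, 'm) fan \<Rightarrow> 'n \<Rightarrow> bool" where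
  "universal C M i S A u \<longleftrightarrow> A \<in> fan_Obj (HomCat C i i) \<and> u \<in> Hom (MCat M i) S (MObj M i i (apex A) S) \<and>
     (\<forall>a < width A. Comp (MCat M i) (MNat M i i (apex A) (tgt A a) (leg A a) S) u = 0) \<and>
     (\<forall>Z \<in> Obj (HomCat C i i).
        (\<forall>x \<in> Hom (MCat M i) S (MObj M i i Z S). \<exists>g \<in> Hom (HomCat C i i) (apex A) Z.
           Comp (MCat M i) (MNat M i i (apex A) Z g S) u = x) \<and>
        (\<forall>g \<in> Hom (HomCat C i i) (apex A) Z. Comp (MCat M i) (MNat M i i (apex A) Z g S) u = 0
           \<longrightarrow> g \<in> null_maps (HomCat C i i) A Z))"

lemma fan_Obj_point: "X \<in> Obj \<A> \<Longrightarrow> (X, []) \<in> fan_Obj \<A>"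
  by (simp add: fan_Obj_def)

lemma null_maps_point: "null_maps \<A> (X, []) Z = {0}"
  by (simp add: null_maps_def)

lemma fan_maps_to_point: "fan_maps \<A> P (X, []) = Hom \<A> (apex P) X"
  by (simp add: fan_maps_def)

lemma fan_Obj_iff_set:
  "P \<in> fan_Obj \<A> \<longleftrightarrow> apex P \<in> Obj \<A> \<and> (\<forall>(Y, f) \<in> set (snd P). Y \<in> Obj \<A> \<and> f \<in> Hom \<A> (apex P) Y)"
  by (fastforce simp: fan_Obj_def in_set_conv_nth case_prod_unfold)

context strict_action
begin

lemma act_obj_unit:
  assumes "P \<in> fan_Obj \<B>"
  shows "actF (fan_unit C i) P = P"
proof -
  have "map (\<lambda>(Q, p). (ob (Unit1 C i) Q, mor (Unit1 C i) (apex P) Q p)) (snd P) = map (\<lambda>x. x) (snd P)"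
    using assms by (intro map_cong) (auto simp: fan_Obj_iff_set act_unit mor_unit split: prod.splits)
  then show ?thesis
    using assms by (cases P) (simp add: act_obj_def fan_Obj_iff_set act_unit)
qed

lemma nt_whisker_right:
  assumes "F \<in> Obj \<A>" "G \<in> Obj \<A>" "K \<in> Obj \<A>" "X \<in> Obj \<B>" "\<alpha> \<in> Hom \<A> F G"
  shows "nt (HComp1 C F K) (HComp1 C G K) (HComp2 C \<alpha> (Idm \<A> K)) X = nt F G \<alpha> (ob K X)"
  using assms
  by (simp add: nat_hcomp2 A.Idm_in nat_Idm mor_Idm act_in)
    (rule B.Comp_Idm[of "ob F (ob K X)" "ob G (ob K X)"], auto simp: act_in nat_in)

lemma nt_whisker_left:
  assumes "F \<in> Obj \<A>" "G \<in> Obj \<A>" "K \<in> Obj \<A>" "X \<in> Obj \<B>" "\<beta> \<in> Hom \<A> G K"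
  shows "nt (HComp1 C F G) (HComp1 C F K) (HComp2 C (Idm \<A> F) \<beta>) X = mor F (ob G X) (ob K X) (nt G K \<beta> X)"
  using assms
  by (simp add: nat_hcomp2 A.Idm_in nat_Idm act_in)
    (rule B.Idm_Comp[of "ob F (ob G X)" "ob F (ob K X)"], auto simp: act_in nat_in mor_in)

text \<open>An equality and not just an isomorphism: the action is strict on objects and morphisms,
  and the lists of legs coming from H, K and P are concatenated in the same order on both
  sides.\<close>

lemma act_obj_assoc:
  assumes H: "H \<in> fan_Obj \<A>" and K: "K \<in> fan_Obj \<A>" and P: "P \<in> fan_Obj \<B>"
  shows "actF (fan_HComp C i H K) P = actF H (actF K P)"
proof -
  have o: "apex H \<in> Obj \<A>" "apex K \<in> Obj \<A>" "apex P \<in> Obj \<B>"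
    "\<And>Y f. (Y, f) \<in> set (snd H) \<Longrightarrow> Y \<in> Obj \<A> \<and> f \<in> Hom \<A> (apex H) Y"
    "\<And>Y f. (Y, f) \<in> set (snd K) \<Longrightarrow> Y \<in> Obj \<A> \<and> f \<in> Hom \<A> (apex K) Y"
    "\<And>Y f. (Y, f) \<in> set (snd P) \<Longrightarrow> Y \<in> Obj \<B> \<and> f \<in> Hom \<B> (apex P) Y"
    using assms by (auto simp: fan_Obj_iff_set)
  show ?thesis
    using o by (auto simp: act_obj_def principal_def act_hcomp1 nt_whisker_right nt_whisker_left mor_hcomp1)
qed

lemma fan_maps_from_point:
  "x \<in> fan_maps \<B> (S, []) (actF H (S, [])) \<longleftrightarrow> x \<in> Hom \<B> S (ob (apex H) S) \<and>
    (\<forall>a < width H. Comp \<B> (nt (apex H) (tgt H a) (leg H a) S) x = 0)"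
  by (auto simp: fan_maps_def act_obj_simps null_maps_point)

text \<open>Yoneda: u is an apex component of the coevaluation, naturality at the identity of A
  gives the formula for \<phi>, and testing \<phi> on fans without legs gives universality.\<close>

lemma internal_hom_universal:
  assumes S: "S \<in> Obj \<B>" and ih: "internal_hom C M i S A \<phi>"
  obtains u where "universal C M i S A u"
    "coev C i A \<phi> = fan_class \<B> (S, []) (actF A (S, [])) u"
    "\<And>H g. \<lbrakk>H \<in> fan_Obj \<A>; g \<in> fan_maps \<A> A H\<rbrakk> \<Longrightarrow> \<phi> H (fan_class \<A> A H g)
      = fan_class \<B> (S, []) (actF H (S, [])) (Comp \<B> (nt (apex A) (apex H) g S) u)"
    "\<And>H. H \<in> fan_Obj \<A> \<Longrightarrow> bij_betw (\<phi> H) (fan_Hom \<A> A H) (fan_Hom \<B> (S, []) (actF H (S, [])))"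
proof -
  note S' = fan_Obj_point[OF S]
  have A: "A \<in> fan_Obj \<A>"
    and bij: "\<And>H. H \<in> fan_Obj \<A> \<Longrightarrow> bij_betw (\<phi> H) (fan_Hom \<A> A H) (fan_Hom \<B> (S, []) (actF H (S, [])))"
    and nat: "\<And>H H' c \<psi>. \<lbrakk>H \<in> fan_Obj \<A>; H' \<in> fan_Obj \<A>; c \<in> fan_Hom \<A> A H; \<psi> \<in> fan_Hom \<A> H H'\<rbrakk> \<Longrightarrow>
         \<phi> H' (fan_Comp \<A> A H H' \<psi> c)
           = fan_Comp \<B> (S, []) (actF H (S, [])) (actF H' (S, [])) (act_nat M i i H H' \<psi> (S, [])) (\<phi> H c)"
    using ih by (auto simp: internal_hom_def Let_def)
  note AS = act_obj_in[OF A S']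
  note oA = fan_ObjD(1)[OF A]
  have Id: "fan_Id \<A> A \<in> fan_Hom \<A> A A"
    by (simp add: A.fan_Id_eq A A.fan_class_in_Hom A.fan_maps_Idm)
  then have "\<phi> A (fan_Id \<A> A) \<in> fan_Hom \<B> (S, []) (actF A (S, []))"
    using bij[OF A] by (auto dest: bij_betwE)
  then obtain u where u: "u \<in> fan_maps \<B> (S, []) (actF A (S, []))"
    and coev: "\<phi> A (fan_Id \<A> A) = fan_class \<B> (S, []) (actF A (S, [])) u"
    by (auto simp: B.fan_Hom_eq[OF S' AS])
  have uH: "u \<in> Hom \<B> S (ob (apex A) S)" using u by (simp add: fan_maps_from_point)
  have eq: "\<phi> H (fan_class \<A> A H g)
      = fan_class \<B> (S, []) (actF H (S, [])) (Comp \<B> (nt (apex A) (apex H) g S) u)"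
    if H: "H \<in> fan_Obj \<A>" and g: "g \<in> fan_maps \<A> A H" for H g
  proof -
    note ntg = fan_maps_nt[OF A H S' g, simplified]
    \<comment> \<open>Writing the class as its composite with the identity makes naturality of
      \<phi> applicable with the identity as the fixed argument.\<close>
    have "fan_class \<A> A H g = fan_Comp \<A> A A H (fan_class \<A> A H g) (fan_Id \<A> A)"
      using A.Comp_Idm[OF oA fan_ObjD(1)[OF H] A.fan_maps_in_Hom[OF g]]
      by (simp add: A.fan_Id_eq A A.fan_Comp_eq[OF A A H A.fan_maps_Idm[OF A] g])
    also have "\<phi> H \<dots> = fan_Comp \<B> (S, []) (actF A (S, [])) (actF H (S, []))
        (act_nat M i i A H (fan_class \<A> A H g) (S, [])) (\<phi> A (fan_Id \<A> A))"
      by (rule nat[OF A H Id A.fan_class_in_Hom[OF A H g]])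
    also have "\<dots> = fan_class \<B> (S, []) (actF H (S, [])) (Comp \<B> (nt (apex A) (apex H) g S) u)"
      unfolding coev act_nat_eq[OF A H S' g] fst_conv
      by (rule B.fan_Comp_eq[OF S' AS act_obj_in[OF H S'] u ntg])
    finally show "\<phi> H (fan_class \<A> A H g)
      = fan_class \<B> (S, []) (actF H (S, [])) (Comp \<B> (nt (apex A) (apex H) g S) u)" .
  qed
  have "universal C M i S A u"
    unfolding universal_def
  proof (intro conjI ballI allI impI)
    show "A \<in> fan_Obj \<A>" "u \<in> Hom \<B> S (ob (apex A) S)" by fact+
    show "Comp \<B> (nt (apex A) (tgt A a) (leg A a) S) u = 0" if "a < width A" for a
      using u that by (simp add: fan_maps_from_point)
  next
    fix Z x assume Z: "Z \<in> Obj \<A>" and x: "x \<in> Hom \<B> S (ob Z S)"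
    note Z' = fan_Obj_point[OF Z]
    note ZS = act_obj_in[OF Z' S']
    have xm: "x \<in> fan_maps \<B> (S, []) (actF (Z, []) (S, []))" using x by (simp add: fan_maps_from_point)
    then have "fan_class \<B> (S, []) (actF (Z, []) (S, [])) x \<in> \<phi> (Z, []) ` fan_class \<A> A (Z, []) ` fan_maps \<A> A (Z, [])"
      using bij[OF Z'] B.fan_class_in_Hom[OF S' ZS xm] by (simp add: bij_betw_def A.fan_Hom_eq[OF A Z'])
    then obtain g where g: "g \<in> fan_maps \<A> A (Z, [])"
      "fan_class \<B> (S, []) (actF (Z, []) (S, [])) x = \<phi> (Z, []) (fan_class \<A> A (Z, []) g)" by auto
    \<comment> \<open>The fan \<open>(S, [])\<close> has no legs, so \<open>0\<close> is the only
      null map out of it and equal classes have equal apex components.\<close>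
    have "x - Comp \<B> (nt (apex A) Z g S) u = 0"
      using g(2) unfolding eq[OF Z' g(1)] B.fan_class_eq_iff[OF S' ZS xm] by (simp add: null_maps_point)
    then show "\<exists>g \<in> Hom \<A> (apex A) Z. Comp \<B> (nt (apex A) Z g S) u = x"
      using g(1) by (auto simp: fan_maps_to_point)
  next
    fix Z g assume Z: "Z \<in> Obj \<A>" and g: "g \<in> Hom \<A> (apex A) Z" and 0: "Comp \<B> (nt (apex A) Z g S) u = 0"
    note Z' = fan_Obj_point[OF Z]
    have gm: "g \<in> fan_maps \<A> A (Z, [])" "0 \<in> fan_maps \<A> A (Z, [])"
      using g A.zero_in_Hom[OF oA Z] by (auto simp: fan_maps_to_point)
    have "Comp \<B> (nt (apex A) Z 0 S) u = 0"
      using B.Comp_0_left[OF S act_in[OF oA S] act_in[OF Z S] uH] by (simp add: nt_0 oA Z S)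
    \<comment> \<open>The class of g is compared with that of \<open>0\<close>; injectivity of
      \<phi> turns the vanishing of the evaluation into nullity of g.\<close>
    then have "\<phi> (Z, []) (fan_class \<A> A (Z, []) g) = \<phi> (Z, []) (fan_class \<A> A (Z, []) 0)"
      using eq[OF Z' gm(1)] eq[OF Z' gm(2)] 0 by simp
    then have "fan_class \<A> A (Z, []) g = fan_class \<A> A (Z, []) 0"
      using bij[OF Z'] A.fan_class_in_Hom[OF A Z' gm(1)] A.fan_class_in_Hom[OF A Z' gm(2)]
      by (meson bij_betw_imp_inj_on inj_onD)
    then show "g \<in> null_maps \<A> A Z"
      unfolding A.fan_class_eq_iff[OF A Z' gm(1)] by simp
  qed
  then show thesis
    using that[of u] eq bij coev by (simp add: coev_def)
qed

end

section \<open>The Yoneda map of a universal element, extended from objects to fans\<close>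

locale universal_element = strict_action C i M
  for C :: "('i, 'f, 'm::ab_group_add, 'k::field) lin_two_cat" and i :: 'i
    and M :: "('i, 'f, 'm, 'x, 'n::ab_group_add, 'k) lin_two_rep" +
  fixes S :: 'x and A :: "('f, 'm) fan" and u :: 'n
  assumes S_in: "S \<in> Obj (MCat M i)" and univ: "universal C M i S A u"
begin

abbreviation "X \<equiv> apex A"

text \<open>The Yoneda map from Hom(X,Z) to Hom(S,ZS). The target Z is an argument because g does
  not determine it.\<close>

definition ev :: "'f \<Rightarrow> 'm \<Rightarrow> 'n" where
  "ev Z g = Comp \<B> (nt X Z g S) u"

lemma fan_A: "A \<in> fan_Obj \<A>"
  and u_in: "u \<in> Hom \<B> S (ob X S)"
  and leg_u: "a < width A \<Longrightarrow> Comp \<B> (nt X (tgt A a) (leg A a) S) u = 0"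
  and ev_surj: "\<lbrakk>Z \<in> Obj \<A>; x \<in> Hom \<B> S (ob Z S)\<rbrakk> \<Longrightarrow> \<exists>g \<in> Hom \<A> X Z. ev Z g = x"
  and ev_null: "\<lbrakk>Z \<in> Obj \<A>; g \<in> Hom \<A> X Z; ev Z g = 0\<rbrakk> \<Longrightarrow> g \<in> null_maps \<A> A Z"
  using univ by (auto simp: universal_def ev_def)

lemma X_in: "X \<in> Obj \<A>"
  using fan_A by (rule fan_ObjD)

lemma ev_Comp:
  assumes "Y \<in> Obj \<A>" "Z \<in> Obj \<A>" "g \<in> Hom \<A> X Y" "h \<in> Hom \<A> Y Z"
  shows "ev Z (Comp \<A> h g) = Comp \<B> (nt Y Z h S) (ev Y g)"
  unfolding ev_def nat_Comp[OF X_in assms S_in]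
  by (rule B.Comp_assoc[of S "ob X S" "ob Y S" "ob Z S"]) (auto simp: S_in X_in act_in nat_in u_in assms)

lemma ev_Idm: "ev X (Idm \<A> X) = u"
  unfolding ev_def nat_Idm[OF X_in S_in] by (rule B.Idm_Comp[OF S_in act_in[OF X_in S_in] u_in])

lemma ev_eq:
  assumes "Z \<in> Obj \<A>" "g \<in> Hom \<A> X Z" "g' \<in> Hom \<A> X Z" "ev Z g = ev Z g'"
  shows "g - g' \<in> null_maps \<A> A Z"
proof (rule ev_null)
  show "ev Z (g - g') = 0"
    using assms unfolding ev_def
    by (simp add: nt_diff X_in S_in
      B.Comp_diff_left[of S "ob X S" "ob Z S" u "nt X Z g S" "nt X Z g' S"] act_in nat_in u_in)
qed (auto intro: A.diff_in_Hom X_in assms)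

text \<open>Injectivity of the Yoneda map modulo null maps. The coalgebra laws and the
  compatibilities of the comparison isomorphism are all checked through it.\<close>

lemma fan_class_eqI:
  assumes H: "H \<in> fan_Obj \<A>" and "g \<in> fan_maps \<A> A H" "g' \<in> fan_maps \<A> A H" "ev (apex H) g = ev (apex H) g'"
  shows "fan_class \<A> A H g = fan_class \<A> A H g'"
  unfolding A.fan_class_eq_iff[OF fan_A H assms(2)]
  by (rule ev_eq) (auto intro: fan_ObjD(1)[OF H] A.fan_maps_in_Hom assms)

text \<open>Once g is found for the apex of H, its composite with each leg of H has evaluation zero
  and is therefore null, which is exactly what makes g a fan map.\<close>

lemma fan_map_ex:
  assumes H: "H \<in> fan_Obj \<A>" and x: "x \<in> Hom \<B> S (ob (apex H) S)"
    and leg_x: "\<And>a. a < width H \<Longrightarrow> Comp \<B> (nt (apex H) (tgt H a) (leg H a) S) x = 0"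
  shows "\<exists>g \<in> fan_maps \<A> A H. ev (apex H) g = x"
proof -
  note o = fan_ObjD[OF H]
  from ev_surj[OF o(1) x] obtain g where g: "g \<in> Hom \<A> X (apex H)" "ev (apex H) g = x" by blast
  have "Comp \<A> (leg H a) g \<in> null_maps \<A> A (tgt H a)" if a: "a < width H" for a
    using ev_Comp[OF o(1) o(2)[OF a] g(1) o(3)[OF a]] g leg_x a o
    by (intro ev_null A.Comp_in[of _ "apex H"]) (auto simp: X_in)
  then show ?thesis
    using g by (auto simp: fan_maps_def)
qed

end

text \<open>Each universal element is the evaluation of a map under the other one; both composites
  of the two maps have the same evaluation as an identity.\<close>

lemma (in strict_action) universal_unique:
  assumes S: "S \<in> Obj \<B>" and A: "universal C M i S A u" and B: "universal C M i S B v"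
  obtains t where "t \<in> fan_maps \<A> A B" "Comp \<B> (nt (apex A) (apex B) t S) u = v"
    "fan_iso \<A> A B (fan_class \<A> A B t)"
proof -
  interpret U: universal_element C i M S A u by unfold_locales fact+
  interpret V: universal_element C i M S B v by unfold_locales fact+
  obtain t where t: "t \<in> fan_maps \<A> A B" "U.ev (apex B) t = v"
    using U.fan_map_ex[OF V.fan_A V.u_in V.leg_u] by blast
  obtain s where s: "s \<in> fan_maps \<A> B A" "V.ev (apex A) s = u"
    using V.fan_map_ex[OF U.fan_A U.u_in U.leg_u] by blast
  have "U.ev (apex A) (Comp \<A> s t) = U.ev (apex A) (Idm \<A> (apex A))"
    using U.ev_Comp[OF V.X_in U.X_in A.fan_maps_in_Hom[OF t(1)] A.fan_maps_in_Hom[OF s(1)]]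
      t(2) s(2) by (simp add: V.ev_def U.ev_Idm)
  then have "fan_Comp \<A> A B A (fan_class \<A> B A s) (fan_class \<A> A B t) = fan_Id \<A> A"
    unfolding A.fan_Comp_eq[OF U.fan_A V.fan_A U.fan_A t(1) s(1)] A.fan_Id_eq[OF U.fan_A]
    by (intro U.fan_class_eqI U.fan_A A.fan_maps_Idm A.fan_maps_Comp[OF U.fan_A V.fan_A U.fan_A t(1) s(1)])
  moreover have "V.ev (apex B) (Comp \<A> t s) = V.ev (apex B) (Idm \<A> (apex B))"
    using V.ev_Comp[OF U.X_in V.X_in A.fan_maps_in_Hom[OF s(1)] A.fan_maps_in_Hom[OF t(1)]]
      t(2) s(2) by (simp add: U.ev_def V.ev_Idm)
  then have "fan_Comp \<A> B A B (fan_class \<A> A B t) (fan_class \<A> B A s) = fan_Id \<A> B"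
    unfolding A.fan_Comp_eq[OF V.fan_A U.fan_A V.fan_A s(1) t(1)] A.fan_Id_eq[OF V.fan_A]
    by (intro V.fan_class_eqI V.fan_A A.fan_maps_Idm A.fan_maps_Comp[OF V.fan_A U.fan_A V.fan_A s(1) t(1)])
  ultimately have "fan_iso \<A> A B (fan_class \<A> A B t)"
    using A.fan_class_in_Hom[OF U.fan_A V.fan_A t(1)] A.fan_class_in_Hom[OF V.fan_A U.fan_A s(1)]
    by (auto simp: fan_iso_def)
  then show thesis
    using t by (intro that[of t]) (auto simp: U.ev_def)
qed

section \<open>The coalgebra of a universal element\<close>

lemma apex_fan_HComp: "apex (fan_HComp C i H K) = HComp1 C (apex H) (apex K)"
  by (simp add: act_obj_def principal_def)

context strict_monoidal
begin

text \<open>The right unit law. \<open>act_obj_unit\<close> covers only the left one, since an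
  action treats its two arguments differently.\<close>

lemma fan_HComp_unit:
  assumes "H \<in> fan_Obj (HomCat C i i)"
  shows "fan_HComp C i H (fan_unit C i) = H"
proof -
  have "map (\<lambda>(Y, f). (HComp1 C Y (Unit1 C i), HComp2 C f (Idm (HomCat C i i) (Unit1 C i)))) (snd H)
      = map (\<lambda>x. x) (snd H)"
    using assms by (intro map_cong) (auto simp: fan_Obj_iff_set hcomp1_unit intro: hcomp2_unit[of "apex H"] split: prod.splits)
  then show ?thesis
    using assms by (cases H) (simp add: act_obj_def principal_def fan_Obj_iff_set hcomp1_unit)
qed

end

context universal_element
begin

text \<open>Makes the results on actions available for whiskering; the rewrites unfold
  \<open>principal\<close>, so that these results speak about the same category \<A>.\<close>

interpretation P: strict_action C i "principal C i"
  rewrites "MCat (principal C i) i = HomCat C i i"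
    and "MObj (principal C i) i i F Y = HComp1 C F Y"
    and "MMor (principal C i) i i F Y Y' f = HComp2 C (Idm (HomCat C i i) F) f"
    and "MNat (principal C i) i i F F' \<alpha> Y = HComp2 C \<alpha> (Idm (HomCat C i i) Y)"
  by (rule principal_action) (simp_all add: principal_def)

abbreviation "AA \<equiv> fan_HComp C i A A"
abbreviation "XX \<equiv> HComp1 C X X"

text \<open>A condition on a representative, not on its class: the equation between elements keeps
  its meaning when the category is enlarged from degree zero to all degrees.\<close>

definition comult_map :: "'m \<Rightarrow> bool" where
  "comult_map d \<longleftrightarrow> d \<in> fan_maps \<A> A AA \<and> ev XX d = Comp \<B> (mor X S (ob X S) u) u"

definition counit_map :: "'m \<Rightarrow> bool" where
  "counit_map e \<longleftrightarrow> e \<in> Hom \<A> X (Unit1 C i) \<and> ev (Unit1 C i) e = Idm \<B> S"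

lemma fan_AA: "AA \<in> fan_Obj \<A>"
  by (rule P.act_obj_in[OF fan_A fan_A])

lemma apex_AA: "apex AA = XX"
  by (simp add: apex_fan_HComp)

lemma XX_in: "XX \<in> Obj \<A>"
  by (simp add: hcomp1_in X_in)

lemma fan_unit_in: "fan_unit C i \<in> fan_Obj \<A>"
  by (simp add: fan_Obj_point unit_in)

lemma obX_in: "Y \<in> Obj \<B> \<Longrightarrow> ob X Y \<in> Obj \<B>"
  by (simp add: act_in X_in)

lemma mu_in: "mor X S (ob X S) u \<in> Hom \<B> (ob X S) (ob X (ob X S))"
  by (simp add: mor_in X_in S_in act_in u_in)

text \<open>The composite is one of fan maps: u is a fan map from S to AS because the legs of A kill
  it, and A acts on this fan map.\<close>

lemma muu_maps: "Comp \<B> (mor X S (ob X S) u) u \<in> fan_maps \<B> (S, []) (actF A (actF A (S, [])))"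
proof -
  note S' = fan_Obj_point[OF S_in]
  have u: "u \<in> fan_maps \<B> (S, []) (actF A (S, []))"
    unfolding fan_maps_from_point using u_in leg_u by blast
  have "mor X S (ob X S) u \<in> fan_maps \<B> (actF A (S, [])) (actF A (actF A (S, [])))"
    using fan_maps_mor[OF fan_A S' act_obj_in[OF fan_A S'] u] by (simp add: act_obj_simps)
  then show ?thesis
    by (rule B.fan_maps_Comp[OF S' act_obj_in[OF fan_A S'] act_obj_in[OF fan_A act_obj_in[OF fan_A S']] u])
qed

text \<open>Strict associativity identifies A(AS) with (AA)S, so the twofold coevaluation satisfies
  the leg conditions under which a fan map into AA exists.\<close>

lemma comult_map_ex: "\<exists>d. comult_map d"
proof -
  note S' = fan_Obj_point[OF S_in]
  have "Comp \<B> (mor X S (ob X S) u) u \<in> fan_maps \<B> (S, []) (actF AA (S, []))"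
    using muu_maps unfolding act_obj_assoc[OF fan_A fan_A S'] .
  then show ?thesis
    using fan_map_ex[OF fan_AA, of "Comp \<B> (mor X S (ob X S) u) u"]
    unfolding fan_maps_from_point comult_map_def apex_AA by blast
qed

lemma counit_map_ex: "\<exists>e. counit_map e"
  using ev_surj[OF unit_in, of "Idm \<B> S"] unfolding counit_map_def
  by (auto simp: act_unit S_in B.Idm_in)

lemma comultD:
  assumes "comult_map d"
  shows "d \<in> fan_maps \<A> A AA" "d \<in> Hom \<A> X XX" "ev XX d = Comp \<B> (mor X S (ob X S) u) u"
  using assms A.fan_maps_in_Hom[of d A AA] by (auto simp: comult_map_def apex_AA)

lemma counitD:
  assumes "counit_map e"
  shows "e \<in> fan_maps \<A> A (fan_unit C i)" "e \<in> Hom \<A> X (Unit1 C i)" "ev (Unit1 C i) e = Idm \<B> S"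
  using assms by (auto simp: counit_map_def fan_maps_to_point)

text \<open>Functoriality of the action of X. It is used when the next morphism acts inside X, so
  that a defining equation of the form (gS)u = x can be applied there.\<close>

lemma mor_mu:
  assumes "Y \<in> Obj \<B>" "f \<in> Hom \<B> (ob X S) Y"
  shows "Comp \<B> (mor X (ob X S) Y f) (Comp \<B> (mor X S (ob X S) u) u)
    = Comp \<B> (mor X S Y (Comp \<B> f u)) u"
  using B.Comp_assoc[of S "ob X S" "ob X (ob X S)" "ob X Y" u "mor X S (ob X S) u" "mor X (ob X S) Y f"]
    mor_Comp[of X S "ob X S" Y u f] assms
  by (simp add: S_in X_in u_in mu_in act_in mor_in)

text \<open>After evaluation both composites become the threefold coevaluation (XXu)(Xu)u.\<close>

lemma comult_coassoc:
  assumes d: "comult_map d"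
  shows "fan_Comp \<A> A AA (fan_HComp C i A AA) (fan_whisker_right C i A AA (fan_class \<A> A AA d) A) (fan_class \<A> A AA d)
    = fan_Comp \<A> A AA (fan_HComp C i A AA) (fan_whisker_left C i A A AA (fan_class \<A> A AA d)) (fan_class \<A> A AA d)"
proof -
  define AAA where "AAA = fan_HComp C i A AA"
  have fan_AAA: "AAA \<in> fan_Obj \<A>" unfolding AAA_def by (rule P.act_obj_in[OF fan_A fan_AA])
  \<comment> \<open>The right whiskering of d ends in (AA)A, the left one in A(AA); strict
    associativity lets their classes be compared at all.\<close>
  have AAA': "fan_HComp C i AA A = AAA"
    unfolding AAA_def by (rule P.act_obj_assoc[OF fan_A fan_A fan_A])
  define XXX where "XXX = HComp1 C X XX"
  have XXX: "HComp1 C XX X = XXX" "apex AAA = XXX" "XXX \<in> Obj \<A>"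
    by (simp_all add: XXX_def AAA_def hcomp1_assoc X_in hcomp1_in apex_fan_HComp apex_AA)
  note dm = comultD[OF d]
  define r where "r = HComp2 C d (Idm \<A> X)"
  define l where "l = HComp2 C (Idm \<A> X) d"
  have wr: "fan_whisker_right C i A AA (fan_class \<A> A AA d) A = fan_class \<A> AA AAA r"
    unfolding r_def using P.act_nat_eq[OF fan_A fan_AA fan_A dm(1)] by (simp add: AAA')
  have rm: "r \<in> fan_maps \<A> AA AAA"
    unfolding r_def using P.fan_maps_nt[OF fan_A fan_AA fan_A dm(1)] by (simp add: AAA')
  have wl: "fan_whisker_left C i A A AA (fan_class \<A> A AA d) = fan_class \<A> AA AAA l"
    unfolding l_def AAA_def using P.act_mor_eq[OF fan_A fan_A fan_AA dm(1)] by simp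
  have lm: "l \<in> fan_maps \<A> AA AAA"
    unfolding l_def AAA_def using P.fan_maps_mor[OF fan_A fan_A fan_AA dm(1)] by simp
  have rH: "r \<in> Hom \<A> XX XXX" and lH: "l \<in> Hom \<A> XX XXX"
    using A.fan_maps_in_Hom[OF rm] A.fan_maps_in_Hom[OF lm] by (simp_all add: apex_AA XXX)
  let ?mu = "mor X S (ob X S) u"
  \<comment> \<open>The component of d at XS slides past Xu by naturality, after which the defining
    equation of d applies to (dS)u.\<close>
  have "ev XXX (Comp \<A> r d) = Comp \<B> (nt XX XXX r S) (Comp \<B> ?mu u)"
    using ev_Comp[OF XX_in XXX(3) dm(2) rH] dm(3) by simp
  also have "nt XX XXX r S = nt X XX d (ob X S)"
    unfolding r_def XXX(1)[symmetric] by (rule nt_whisker_right[OF X_in XX_in X_in S_in dm(2)])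
  also have "Comp \<B> \<dots> (Comp \<B> ?mu u) = Comp \<B> (Comp \<B> (nt X XX d (ob X S)) ?mu) u"
    by (rule B.Comp_assoc[symmetric, of S "ob X S" "ob X (ob X S)" "ob XX (ob X S)"])
      (auto simp: S_in X_in XX_in obX_in u_in mu_in act_in nat_in dm)
  also have "Comp \<B> (nt X XX d (ob X S)) ?mu = Comp \<B> (mor XX S (ob X S) u) (nt X XX d S)"
    by (rule nat_natural[OF X_in XX_in dm(2) S_in obX_in[OF S_in] u_in])
  also have "Comp \<B> \<dots> u = Comp \<B> (mor XX S (ob X S) u) (Comp \<B> (nt X XX d S) u)"
    by (rule B.Comp_assoc[of S "ob X S" "ob XX S" "ob XX (ob X S)"])
      (auto simp: S_in X_in XX_in obX_in u_in act_in nat_in mor_in dm)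
  also have "Comp \<B> (nt X XX d S) u = Comp \<B> ?mu u"
    using dm(3) by (simp add: ev_def)
  also have "mor XX S (ob X S) u = mor X (ob X S) (ob X (ob X S)) ?mu"
    by (rule mor_hcomp1[OF X_in X_in S_in obX_in[OF S_in] u_in])
  \<comment> \<open>The threefold coevaluation has been reached. From here the defining equation of
    d is used backwards, inside X, to arrive at the left whiskering.\<close>
  also have "Comp \<B> \<dots> (Comp \<B> ?mu u) = Comp \<B> (mor X S (ob X (ob X S)) (Comp \<B> ?mu u)) u"
    by (rule mor_mu[OF obX_in[OF obX_in[OF S_in]] mu_in])
  also have "Comp \<B> ?mu u = Comp \<B> (nt X XX d S) u"
    using dm(3) by (simp add: ev_def)
  also have "Comp \<B> (mor X S (ob X (ob X S)) \<dots>) u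
      = Comp \<B> (mor X (ob X S) (ob X (ob X S)) (nt X XX d S)) (Comp \<B> ?mu u)"
    by (rule mor_mu[symmetric, OF obX_in[OF obX_in[OF S_in]]])
      (use nat_in[OF X_in XX_in dm(2) S_in] in \<open>simp add: act_hcomp1 X_in S_in\<close>)
  also have "mor X (ob X S) (ob X (ob X S)) (nt X XX d S) = nt XX XXX l S"
    unfolding l_def XXX_def using nt_whisker_left[OF X_in X_in XX_in S_in dm(2)]
    by (simp add: act_hcomp1 X_in S_in)
  also have "Comp \<B> \<dots> (Comp \<B> ?mu u) = ev XXX (Comp \<A> l d)"
    using ev_Comp[OF XX_in XXX(3) dm(2) lH] dm(3) by simp
  finally have "ev XXX (Comp \<A> r d) = ev XXX (Comp \<A> l d)" .
  then have "fan_class \<A> A AAA (Comp \<A> r d) = fan_class \<A> A AAA (Comp \<A> l d)"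
    by (intro fan_class_eqI fan_AAA A.fan_maps_Comp[OF fan_A fan_AA fan_AAA dm(1)] rm lm) (simp add: XXX)
  then show ?thesis
    unfolding AAA_def[symmetric] wr wl A.fan_Comp_eq[OF fan_A fan_AA fan_AAA dm(1) rm]
      A.fan_Comp_eq[OF fan_A fan_AA fan_AAA dm(1) lm] .
qed

text \<open>Naturality slides e past Xu, leaving u after (eS)u, which is the identity; the result u
  is the evaluation of the identity of X.\<close>

lemma comult_counit_left:
  assumes d: "comult_map d" and e: "counit_map e"
  shows "fan_Comp \<A> A AA A (fan_whisker_right C i A (fan_unit C i) (fan_class \<A> A (fan_unit C i) e) A)
      (fan_class \<A> A AA d) = fan_Id \<A> A"
proof -
  note dm = comultD[OF d] and em = counitD[OF e]
  define r where "r = HComp2 C e (Idm \<A> X)"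
  have wr: "fan_whisker_right C i A (fan_unit C i) (fan_class \<A> A (fan_unit C i) e) A = fan_class \<A> AA A r"
    unfolding r_def using P.act_nat_eq[OF fan_A fan_unit_in fan_A em(1)] by (simp add: P.act_obj_unit fan_A)
  have rm: "r \<in> fan_maps \<A> AA A"
    unfolding r_def using P.fan_maps_nt[OF fan_A fan_unit_in fan_A em(1)] by (simp add: P.act_obj_unit fan_A)
  have rH: "r \<in> Hom \<A> XX X" using A.fan_maps_in_Hom[OF rm] by (simp add: apex_AA)
  let ?mu = "mor X S (ob X S) u"
  have "ev X (Comp \<A> r d) = Comp \<B> (nt XX X r S) (Comp \<B> ?mu u)"
    using ev_Comp[OF XX_in X_in dm(2) rH] dm(3) by simp
  also have "nt XX X r S = nt X (Unit1 C i) e (ob X S)"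
    unfolding r_def using nt_whisker_right[OF X_in unit_in X_in S_in em(2)] by (simp add: unit_hcomp1 X_in)
  also have "Comp \<B> \<dots> (Comp \<B> ?mu u) = Comp \<B> (Comp \<B> (nt X (Unit1 C i) e (ob X S)) ?mu) u"
    by (rule B.Comp_assoc[symmetric, of S "ob X S" "ob X (ob X S)" "ob (Unit1 C i) (ob X S)"])
      (auto simp: S_in X_in unit_in obX_in u_in mu_in act_in nat_in em)
  also have "Comp \<B> (nt X (Unit1 C i) e (ob X S)) ?mu
      = Comp \<B> (mor (Unit1 C i) S (ob X S) u) (nt X (Unit1 C i) e S)"
    by (rule nat_natural[OF X_in unit_in em(2) S_in obX_in[OF S_in] u_in])
  also have "Comp \<B> \<dots> u = Comp \<B> (mor (Unit1 C i) S (ob X S) u) (Comp \<B> (nt X (Unit1 C i) e S) u)"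
    by (rule B.Comp_assoc[of S "ob X S" "ob (Unit1 C i) S" "ob (Unit1 C i) (ob X S)"])
      (auto simp: S_in X_in unit_in obX_in u_in act_in nat_in mor_in em)
  also have "\<dots> = u"
    using em(3) B.Comp_Idm[OF S_in obX_in[OF S_in] u_in] by (simp add: ev_def mor_unit S_in obX_in u_in)
  finally have "ev X (Comp \<A> r d) = ev X (Idm \<A> X)" by (simp add: ev_Idm)
  then have "fan_class \<A> A A (Comp \<A> r d) = fan_class \<A> A A (Idm \<A> X)"
    by (intro fan_class_eqI fan_A A.fan_maps_Comp[OF fan_A fan_AA fan_A dm(1)] rm A.fan_maps_Idm)
  then show ?thesis
    unfolding wr A.fan_Comp_eq[OF fan_A fan_AA fan_A dm(1) rm] A.fan_Id_eq[OF fan_A] .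
qed

text \<open>Here e acts inside X, so no naturality is involved: \<open>mor_mu\<close> brings (eS)u
  under X, where it is the identity.\<close>

lemma comult_counit_right:
  assumes d: "comult_map d" and e: "counit_map e"
  shows "fan_Comp \<A> A AA A (fan_whisker_left C i A A (fan_unit C i) (fan_class \<A> A (fan_unit C i) e))
      (fan_class \<A> A AA d) = fan_Id \<A> A"
proof -
  note dm = comultD[OF d] and em = counitD[OF e]
  define l where "l = HComp2 C (Idm \<A> X) e"
  have wl: "fan_whisker_left C i A A (fan_unit C i) (fan_class \<A> A (fan_unit C i) e) = fan_class \<A> AA A l"
    unfolding l_def using P.act_mor_eq[OF fan_A fan_A fan_unit_in em(1)] by (simp add: fan_HComp_unit fan_A)
  have lm: "l \<in> fan_maps \<A> AA A"
    unfolding l_def using P.fan_maps_mor[OF fan_A fan_A fan_unit_in em(1)] by (simp add: fan_HComp_unit fan_A)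
  have lH: "l \<in> Hom \<A> XX X" using A.fan_maps_in_Hom[OF lm] by (simp add: apex_AA)
  let ?mu = "mor X S (ob X S) u"
  have "ev X (Comp \<A> l d) = Comp \<B> (nt XX X l S) (Comp \<B> ?mu u)"
    using ev_Comp[OF XX_in X_in dm(2) lH] dm(3) by simp
  also have "nt XX X l S = mor X (ob X S) S (nt X (Unit1 C i) e S)"
    unfolding l_def using nt_whisker_left[OF X_in X_in unit_in S_in em(2)]
    by (simp add: hcomp1_unit X_in act_unit S_in)
  also have "Comp \<B> \<dots> (Comp \<B> ?mu u) = Comp \<B> (mor X S S (Comp \<B> (nt X (Unit1 C i) e S) u)) u"
    by (rule mor_mu[OF S_in]) (use nat_in[OF X_in unit_in em(2) S_in] in \<open>simp add: act_unit S_in\<close>)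
  also have "\<dots> = u"
    using em(3) B.Idm_Comp[OF S_in obX_in[OF S_in] u_in] by (simp add: ev_def mor_Idm X_in S_in)
  finally have "ev X (Comp \<A> l d) = ev X (Idm \<A> X)" by (simp add: ev_Idm)
  then have "fan_class \<A> A A (Comp \<A> l d) = fan_class \<A> A A (Idm \<A> X)"
    by (intro fan_class_eqI fan_A A.fan_maps_Comp[OF fan_A fan_AA fan_A dm(1)] lm A.fan_maps_Idm)
  then show ?thesis
    unfolding wl A.fan_Comp_eq[OF fan_A fan_AA fan_A dm(1) lm] A.fan_Id_eq[OF fan_A] .
qed

lemma universal_coalgebra:
  assumes d: "comult_map d" and e: "counit_map e"
  shows "coalgebra C i A (fan_class \<A> A AA d) (fan_class \<A> A (fan_unit C i) e)"
  using comult_coassoc[OF d] comult_counit_left[OF d e] comult_counit_right[OF d e]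
    A.fan_class_in_Hom[OF fan_A fan_AA comultD(1)[OF d]]
    A.fan_class_in_Hom[OF fan_A fan_unit_in counitD(1)[OF e]] fan_A
  by (simp add: coalgebra_def Let_def)

text \<open>The isomorphism t is the one with (tS)u = v. Both d't and (tt)d evaluate to the twofold
  coevaluation built from v, and both e and e't evaluate to the identity of S.\<close>

lemma universal_coalgebra_iso:
  assumes d: "comult_map d" and e: "counit_map e" and V: "universal_element C i M S B v"
    and d': "universal_element.comult_map C i M S B v d'" and e': "universal_element.counit_map C i M S B v e'"
  obtains t where "coalgebra_iso C i A (fan_class \<A> A AA d) (fan_class \<A> A (fan_unit C i) e)
    B (fan_class \<A> B (fan_HComp C i B B) d') (fan_class \<A> B (fan_unit C i) e') (fan_class \<A> A B t)"
proof -
  interpret V: universal_element C i M S B v by (rule V)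
  obtain t where tm: "t \<in> fan_maps \<A> A B" and t: "Comp \<B> (nt X V.X t S) u = v"
    and iso: "fan_iso \<A> A B (fan_class \<A> A B t)"
    by (rule universal_unique[OF S_in univ V.univ])
  note dm = comultD[OF d] and em = counitD[OF e] and dm' = V.comultD[OF d'] and em' = V.counitD[OF e']
  have tH: "t \<in> Hom \<A> X V.X" by (rule A.fan_maps_in_Hom[OF tm])
  define AB where "AB = fan_HComp C i A B"
  have fan_AB: "AB \<in> fan_Obj \<A>" unfolding AB_def by (rule P.act_obj_in[OF fan_A V.fan_A])
  define XB where "XB = HComp1 C X V.X"
  have XB: "XB \<in> Obj \<A>" "apex AB = XB"
    by (simp_all add: XB_def AB_def hcomp1_in X_in V.X_in apex_fan_HComp)
  define r where "r = HComp2 C t (Idm \<A> V.X)"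
  define l where "l = HComp2 C (Idm \<A> X) t"
  have wr: "fan_whisker_right C i A B (fan_class \<A> A B t) B = fan_class \<A> AB V.AA r"
    unfolding r_def AB_def using P.act_nat_eq[OF fan_A V.fan_A V.fan_A tm] by simp
  have rm: "r \<in> fan_maps \<A> AB V.AA"
    unfolding r_def AB_def using P.fan_maps_nt[OF fan_A V.fan_A V.fan_A tm] by simp
  have wl: "fan_whisker_left C i A A B (fan_class \<A> A B t) = fan_class \<A> AA AB l"
    unfolding l_def AB_def using P.act_mor_eq[OF fan_A fan_A V.fan_A tm] by simp
  have lm: "l \<in> fan_maps \<A> AA AB"
    unfolding l_def AB_def using P.fan_maps_mor[OF fan_A fan_A V.fan_A tm] by simp
  have rH: "r \<in> Hom \<A> XB V.XX" and lH: "l \<in> Hom \<A> XX XB"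
    using A.fan_maps_in_Hom[OF rm] A.fan_maps_in_Hom[OF lm] by (simp_all add: apex_AA V.apex_AA XB)
  note rlm = A.fan_maps_Comp[OF fan_AA fan_AB V.fan_AA lm rm]
  have ldH: "Comp \<A> l d \<in> Hom \<A> X XB"
    by (rule A.Comp_in[OF X_in XX_in XB(1) dm(2) lH])
  let ?mu = "mor X S (ob X S) u" and ?mv = "mor V.X S (ob V.X S) v"
  have "ev XB (Comp \<A> l d) = Comp \<B> (nt XX XB l S) (Comp \<B> ?mu u)"
    using ev_Comp[OF XX_in XB(1) dm(2) lH] dm(3) by simp
  also have "nt XX XB l S = mor X (ob X S) (ob V.X S) (nt X V.X t S)"
    unfolding l_def XB_def by (rule nt_whisker_left[OF X_in X_in V.X_in S_in tH])
  also have "Comp \<B> \<dots> (Comp \<B> ?mu u) = Comp \<B> (mor X S (ob V.X S) v) u"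
    using mor_mu[OF V.obX_in[OF S_in] nat_in[OF X_in V.X_in tH S_in]] t by simp
  \<comment> \<open>Whiskering t inside X replaces the inner u by v; the outer u is replaced only
    after the other t has moved past Xv by naturality.\<close>
  finally have ev_ld: "ev XB (Comp \<A> l d) = Comp \<B> (mor X S (ob V.X S) v) u" .
  have "ev V.XX (Comp \<A> (Comp \<A> r l) d) = ev V.XX (Comp \<A> r (Comp \<A> l d))"
    by (subst A.Comp_assoc[OF X_in XX_in XB(1) V.XX_in dm(2) lH rH]) (rule refl)
  also have "\<dots> = Comp \<B> (nt XB V.XX r S) (Comp \<B> (mor X S (ob V.X S) v) u)"
    using ev_Comp[OF XB(1) V.XX_in ldH rH] ev_ld by simp
  also have "nt XB V.XX r S = nt X V.X t (ob V.X S)"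
    unfolding r_def XB_def by (rule nt_whisker_right[OF X_in V.X_in V.X_in S_in tH])
  also have "Comp \<B> \<dots> (Comp \<B> (mor X S (ob V.X S) v) u)
      = Comp \<B> (Comp \<B> (nt X V.X t (ob V.X S)) (mor X S (ob V.X S) v)) u"
    by (rule B.Comp_assoc[symmetric, of S "ob X S" "ob X (ob V.X S)" "ob V.X (ob V.X S)"])
      (auto simp: S_in X_in V.X_in u_in V.u_in act_in nat_in mor_in tH)
  also have "Comp \<B> (nt X V.X t (ob V.X S)) (mor X S (ob V.X S) v) = Comp \<B> ?mv (nt X V.X t S)"
    by (rule nat_natural[OF X_in V.X_in tH S_in V.obX_in[OF S_in] V.u_in])
  also have "Comp \<B> \<dots> u = Comp \<B> ?mv (Comp \<B> (nt X V.X t S) u)"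
    by (rule B.Comp_assoc[of S "ob X S" "ob V.X S" "ob V.X (ob V.X S)"])
      (auto simp: S_in X_in V.X_in u_in V.u_in act_in nat_in mor_in tH)
  also have "\<dots> = V.ev V.XX d'" using t dm'(3) by simp
  also have "\<dots> = ev V.XX (Comp \<A> d' t)"
    using ev_Comp[OF V.X_in V.XX_in tH dm'(2)] t by (simp add: ev_def V.ev_def)
  finally have "ev V.XX (Comp \<A> d' t) = ev V.XX (Comp \<A> (Comp \<A> r l) d)" by simp
  then have "fan_class \<A> A V.AA (Comp \<A> d' t) = fan_class \<A> A V.AA (Comp \<A> (Comp \<A> r l) d)"
    by (intro fan_class_eqI V.fan_AA A.fan_maps_Comp[OF fan_A V.fan_A V.fan_AA tm dm'(1)]
        A.fan_maps_Comp[OF fan_A fan_AA V.fan_AA dm(1) rlm]) (simp add: V.apex_AA)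
  then have comult: "fan_Comp \<A> A B V.AA (fan_class \<A> B V.AA d') (fan_class \<A> A B t)
      = fan_Comp \<A> A AA V.AA (fan_Comp \<A> AA AB V.AA (fan_whisker_right C i A B (fan_class \<A> A B t) B)
          (fan_whisker_left C i A A B (fan_class \<A> A B t))) (fan_class \<A> A AA d)"
    unfolding wr wl A.fan_Comp_eq[OF fan_A V.fan_A V.fan_AA tm dm'(1)]
      A.fan_Comp_eq[OF fan_AA fan_AB V.fan_AA lm rm] A.fan_Comp_eq[OF fan_A fan_AA V.fan_AA dm(1) rlm] .
  have "ev (Unit1 C i) (Comp \<A> e' t) = ev (Unit1 C i) e"
    using ev_Comp[OF V.X_in unit_in tH em'(2)] t em(3) em'(3) by (simp add: ev_def V.ev_def)
  then have "fan_class \<A> A (fan_unit C i) (Comp \<A> e' t) = fan_class \<A> A (fan_unit C i) e"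
    by (intro fan_class_eqI fan_unit_in em A.fan_maps_Comp[OF fan_A V.fan_A fan_unit_in tm em'(1)]) simp
  then have counit: "fan_Comp \<A> A B (fan_unit C i) (fan_class \<A> B (fan_unit C i) e') (fan_class \<A> A B t)
      = fan_class \<A> A (fan_unit C i) e"
    unfolding A.fan_Comp_eq[OF fan_A V.fan_A fan_unit_in tm em'(1)] .
  show thesis
    by (rule that[of t]) (use iso comult counit in \<open>simp add: coalgebra_iso_def Let_def AB_def\<close>)
qed

end

text \<open>On classes of fan maps \<phi> is the evaluation at u, so applying the inverse of \<phi>
  to a class returns the class of any fan map with that evaluation; d and e are such fan
  maps.\<close>

lemma (in strict_action) comult_counit_eq:
  assumes S: "S \<in> Obj \<B>" and ih: "internal_hom C M i S A \<phi>"
  obtains u d e where "universal_element C i M S A u" "universal_element.comult_map C i M S A u d"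
    "universal_element.counit_map C i M S A u e"
    "comult C M i S A \<phi> = fan_class \<A> A (fan_HComp C i A A) d"
    "counit C M i S A \<phi> = fan_class \<A> A (fan_unit C i) e"
proof -
  obtain u where u: "universal C M i S A u"
    and coev: "coev C i A \<phi> = fan_class \<B> (S, []) (actF A (S, [])) u"
    and eq: "\<And>H g. \<lbrakk>H \<in> fan_Obj \<A>; g \<in> fan_maps \<A> A H\<rbrakk> \<Longrightarrow> \<phi> H (fan_class \<A> A H g)
      = fan_class \<B> (S, []) (actF H (S, [])) (Comp \<B> (nt (apex A) (apex H) g S) u)"
    and bij: "\<And>H. H \<in> fan_Obj \<A> \<Longrightarrow> bij_betw (\<phi> H) (fan_Hom \<A> A H) (fan_Hom \<B> (S, []) (actF H (S, [])))"
    by (rule internal_hom_universal[OF S ih]) blast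
  interpret U: universal_element C i M S A u by unfold_locales fact+
  obtain d e where d: "U.comult_map d" and e: "U.counit_map e"
    using U.comult_map_ex U.counit_map_ex by blast
  note S' = fan_Obj_point[OF S]
  note dm = U.comultD[OF d] and em = U.counitD[OF e]
  have inv: "inv_into (fan_Hom \<A> A H) (\<phi> H) (fan_class \<B> (S, []) (actF H (S, [])) (U.ev (apex H) g)) = fan_class \<A> A H g"
    if H: "H \<in> fan_Obj \<A>" and g: "g \<in> fan_maps \<A> A H" for H g
    using eq[OF H g] bij_betw_inv_into_left[OF bij[OF H] A.fan_class_in_Hom[OF U.fan_A H g]]
    by (simp add: U.ev_def)
  note AS = act_obj_in[OF U.fan_A S'] and AAS = act_obj_in[OF U.fan_A act_obj_in[OF U.fan_A S']]
  have um: "u \<in> fan_maps \<B> (S, []) (actF A (S, []))"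
    unfolding fan_maps_from_point using U.u_in U.leg_u by blast
  have mum: "mor (apex A) S (ob (apex A) S) u \<in> fan_maps \<B> (actF A (S, [])) (actF A (actF A (S, [])))"
    using fan_maps_mor[OF U.fan_A S' AS um] by (simp add: act_obj_simps)
  have "fan_Comp \<B> (S, []) (actF A (S, [])) (actF A (actF A (S, [])))
      (act_mor M i i A (S, []) (actF A (S, [])) (coev C i A \<phi>)) (coev C i A \<phi>)
    = fan_class \<B> (S, []) (actF A (actF A (S, []))) (Comp \<B> (mor (apex A) S (ob (apex A) S) u) u)"
    unfolding coev using act_mor_eq[OF U.fan_A S' AS um] B.fan_Comp_eq[OF S' AS AAS um mum]
    by (simp add: act_obj_simps)
  then have "comult C M i S A \<phi> = fan_class \<A> A U.AA d"
    using inv[OF U.fan_AA dm(1)] dm(3)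
    by (simp add: comult_def Let_def act_obj_assoc[OF U.fan_A U.fan_A S', symmetric] U.apex_AA)
  moreover have "counit C M i S A \<phi> = fan_class \<A> A (fan_unit C i) e"
    using inv[OF U.fan_unit_in em(1)] em(3)
    by (simp add: counit_def B.fan_Id_eq[OF S'] act_obj_unit[OF S'])
  ultimately show thesis
    using that U.universal_element_axioms d e by blast
qed

section \<open>Graded categories and their envelopes\<close>

lemma total_cat_simps [simp]:
  "Obj (total_cat \<A>) = GObj \<A>" "Idm (total_cat \<A>) = GIdm \<A>" "Comp (total_cat \<A>) = GComp \<A>"
  "Scale (total_cat \<A>) = GScale \<A>"
  by (simp_all add: total_cat_def)

lemma degree_zero_cat_simps [simp]:
  "Obj (degree_zero_cat \<A>) = GObj \<A>" "Idm (degree_zero_cat \<A>) = GIdm \<A>"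
  "Comp (degree_zero_cat \<A>) = GComp \<A>" "Scale (degree_zero_cat \<A>) = GScale \<A>"
  "Hom (degree_zero_cat \<A>) X Y = HomD \<A> X Y 0"
  by (simp_all add: degree_zero_cat_def)

context graded_category
begin

interpretation V: vector_space "GScale \<A>"
  using Scale_vector_space by simp

lemma HomD_in_Hom: "f \<in> HomD \<A> X Y d \<Longrightarrow> f \<in> Hom (total_cat \<A>) X Y"
  by (auto simp: total_cat_def intro: V.span_base)

lemma zero_in_HomD: "\<lbrakk>X \<in> GObj \<A>; Y \<in> GObj \<A>\<rbrakk> \<Longrightarrow> 0 \<in> HomD \<A> X Y d"
  by (simp add: HomD_subspace V.subspace_0)

lemma linear_degree_zero: "linear_category (degree_zero_cat \<A>)"
proof
  fix W X Y Z f g h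
  assume "W \<in> Obj (degree_zero_cat \<A>)" "X \<in> Obj (degree_zero_cat \<A>)" "Y \<in> Obj (degree_zero_cat \<A>)"
    "Z \<in> Obj (degree_zero_cat \<A>)" "f \<in> Hom (degree_zero_cat \<A>) W X" "g \<in> Hom (degree_zero_cat \<A>) X Y"
    "h \<in> Hom (degree_zero_cat \<A>) Y Z"
  then show "Comp (degree_zero_cat \<A>) (Comp (degree_zero_cat \<A>) h g) f
      = Comp (degree_zero_cat \<A>) h (Comp (degree_zero_cat \<A>) g f)"
    using Comp_assoc[of W X Y Z f g h] by (simp add: HomD_in_Hom)
next
  fix X Y Z f g g'
  assume "X \<in> Obj (degree_zero_cat \<A>)" "Y \<in> Obj (degree_zero_cat \<A>)" "Z \<in> Obj (degree_zero_cat \<A>)"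
    "f \<in> Hom (degree_zero_cat \<A>) X Y" "g \<in> Hom (degree_zero_cat \<A>) Y Z" "g' \<in> Hom (degree_zero_cat \<A>) Y Z"
  then show "Comp (degree_zero_cat \<A>) (g + g') f = Comp (degree_zero_cat \<A>) g f + Comp (degree_zero_cat \<A>) g' f"
    using Comp_add_left[of X Y Z f g g'] by (simp add: HomD_in_Hom)
next
  fix X Y Z f f' g
  assume "X \<in> Obj (degree_zero_cat \<A>)" "Y \<in> Obj (degree_zero_cat \<A>)" "Z \<in> Obj (degree_zero_cat \<A>)"
    "f \<in> Hom (degree_zero_cat \<A>) X Y" "f' \<in> Hom (degree_zero_cat \<A>) X Y" "g \<in> Hom (degree_zero_cat \<A>) Y Z"
  then show "Comp (degree_zero_cat \<A>) g (f + f') = Comp (degree_zero_cat \<A>) g f + Comp (degree_zero_cat \<A>) g f'"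
    using Comp_add_right[of X Y Z f f' g] by (simp add: HomD_in_Hom)
next
  fix X Y Z f g a
  assume "X \<in> Obj (degree_zero_cat \<A>)" "Y \<in> Obj (degree_zero_cat \<A>)" "Z \<in> Obj (degree_zero_cat \<A>)"
    "f \<in> Hom (degree_zero_cat \<A>) X Y" "g \<in> Hom (degree_zero_cat \<A>) Y Z"
  then show "Comp (degree_zero_cat \<A>) (Scale (degree_zero_cat \<A>) a g) f
        = Scale (degree_zero_cat \<A>) a (Comp (degree_zero_cat \<A>) g f)"
    "Comp (degree_zero_cat \<A>) g (Scale (degree_zero_cat \<A>) a f)
        = Scale (degree_zero_cat \<A>) a (Comp (degree_zero_cat \<A>) g f)"
    using Comp_scale_left[of X Y Z f g a] Comp_scale_right[of X Y Z f g a]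
    by (simp_all add: HomD_in_Hom)
next
  fix X Y Z f g
  assume "X \<in> Obj (degree_zero_cat \<A>)" "Y \<in> Obj (degree_zero_cat \<A>)" "Z \<in> Obj (degree_zero_cat \<A>)"
    "f \<in> Hom (degree_zero_cat \<A>) X Y" "g \<in> Hom (degree_zero_cat \<A>) Y Z"
  then show "Comp (degree_zero_cat \<A>) g f \<in> Hom (degree_zero_cat \<A>) X Z"
    using Comp_degree[of X Y Z f 0 g 0] by simp
next
  fix X Y f
  assume "X \<in> Obj (degree_zero_cat \<A>)" "Y \<in> Obj (degree_zero_cat \<A>)" "f \<in> Hom (degree_zero_cat \<A>) X Y"
  then show "Comp (degree_zero_cat \<A>) f (Idm (degree_zero_cat \<A>) X) = f"
    "Comp (degree_zero_cat \<A>) (Idm (degree_zero_cat \<A>) Y) f = f"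
    using Comp_Idm[of X Y f] Idm_Comp[of X Y f] by (simp_all add: HomD_in_Hom)
qed (simp_all add: V.scale_right_distrib V.scale_left_distrib HomD_subspace Idm_degree)

lemma homogeneous_decomposition:
  assumes X: "X \<in> GObj \<A>" and Y: "Y \<in> GObj \<A>" and f: "f \<in> Hom (total_cat \<A>) X Y"
  obtains D x where "finite D" "\<And>d. d \<in> D \<Longrightarrow> x d \<in> HomD \<A> X Y d" "f = (\<Sum>d\<in>D. x d)"
proof -
  \<comment> \<open>Families are taken over all degrees and vanish outside D, which allows two of
    them to be added over the union of their degree sets.\<close>
  let ?P = "\<lambda>f. \<exists>D x. finite D \<and> (\<forall>d. x d \<in> HomD \<A> X Y d) \<and> (\<forall>d. d \<notin> D \<longrightarrow> x d = 0) \<and> f = (\<Sum>d\<in>D. x d)"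
  have "f \<in> V.span (\<Union>d. HomD \<A> X Y d)" using f by (simp add: total_cat_def)
  then have "?P f"
  proof (induction rule: V.span_induct)
    case base
    show ?case
    proof (rule V.subspaceI, unfold mem_Collect_eq)
      show "?P 0"
        by (rule exI[of _ "{}"], rule exI[of _ "\<lambda>d. 0"]) (simp add: zero_in_HomD X Y)
    next
      fix f f'
      assume "?P f" "?P f'"
      then obtain D x D' x' where *: "finite D" "\<forall>d. x d \<in> HomD \<A> X Y d" "\<forall>d. d \<notin> D \<longrightarrow> x d = 0"
          "f = sum x D"
        "finite D'" "\<forall>d. x' d \<in> HomD \<A> X Y d" "\<forall>d. d \<notin> D' \<longrightarrow> x' d = 0" "f' = sum x' D'"
        by blast
      have "sum x D = sum x (D \<union> D')" "sum x' D' = sum x' (D \<union> D')"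
        by (rule sum.mono_neutral_left; use * in auto)+
      then have "f + f' = (\<Sum>d\<in>D \<union> D'. x d + x' d)" by (simp add: sum.distrib *)
      then show "?P (f + f')"
        using * X Y
        by (intro exI[of _ "D \<union> D'"] exI[of _ "\<lambda>d. x d + x' d"])
          (auto intro: V.subspace_add[OF HomD_subspace])
    next
      fix c f
      assume "?P f"
      then obtain D x where *: "finite D" "\<forall>d. x d \<in> HomD \<A> X Y d" "\<forall>d. d \<notin> D \<longrightarrow> x d = 0"
          "f = sum x D"
        by blast
      then show "?P (GScale \<A> c f)"
        using X Y by (intro exI[of _ D] exI[of _ "\<lambda>d. GScale \<A> c (x d)"])
          (auto intro: V.subspace_scale[OF HomD_subspace] simp: V.scale_sum_right)
    qed
  next
    case (step y)
    then obtain d where "y \<in> HomD \<A> X Y d" by blast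
    then show ?case
      by (intro exI[of _ "{d}"] exI[of _ "\<lambda>e. if e = d then y else 0"]) (auto simp: zero_in_HomD X Y)
  qed
  then show thesis using that by blast
qed

lemma homogeneous_sum_zero:
  assumes X: "X \<in> GObj \<A>" and Y: "Y \<in> GObj \<A>" and D: "finite D"
    and x: "\<And>d. d \<in> D \<Longrightarrow> x d \<in> HomD \<A> X Y d" and 0: "(\<Sum>d\<in>D. x d) = 0" and d: "d \<in> D"
  shows "x d = 0"
proof -
  \<comment> \<open>\<open>HomD_direct\<close> expects a homogeneous element in every degree and
    finite support, hence the cut-off outside D.\<close>
  define y where "y = (\<lambda>d. if d \<in> D then x d else 0)"
  have sub: "{d. y d \<noteq> 0} \<subseteq> D" by (auto simp: y_def)
  have "(\<Sum>d | y d \<noteq> 0. y d) = (\<Sum>d\<in>D. y d)"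
    by (rule sum.mono_neutral_left[OF D sub]) auto
  also have "\<dots> = 0" using 0 by (simp add: y_def)
  finally have "y d = 0"
    by (rule HomD_direct[OF X Y _ finite_subset[OF sub D], rotated]) (auto simp: y_def x zero_in_HomD X Y)
  then show ?thesis using d by (simp add: y_def)
qed

end

lemma envelope_simps [simp]:
  "GObj (envelope \<A>) = GObj \<A> \<times> UNIV" "GComp (envelope \<A>) = GComp \<A>" "GScale (envelope \<A>) = GScale \<A>"
  "GIdm (envelope \<A>) (X, g) = GIdm \<A> X"
  "HomD (envelope \<A>) (X, g) (Y, h) d = HomD \<A> X Y (d - (h - g))"
  by (simp_all add: envelope_def)

text \<open>A shift only renumbers the degrees, and the union runs over all of them.\<close>

lemma Hom_total_envelope [simp]:
  fixes \<A> :: "('o, 'm::ab_group_add, 'k::field, 'g::ab_group_add) gr_cat"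
  shows "Hom (total_cat (envelope \<A>)) (X, g) (Y, h) = Hom (total_cat \<A>) X Y"
proof -
  have "(\<Union>d. HomD \<A> X Y (d - (h - g))) = (\<Union>d. HomD \<A> X Y d)"
    by (auto, metis add_diff_cancel_right')
  then show ?thesis by (simp add: total_cat_def)
qed

lemma graded_category_envelope:
  assumes "graded_category \<A>"
  shows "graded_category (envelope \<A>)"
proof -
  interpret graded_category \<A> by fact
  have lin: "linear_category (total_cat (envelope \<A>))"
  proof (rule linear_category.intro, unfold split_paired_all)
    show "vector_space (Scale (total_cat (envelope \<A>)))" using Scale_vector_space by simp
  qed (simp_all add: Hom_subspace[simplified] Idm_in[simplified], (rule Comp_in[simplified]
      Comp_Idm[simplified] Idm_Comp[simplified] Comp_assoc[simplified] Comp_add_left[simplified]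
      Comp_add_right[simplified] Comp_scale_left[simplified] Comp_scale_right[simplified]; assumption)+)
  have "graded_category_axioms (envelope \<A>)"
  proof (rule graded_category_axioms.intro, unfold split_paired_all)
    fix X g Y h d
    assume "(X, g) \<in> GObj (envelope \<A>)" "(Y, h) \<in> GObj (envelope \<A>)"
    then show "module.subspace (GScale (envelope \<A>)) (HomD (envelope \<A>) (X, g) (Y, h) d)"
      by (simp add: HomD_subspace)
  next
    fix X g Y h x d
    assume *: "(X, g) \<in> GObj (envelope \<A>)" "(Y, h) \<in> GObj (envelope \<A>)"
      "\<And>d. x d \<in> HomD (envelope \<A>) (X, g) (Y, h) d" "finite {d. x d \<noteq> 0}" "(\<Sum>d | x d \<noteq> 0. x d) = 0"
    show "x d = 0"
    proof (cases "x d = 0")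
      case False
      show ?thesis
      \<comment> \<open>The component of degree d in the envelope has degree d - (h - g) in the
        original category; the family and its index set are renumbered accordingly.\<close>
      proof (rule homogeneous_sum_zero[of X Y "(\<lambda>d. d - (h - g)) ` {d. x d \<noteq> 0}"
            "\<lambda>d. x (d + (h - g))" "d - (h - g)", simplified])
        have "(\<Sum>d\<in>(\<lambda>d. d - (h - g)) ` {d. x d \<noteq> 0}. x (d + (h - g))) = (\<Sum>d | x d \<noteq> 0. x d)"
          by (subst sum.reindex) (auto simp: inj_on_def)
        then show "(\<Sum>d\<in>(\<lambda>d. d - (h - g)) ` {d. x d \<noteq> 0}. x (d + (h - g))) = 0" using * by simp
        show "x (d + (h - g)) \<in> HomD \<A> X Y d" if "d \<in> (\<lambda>d. d - (h - g)) ` {d. x d \<noteq> 0}" for d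
          using *(3)[of "d + (h - g)"] by simp
      qed (use * False in auto)
    qed
  next
    fix X g
    assume "(X, g) \<in> GObj (envelope \<A>)"
    then show "GIdm (envelope \<A>) (X, g) \<in> HomD (envelope \<A>) (X, g) (X, g) 0" by (simp add: Idm_degree)
  next
    fix X a Y b Z c f d g e
    assume "(X, a) \<in> GObj (envelope \<A>)" "(Y, b) \<in> GObj (envelope \<A>)" "(Z, c) \<in> GObj (envelope \<A>)"
      "f \<in> HomD (envelope \<A>) (X, a) (Y, b) d" "g \<in> HomD (envelope \<A>) (Y, b) (Z, c) e"
    then show "GComp (envelope \<A>) g f \<in> HomD (envelope \<A>) (X, a) (Z, c) (e + d)"
      using Comp_degree[of X Y Z f "d - (b - a)" g "e - (c - b)"] by (simp add: algebra_simps)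
  qed
  with lin show ?thesis by (rule graded_category.intro)
qed

lemma envelope2_simps [simp]:
  "Ob (envelope2 \<D>) = Ob \<D>" "HomCat (envelope2 \<D>) i j = envelope (HomCat \<D> i j)"
  "Unit1 (envelope2 \<D>) i = (Unit1 \<D> i, 0)"
  "HComp1 (envelope2 \<D>) (X, g) (Y, h) = (HComp1 \<D> X Y, g + h)" "HComp2 (envelope2 \<D>) = HComp2 \<D>"
  by (simp_all add: envelope2_def)

lemma graded_two_category_envelope2:
  assumes "graded_two_category \<D>"
  shows "graded_two_category (envelope2 \<D>)"
proof -
  interpret graded_two_category \<D> by fact
  show ?thesis
  proof (rule graded_two_category.intro, unfold split_paired_all, goal_cases)
    \<comment> \<open>The shifts of composed 1-morphisms add up, so the corrections a' - a and b' -
      b sum to the correction for the horizontal composite.\<close>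
    case (4 i j k F a F' a' G b G' b' \<alpha> d \<beta> e)
    then show ?case
      using HComp2_degree[of i j k F F' G G' \<alpha> "d - (a' - a)" \<beta> "e - (b' - b)"] by (simp add: algebra_simps)
  qed (simp_all add: add.assoc hom_graded graded_category_envelope Unit1_in HComp1_in HComp2_Idm
      HComp1_assoc HComp1_Unit1 Unit1_HComp1,
    (rule HComp2_add_left HComp2_add_right HComp2_scale_left HComp2_scale_right interchange
      HComp2_assoc HComp2_Unit1 Unit1_HComp2; assumption)+)
qed

section \<open>Passing from degree zero to all degrees\<close>

lemma map_hom_cats_simps [simp]:
  "HomCat (map_hom_cats T \<C>) i j = T (HomCat \<C> i j)" "Unit1 (map_hom_cats T \<C>) = Unit1 \<C>"
  "HComp1 (map_hom_cats T \<C>) = HComp1 \<C>" "HComp2 (map_hom_cats T \<C>) = HComp2 \<C>"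
  by (simp_all add: map_hom_cats_def)

lemma map_rep_cats_simps [simp]:
  "MCat (map_rep_cats T M) i = T (MCat M i)" "MObj (map_rep_cats T M) = MObj M"
  "MMor (map_rep_cats T M) = MMor M" "MNat (map_rep_cats T M) = MNat M"
  by (simp_all add: map_rep_cats_def)

text \<open>The axioms locate images of homogeneous morphisms only. Decomposition into homogeneous
  components and additivity extend this to all morphisms.\<close>

lemma (in graded_category) additive_in_Hom:
  assumes B: "linear_category \<B>" and X: "X \<in> GObj \<A>" and Y: "Y \<in> GObj \<A>"
    and X': "X' \<in> Obj \<B>" and Y': "Y' \<in> Obj \<B>"
    and T: "\<And>d f. f \<in> HomD \<A> X Y d \<Longrightarrow> T f \<in> Hom \<B> X' Y'"
    and add: "\<And>f f'. \<lbrakk>f \<in> Hom (total_cat \<A>) X Y; f' \<in> Hom (total_cat \<A>) X Y\<rbrakk> \<Longrightarrow> T (f + f') = T f + T f'"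
    and f: "f \<in> Hom (total_cat \<A>) X Y"
  shows "T f \<in> Hom \<B> X' Y'"
proof -
  interpret B: linear_category \<B> by (rule B)
  obtain D x where D: "finite D" and x: "\<And>d. d \<in> D \<Longrightarrow> x d \<in> HomD \<A> X Y d" and f: "f = (\<Sum>d\<in>D. x d)"
    by (rule homogeneous_decomposition[OF X Y f]) blast
  have T0: "T 0 = 0" using add[of 0 0] zero_in_Hom X Y by simp
  have "T (\<Sum>d\<in>D. x d) = (\<Sum>d\<in>D. T (x d))"
    using D x
  proof (induction D rule: finite_induct)
    case (insert d D)
    have "T (x d + (\<Sum>d\<in>D. x d)) = T (x d) + T (\<Sum>d\<in>D. x d)"
      by (intro add sum_in_Hom HomD_in_Hom[OF insert.prems]) (simp_all add: X Y)
    then show ?case using insert by simp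
  qed (simp add: T0)
  then show ?thesis
    using x by (auto simp: f intro!: B.sum_in_Hom X' Y' T)
qed

context graded_two_category
begin

lemma strict_monoidal_total:
  assumes i: "i \<in> Ob \<C>"
  shows "strict_monoidal (map_hom_cats total_cat \<C>) i"
proof -
  interpret H: graded_category "HomCat \<C> i i" by (rule hom_graded[OF i i])
  have "HComp2 \<C> \<beta> \<alpha> \<in> Hom (total_cat (HomCat \<C> i i)) (HComp1 \<C> G F) (HComp1 \<C> G' F')"
    if o: "F \<in> GObj (HomCat \<C> i i)" "F' \<in> GObj (HomCat \<C> i i)" "G \<in> GObj (HomCat \<C> i i)" "G' \<in> GObj (HomCat \<C> i i)"
      and \<alpha>: "\<alpha> \<in> Hom (total_cat (HomCat \<C> i i)) F F'" and \<beta>: "\<beta> \<in> Hom (total_cat (HomCat \<C> i i)) G G'"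
    for F F' G G' \<alpha> \<beta>
  \<comment> \<open>Additivity is used in one variable at a time: \<beta> is reduced to the
    homogeneous case for fixed \<alpha>, and then \<alpha> for homogeneous \<beta>.\<close>
  proof (rule H.additive_in_Hom[OF H.linear_category_axioms o(3,4) _ _ _ _ \<beta>])
    fix e \<beta>
    assume \<beta>: "\<beta> \<in> HomD (HomCat \<C> i i) G G' e"
    show "HComp2 \<C> \<beta> \<alpha> \<in> Hom (total_cat (HomCat \<C> i i)) (HComp1 \<C> G F) (HComp1 \<C> G' F')"
      by (rule H.additive_in_Hom[OF H.linear_category_axioms o(1,2) _ _ _ _ \<alpha>])
        (use i o \<beta> in \<open>auto intro: HComp1_in H.HomD_in_Hom[OF HComp2_degree] HComp2_add_right H.HomD_in_Hom\<close>)
  qed (use i o \<alpha> in \<open>auto intro: HComp1_in HComp2_add_left\<close>)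
  note in_total = this
  show ?thesis
    by (intro strict_monoidal.intro; simp add: H.linear_category_axioms)
      (rule Unit1_in[OF i] HComp1_in[OF i i i] in_total HComp2_add_left[OF i i i] HComp2_add_right[OF i i i]
        HComp2_Idm[OF i i i] interchange[OF i i i] HComp1_assoc[OF i i i i] HComp1_Unit1[OF i i]
        Unit1_HComp1[OF i i] HComp2_assoc[OF i i i i] HComp2_Unit1[OF i i] Unit1_HComp2[OF i i]; assumption)+
qed

lemma strict_monoidal_degree_zero:
  assumes i: "i \<in> Ob \<C>"
  shows "strict_monoidal (map_hom_cats degree_zero_cat \<C>) i"
proof -
  interpret H: graded_category "HomCat \<C> i i" by (rule hom_graded[OF i i])
  show ?thesis
    by (intro strict_monoidal.intro; simp add: H.linear_degree_zero)
      (rule Unit1_in[OF i] HComp1_in[OF i i i] HComp2_degree[OF i i i, where d = 0 and e = 0, simplified]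
        HComp2_add_left[OF i i i] HComp2_add_right[OF i i i]
        HComp2_Idm[OF i i i] interchange[OF i i i] HComp1_assoc[OF i i i i] HComp1_Unit1[OF i i]
        Unit1_HComp1[OF i i] HComp2_assoc[OF i i i i] HComp2_Unit1[OF i i] Unit1_HComp2[OF i i];
        (assumption | erule H.HomD_in_Hom))+
qed

end

text \<open>The assumptions on \<open>shift\<close> record that every 1-morphism has all shifts,
  with the same underlying identity and with degrees into them merely translated.\<close>

locale graded_action = graded_two_category \<C> + G_finitary_2representation \<C> M
  for \<C> :: "('i, 'f \<times> 'g, 'm::ab_group_add, 'k::field, 'g::ab_group_add) gr_two_cat"
    and M :: "('i, 'f \<times> 'g, 'm, 'x \<times> 'g, 'n::ab_group_add, 'k, 'g) gr_two_rep" +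
  fixes i :: 'i
  assumes i: "i \<in> Ob \<C>"
    and shift_in: "Z \<in> GObj (HomCat \<C> i i) \<Longrightarrow> shift Z s \<in> GObj (HomCat \<C> i i)"
    and GIdm_shift: "Z \<in> GObj (HomCat \<C> i i) \<Longrightarrow> GIdm (HomCat \<C> i i) (shift Z s) = GIdm (HomCat \<C> i i) Z"
    and HomD_shift: "\<lbrakk>W \<in> GObj (HomCat \<C> i i); Z \<in> GObj (HomCat \<C> i i)\<rbrakk>
      \<Longrightarrow> HomD (HomCat \<C> i i) W (shift Z s) d = HomD (HomCat \<C> i i) W Z (d - s)"
begin

sublocale H: graded_category "HomCat \<C> i i"
  by (rule hom_graded[OF i i])

sublocale N: graded_category "MCat M i"
  using M_finitary[OF i] by (auto simp: G_finitary_category_def G_graded_finitary_def intro: graded_category_envelope)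

lemma strict_action_total: "strict_action (map_hom_cats total_cat \<C>) i (map_rep_cats total_cat M)"
proof -
  have mor_in: "MMor M i i F X Y f \<in> Hom (total_cat (MCat M i)) (MObj M i i F X) (MObj M i i F Y)"
    if "F \<in> GObj (HomCat \<C> i i)" "X \<in> GObj (MCat M i)" "Y \<in> GObj (MCat M i)" "f \<in> Hom (total_cat (MCat M i)) X Y"
    for F X Y f
    by (rule N.additive_in_Hom[OF N.linear_category_axioms that(2,3) _ _ _ _ that(4)])
      (use i that in \<open>auto intro: MObj_in N.HomD_in_Hom[OF MMor_degree] MMor_add\<close>)
  have nat_in: "MNat M i i F G \<alpha> X \<in> Hom (total_cat (MCat M i)) (MObj M i i F X) (MObj M i i G X)"
    if "F \<in> GObj (HomCat \<C> i i)" "G \<in> GObj (HomCat \<C> i i)" "\<alpha> \<in> Hom (total_cat (HomCat \<C> i i)) F G" "X \<in> GObj (MCat M i)"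
    for F G \<alpha> X
    by (rule H.additive_in_Hom[OF N.linear_category_axioms that(1,2) _ _ _ _ that(3)])
      (use i that in \<open>auto intro: MObj_in N.HomD_in_Hom[OF MNat_degree] MNat_add\<close>)
  show ?thesis
    by (intro strict_action.intro strict_action_axioms.intro; simp add: strict_monoidal_total i N.linear_category_axioms)
      (rule MObj_in[OF i i] mor_in MMor_add[OF i i] MMor_Idm[OF i i] MMor_Comp[OF i i] nat_in
        MNat_natural[OF i i] MNat_add[OF i i] MNat_Idm[OF i i] MNat_Comp[OF i i] MObj_Unit1[OF i] MMor_Unit1[OF i]
        MObj_HComp1[OF i i i] MMor_HComp1[OF i i i] MNat_HComp2[OF i i i]; assumption)+
qed

lemma strict_action_degree_zero:
  "strict_action (map_hom_cats degree_zero_cat \<C>) i (map_rep_cats degree_zero_cat M)"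
  by (intro strict_action.intro strict_action_axioms.intro;
      simp add: strict_monoidal_degree_zero i N.linear_degree_zero)
    (rule MObj_in[OF i i] MMor_degree[OF i i] MMor_add[OF i i] MMor_Idm[OF i i] MMor_Comp[OF i i] MNat_degree[OF i i]
      MNat_natural[OF i i] MNat_add[OF i i] MNat_Idm[OF i i] MNat_Comp[OF i i] MObj_Unit1[OF i] MMor_Unit1[OF i]
      MObj_HComp1[OF i i i] MMor_HComp1[OF i i i] MNat_HComp2[OF i i i];
      (assumption | erule N.HomD_in_Hom | erule H.HomD_in_Hom))+

sublocale T: strict_action "map_hom_cats total_cat \<C>" i "map_rep_cats total_cat M"
  by (rule strict_action_total)

sublocale Z: strict_action "map_hom_cats degree_zero_cat \<C>" i "map_rep_cats degree_zero_cat M"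
  by (rule strict_action_degree_zero)

lemma null_maps_degree_zero:
  "null_maps (degree_zero_cat (HomCat \<C> i i)) A X \<subseteq> null_maps (total_cat (HomCat \<C> i i)) A X"
  unfolding null_maps_def by (auto intro: H.HomD_in_Hom)

lemma fan_tuples_degree_zero:
  "fan_tuples (degree_zero_cat (HomCat \<C> i i)) A B \<subseteq> fan_tuples (total_cat (HomCat \<C> i i)) A B"
  unfolding fan_tuples_def by (auto intro: H.HomD_in_Hom)

text \<open>
  A morphism of degree \<open>d\<close> into \<open>Z\<close> is a morphism of degree zero into \<open>Z[-d]\<close>, and the action of the
  invertible 2-morphism \<open>Z \<rightarrow> Z[-d]\<close> given by the identity of \<open>Z\<close> is invertible, though not
  necessarily given by the identity.
\<close>

lemma universal_total:
  assumes S: "S \<in> GObj (MCat M i)"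
    and univ: "universal (map_hom_cats degree_zero_cat \<C>) (map_rep_cats degree_zero_cat M) i S A u"
  shows "universal (map_hom_cats total_cat \<C>) (map_rep_cats total_cat M) i S A u"
proof -
  let ?A = "HomCat \<C> i i" and ?B = "MCat M i"
  let ?ev = "\<lambda>Z g. GComp ?B (MNat M i i (apex A) Z g S) u"
  have A0: "A \<in> fan_Obj (degree_zero_cat ?A)" and u0: "u \<in> HomD ?B S (MObj M i i (apex A) S) 0"
    and legs: "\<And>a. a < width A \<Longrightarrow> GComp ?B (MNat M i i (apex A) (tgt A a) (leg A a) S) u = 0"
    and surj: "\<And>Z x. \<lbrakk>Z \<in> GObj ?A; x \<in> HomD ?B S (MObj M i i Z S) 0\<rbrakk> \<Longrightarrow> \<exists>g \<in> HomD ?A (apex A) Z 0. ?ev Z g = x"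
    and ker: "\<And>Z g. \<lbrakk>Z \<in> GObj ?A; g \<in> HomD ?A (apex A) Z 0; ?ev Z g = 0\<rbrakk> \<Longrightarrow> g \<in> null_maps (degree_zero_cat ?A) A Z"
    using univ by (auto simp: universal_def)
  have A: "A \<in> fan_Obj (total_cat ?A)"
    using A0 fan_Obj_degree_zero[OF H.graded_category_axioms] by blast
  have X: "apex A \<in> GObj ?A" using fan_ObjD(1)[OF A] by simp
  have u: "u \<in> Hom (total_cat ?B) S (MObj M i i (apex A) S)" by (rule N.HomD_in_Hom[OF u0])
  note obS = MObj_in[OF i i _ S]
  \<comment> \<open>Since u has degree zero, evaluation preserves degrees; this is what later
    separates the homogeneous components of a vanishing evaluation.\<close>
  have ev_degree: "?ev Z g \<in> HomD ?B S (MObj M i i Z S) d" if "Z \<in> GObj ?A" "g \<in> HomD ?A (apex A) Z d" for Z g d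
    using N.Comp_degree[OF S obS[OF X] obS[OF that(1)] u0 MNat_degree[OF i i X that S]] by simp
  have ev_Comp: "?ev W (GComp ?A h g) = GComp ?B (MNat M i i Z W h S) (?ev Z g)"
    if "Z \<in> GObj ?A" "W \<in> GObj ?A" "g \<in> Hom (total_cat ?A) (apex A) Z" "h \<in> Hom (total_cat ?A) Z W" for Z W g h
  proof -
    have "MNat M i i (apex A) Z g S \<in> Hom (total_cat ?B) (MObj M i i (apex A) S) (MObj M i i Z S)"
      "MNat M i i Z W h S \<in> Hom (total_cat ?B) (MObj M i i Z S) (MObj M i i W S)"
      using T.nat_in[of "apex A" Z g S] T.nat_in[of Z W h S] that X S by simp_all
    then show ?thesis
      using N.Comp_assoc[of S "MObj M i i (apex A) S" "MObj M i i Z S" "MObj M i i W S" u]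
        MNat_Comp[OF i i X that(1,2,3,4) S] S X that obS u by simp
  qed
  \<comment> \<open>The first membership comes from the identity of Z, the second from the identity
    of its shift, which is the same element.\<close>
  have shift_Id: "GIdm ?A Z \<in> HomD ?A Z (shift Z s) s" "GIdm ?A Z \<in> HomD ?A (shift Z s) Z (- s)"
    if Z: "Z \<in> GObj ?A" for Z s
    using H.Idm_degree[OF Z] H.Idm_degree[OF shift_in[OF Z], of s] HomD_shift[OF Z Z, of s s]
      HomD_shift[OF shift_in[OF Z] Z, of s s 0] GIdm_shift[OF Z] by simp_all
  have hom_surj: "\<exists>g \<in> HomD ?A (apex A) Z d. ?ev Z g = y"
    if Z: "Z \<in> GObj ?A" and y: "y \<in> HomD ?B S (MObj M i i Z S) d" for Z d y
  proof -
    let ?Z = "shift Z (- d)"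
    note Z' = shift_in[OF Z, of "- d"]
    note Id = H.HomD_in_Hom[OF shift_Id(1)[OF Z, of "- d"]] H.HomD_in_Hom[OF shift_Id(2)[OF Z, of "- d"]]
    define \<tau> \<tau>' where "\<tau> = MNat M i i Z ?Z (GIdm ?A Z) S" and "\<tau>' = MNat M i i ?Z Z (GIdm ?A Z) S"
    have \<tau>: "\<tau> \<in> HomD ?B (MObj M i i Z S) (MObj M i i ?Z S) (- d)"
      unfolding \<tau>_def by (rule MNat_degree[OF i i Z Z' shift_Id(1)[OF Z] S])
    have \<tau>': "\<tau>' \<in> HomD ?B (MObj M i i ?Z S) (MObj M i i Z S) d"
      unfolding \<tau>'_def using MNat_degree[OF i i Z' Z shift_Id(2)[OF Z] S] by simp
    \<comment> \<open>Composing with \<tau> lowers the degree d of y to zero, so degree-zero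
      surjectivity applies with Z[-d] as target.\<close>
    have "GComp ?B \<tau> y \<in> HomD ?B S (MObj M i i ?Z S) 0"
      using N.Comp_degree[OF S obS[OF Z] obS[OF Z'] y \<tau>] by simp
    from surj[OF Z' this] obtain g where g: "g \<in> HomD ?A (apex A) ?Z 0" "?ev ?Z g = GComp ?B \<tau> y" by blast
    have gZ: "g \<in> HomD ?A (apex A) Z d" using g(1) HomD_shift[OF X Z, of "- d" 0] by simp
    \<comment> \<open>The element g found for Z[-d] is reused for Z. Its evaluation there is
      obtained by factoring it through Z[-d], which produces \<tau>', and \<tau>' undoes
      \<tau>.\<close>
    have "?ev Z g = ?ev Z (GComp ?A (GIdm ?A Z) g)"
      using H.Idm_Comp[of "apex A" Z g] X Z H.HomD_in_Hom[OF gZ] by simp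
    also have "\<dots> = GComp ?B \<tau>' (GComp ?B \<tau> y)"
      unfolding ev_Comp[OF Z' Z H.HomD_in_Hom[OF g(1)] Id(2)] g(2) \<tau>'_def ..
    also have "\<dots> = GComp ?B (GComp ?B \<tau>' \<tau>) y"
      using N.Comp_assoc[of S "MObj M i i Z S" "MObj M i i ?Z S" "MObj M i i Z S" y \<tau> \<tau>']
        S obS Z Z' N.HomD_in_Hom[OF y] N.HomD_in_Hom[OF \<tau>] N.HomD_in_Hom[OF \<tau>'] by simp
    also have "GComp ?B \<tau>' \<tau> = MNat M i i Z Z (GComp ?A (GIdm ?A Z) (GIdm ?A Z)) S"
      unfolding \<tau>_def \<tau>'_def by (rule MNat_Comp[symmetric, OF i i Z Z' Z Id S])
    also have "GComp ?A (GIdm ?A Z) (GIdm ?A Z) = GIdm ?A Z"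
      using H.Comp_Idm[of Z Z "GIdm ?A Z"] H.Idm_in[of Z] Z by simp
    also have "MNat M i i Z Z (GIdm ?A Z) S = GIdm ?B (MObj M i i Z S)"
      by (rule MNat_Idm[OF i i Z S])
    also have "GComp ?B \<dots> y = y"
      using N.Idm_Comp[of S "MObj M i i Z S" y] S obS[OF Z] N.HomD_in_Hom[OF y] by simp
    finally show ?thesis using gZ by blast
  qed
  have hom_ker: "g \<in> null_maps (total_cat ?A) A Z"
    if Z: "Z \<in> GObj ?A" and g: "g \<in> HomD ?A (apex A) Z d" and 0: "?ev Z g = 0" for Z d g
  proof -
    let ?Z = "shift Z (- d)"
    note Z' = shift_in[OF Z, of "- d"]
    note Id = H.HomD_in_Hom[OF shift_Id(1)[OF Z, of "- d"]] H.HomD_in_Hom[OF shift_Id(2)[OF Z, of "- d"]]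
    have Idg: "GComp ?A (GIdm ?A Z) g = g"
      using H.Idm_Comp[of "apex A" Z g] X Z H.HomD_in_Hom[OF g] by simp
    have g': "g \<in> HomD ?A (apex A) ?Z 0" using g HomD_shift[OF X Z, of "- d" 0] by simp
    have "?ev ?Z g = GComp ?B (MNat M i i Z ?Z (GIdm ?A Z) S) 0"
      using ev_Comp[OF Z Z' H.HomD_in_Hom[OF g] Id(1)] unfolding Idg 0 .
    also have "\<dots> = 0"
      using N.Comp_0_right[of S "MObj M i i Z S" "MObj M i i ?Z S" "MNat M i i Z ?Z (GIdm ?A Z) S"]
        S obS Z Z' T.nat_in[of Z ?Z "GIdm ?A Z" S] Id(1) by simp
    finally have "g \<in> null_maps (total_cat ?A) A ?Z"
      using ker[OF Z' g'] null_maps_degree_zero by blast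
    \<comment> \<open>A factorization through the legs into Z[-d] becomes one into Z by composing
      with the identity element read as a 2-morphism of degree d.\<close>
    then have "GComp ?A (GIdm ?A Z) g \<in> null_maps (total_cat ?A) A Z"
      using H.null_maps_Comp[OF A, of ?Z Z g "GIdm ?A Z"] Z Z' Id(2) by simp
    then show ?thesis unfolding Idg .
  qed
  have ev_sum: "?ev Z (\<Sum>d\<in>D. g d) = (\<Sum>d\<in>D. ?ev Z (g d))"
    if Z: "Z \<in> GObj ?A" and g: "\<And>d. d \<in> D \<Longrightarrow> g d \<in> HomD ?A (apex A) Z d" for Z D g
  proof -
    have "MNat M i i (apex A) Z (\<Sum>d\<in>D. g d) S = (\<Sum>d\<in>D. MNat M i i (apex A) Z (g d) S)"
      using T.nt_sum[of "apex A" Z S D g] X Z S H.HomD_in_Hom[OF g] by simp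
    then show ?thesis
      using N.Comp_sum_left[of S "MObj M i i (apex A) S" "MObj M i i Z S" u D "\<lambda>d. MNat M i i (apex A) Z (g d) S"]
        T.nat_in[of "apex A" Z "g _" S] X Z S H.HomD_in_Hom[OF g] obS u by simp
  qed
  show ?thesis
    unfolding universal_def
  proof (intro conjI ballI allI impI)
    fix Z x
    assume "Z \<in> Obj (HomCat (map_hom_cats total_cat \<C>) i i)"
      "x \<in> Hom (MCat (map_rep_cats total_cat M) i) S (MObj (map_rep_cats total_cat M) i i Z S)"
    then have Z: "Z \<in> GObj ?A" and x: "x \<in> Hom (total_cat ?B) S (MObj M i i Z S)" by simp_all
    obtain D y where D: "finite D" and y: "\<And>d. d \<in> D \<Longrightarrow> y d \<in> HomD ?B S (MObj M i i Z S) d"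
      and x: "x = (\<Sum>d\<in>D. y d)"
      using N.homogeneous_decomposition[OF S obS[OF Z] x] by metis
    have "\<forall>d\<in>D. \<exists>g. g \<in> HomD ?A (apex A) Z d \<and> ?ev Z g = y d" using hom_surj[OF Z y] by blast
    from bchoice[OF this] obtain g where g: "\<And>d. d \<in> D \<Longrightarrow> g d \<in> HomD ?A (apex A) Z d"
      "\<And>d. d \<in> D \<Longrightarrow> ?ev Z (g d) = y d" by blast
    have "?ev Z (\<Sum>d\<in>D. g d) = x"
      using g(2) by (simp add: ev_sum[OF Z g(1)] x)
    moreover have "(\<Sum>d\<in>D. g d) \<in> Hom (total_cat ?A) (apex A) Z"
      by (rule H.sum_in_Hom) (use X Z g(1) in \<open>auto intro: H.HomD_in_Hom\<close>)
    ultimately show "\<exists>g \<in> Hom (HomCat (map_hom_cats total_cat \<C>) i i) (apex A) Z.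
        Comp (MCat (map_rep_cats total_cat M) i) (MNat (map_rep_cats total_cat M) i i (apex A) Z g S) u = x"
      by auto
  next
    fix Z g
    assume "Z \<in> Obj (HomCat (map_hom_cats total_cat \<C>) i i)" "g \<in> Hom (HomCat (map_hom_cats total_cat \<C>) i i) (apex A) Z"
      "Comp (MCat (map_rep_cats total_cat M) i) (MNat (map_rep_cats total_cat M) i i (apex A) Z g S) u = 0"
    then have Z: "Z \<in> GObj ?A" and g: "g \<in> Hom (total_cat ?A) (apex A) Z" and 0: "?ev Z g = 0" by simp_all
    obtain D x where D: "finite D" and x: "\<And>d. d \<in> D \<Longrightarrow> x d \<in> HomD ?A (apex A) Z d" and g: "g = (\<Sum>d\<in>D. x d)"
      using H.homogeneous_decomposition[OF X Z g] by metis
    have "(\<Sum>d\<in>D. ?ev Z (x d)) = 0" using 0 by (simp add: g ev_sum[OF Z x])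
    \<comment> \<open>The evaluations lie in distinct degrees, so their sum vanishes only if each of
      them does.\<close>
    then have "?ev Z (x d) = 0" if "d \<in> D" for d
      using N.homogeneous_sum_zero[OF S obS[OF Z] D ev_degree[OF Z x], of d] that by blast
    then show "g \<in> null_maps (HomCat (map_hom_cats total_cat \<C>) i i) A Z"
      using hom_ker[OF Z x] H.null_maps_sum[OF A, of Z D x] Z by (simp add: g)
  qed (use A u legs in simp_all)
qed

end

text \<open>The shift assumptions are read off the envelope: a shift changes only the second
  component of an object, identities ignore that component, and it enters the degree through h -
  g.\<close>

lemma locally_G_finitary_action:
  assumes "locally_G_finitary_2category \<C>" "G_finitary_2representation \<C> M" "i \<in> Ob \<C>"
  shows "graded_action \<C> M i"
proof -
  from assms(1) obtain \<D> where D: "graded_two_category \<D>" and C: "\<C> = envelope2 \<D>"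
    by (auto simp: locally_G_finitary_2category_def)
  have "graded_action_axioms \<C> i"
    using assms(3) unfolding C
    by (intro graded_action_axioms.intro; simp only: split_paired_all) (auto simp: shift_def algebra_simps)
  with graded_two_category_envelope2[OF D] assms(2) show ?thesis
    unfolding C by (intro graded_action.intro)
qed

theorem theorem6p21:
  fixes \<C> :: "('i, 'f \<times> 'g, 'm::ab_group_add, 'k::alg_closed_field, 'g::{ab_group_add, countable}) gr_two_cat"
    and M :: "('i, 'f \<times> 'g, 'm, 'x \<times> 'g, 'n::ab_group_add, 'k, 'g) gr_two_rep"
    and i :: 'i and S :: "'x \<times> 'g"
    and A A\<^sub>0 :: "('f \<times> 'g, 'm) fan"
    and \<phi> \<phi>\<^sub>0 :: "('f \<times> 'g, 'm) fan \<Rightarrow> 'm fan_tuple set \<Rightarrow> 'n fan_tuple set"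
  assumes "locally_G_finitary_2category \<C>" and "restricted \<C>"
    and "G_finitary_2representation \<C> M"
    and "\<forall>j \<in> Ob \<C>. \<forall>k \<in> Ob \<C>. additive_category (degree_zero_cat (HomCat \<C> j k)) \<and>
           idempotent_complete (degree_zero_cat (HomCat \<C> j k))"
    and "\<forall>j \<in> Ob \<C>. additive_category (degree_zero_cat (MCat M j)) \<and>
           idempotent_complete (degree_zero_cat (MCat M j))"
    and "i \<in> Ob \<C>" and "S \<in> GObj (MCat M i)"
    and "internal_hom (map_hom_cats total_cat \<C>) (map_rep_cats total_cat M) i S A \<phi>"
    and "internal_hom (map_hom_cats degree_zero_cat \<C>) (map_rep_cats degree_zero_cat M) i S A\<^sub>0 \<phi>\<^sub>0"
  shows "fan_isomorphic (total_cat (HomCat \<C> i i)) A A\<^sub>0 \<and>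
         (\<exists>A' \<delta>' \<epsilon>' \<theta>.
           coalgebra (map_hom_cats total_cat \<C>) i A' \<delta>' \<epsilon>' \<and>
           coalgebra_iso (map_hom_cats total_cat \<C>) i A' \<delta>' \<epsilon>'
             A (comult (map_hom_cats total_cat \<C>) (map_rep_cats total_cat M) i S A \<phi>)
               (counit (map_hom_cats total_cat \<C>) (map_rep_cats total_cat M) i S A \<phi>) \<theta> \<and>
           homogeneous_zero (HomCat \<C> i i) A'
             (fan_HComp (map_hom_cats total_cat \<C>) i A' A') \<delta>' \<and>
           homogeneous_zero (HomCat \<C> i i) A' (fan_unit (map_hom_cats total_cat \<C>) i) \<epsilon>')"
proof -
  let ?C = "map_hom_cats total_cat \<C>" and ?M = "map_rep_cats total_cat M"
  let ?CZ = "map_hom_cats degree_zero_cat \<C>" and ?MZ = "map_rep_cats degree_zero_cat M"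
  interpret graded_action \<C> M i by (rule locally_G_finitary_action) fact+
  have S: "S \<in> Obj (MCat ?M i)" "S \<in> Obj (MCat ?MZ i)" using assms(7) by simp_all
  obtain v d' e' where V: "universal_element ?C i ?M S A v"
    and d': "universal_element.comult_map ?C i ?M S A v d'" and e': "universal_element.counit_map ?C i ?M S A v e'"
    and comult: "comult ?C ?M i S A \<phi> = fan_class (HomCat ?C i i) A (fan_HComp ?C i A A) d'"
    and counit: "counit ?C ?M i S A \<phi> = fan_class (HomCat ?C i i) A (fan_unit ?C i) e'"
    by (rule T.comult_counit_eq[OF S(1) assms(8)])
  obtain u d e where U0: "universal_element ?CZ i ?MZ S A\<^sub>0 u"
    and d0: "universal_element.comult_map ?CZ i ?MZ S A\<^sub>0 u d" and e0: "universal_element.counit_map ?CZ i ?MZ S A\<^sub>0 u e"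
    by (rule Z.comult_counit_eq[OF S(2) assms(9)])
  interpret V: universal_element ?C i ?M S A v by (rule V)
  interpret U0: universal_element ?CZ i ?MZ S A\<^sub>0 u by (rule U0)
  \<comment> \<open>The degree-zero element u is universal over the whole 2-category as well, so
    \<open>A\<^sub>0\<close> can be compared with A there.\<close>
  interpret U: universal_element ?C i ?M S A\<^sub>0 u
    by unfold_locales (use S universal_total[OF assms(7) U0.univ] in simp_all)
  \<comment> \<open>Composition of fans is built from data that the two 2-categories share, namely
    composition of 1- and 2-morphisms and identities.\<close>
  have AA: "fan_HComp ?CZ i A\<^sub>0 A\<^sub>0 = fan_HComp ?C i A\<^sub>0 A\<^sub>0"
    by (simp add: act_obj_def principal_def)
  have homogeneous: "g \<in> fan_maps (total_cat (HomCat \<C> i i)) A\<^sub>0 B \<and>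
      homogeneous_zero (HomCat \<C> i i) A\<^sub>0 B (fan_class (total_cat (HomCat \<C> i i)) A\<^sub>0 B g)"
    if B: "B \<in> fan_Obj (total_cat (HomCat \<C> i i))" and g: "g \<in> fan_maps (degree_zero_cat (HomCat \<C> i i)) A\<^sub>0 B" for B g
  proof -
    obtain h where h: "(g, h) \<in> fan_tuples (degree_zero_cat (HomCat \<C> i i)) A\<^sub>0 B"
      using g Z.A.fan_maps_iff_tuple[of g A\<^sub>0 B] by auto
    then have h': "(g, h) \<in> fan_tuples (total_cat (HomCat \<C> i i)) A\<^sub>0 B"
      using fan_tuples_degree_zero by blast
    \<comment> \<open>A tuple of degree zero is also a tuple over the whole category, and it lies in
      the class of its own apex component there; it is the representative demanded by
      \<open>homogeneous_zero\<close>.\<close>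
    then have "(g, h) \<in> fan_class (total_cat (HomCat \<C> i i)) A\<^sub>0 B g"
      using H.null_maps_0[of A\<^sub>0 "apex B"] U.fan_A fan_ObjD(1)[OF B] by (simp add: fan_class_def)
    then show ?thesis
      using h h' H.fan_maps_iff_tuple by (auto simp: homogeneous_zero_def fan_tuples_def)
  qed
  have dm: "d \<in> fan_maps (degree_zero_cat (HomCat \<C> i i)) A\<^sub>0 (fan_HComp ?C i A\<^sub>0 A\<^sub>0)"
    using U0.comultD(1)[OF d0] by (simp add: AA)
  have em: "e \<in> fan_maps (degree_zero_cat (HomCat \<C> i i)) A\<^sub>0 (fan_unit ?C i)"
    using U0.counitD(1)[OF e0] by simp
  note hd = homogeneous[OF _ dm] and he = homogeneous[OF _ em]
  \<comment> \<open>The defining equation is literally the same in both settings; only membership in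
    the larger set of fan maps has to be supplied.\<close>
  have d: "U.comult_map d"
    using U0.comultD(3)[OF d0] hd U.fan_AA by (simp add: U.comult_map_def U.ev_def U0.ev_def)
  have e: "U.counit_map e"
    using U0.counitD(3)[OF e0] he U.fan_unit_in H.fan_maps_in_Hom
    by (auto simp: U.counit_map_def U.ev_def U0.ev_def fan_maps_to_point)
  obtain t where t: "coalgebra_iso ?C i A\<^sub>0 (fan_class (HomCat ?C i i) A\<^sub>0 (fan_HComp ?C i A\<^sub>0 A\<^sub>0) d)
      (fan_class (HomCat ?C i i) A\<^sub>0 (fan_unit ?C i) e) A (comult ?C ?M i S A \<phi>) (counit ?C ?M i S A \<phi>)
      (fan_class (HomCat ?C i i) A\<^sub>0 A t)"
    unfolding comult counit by (rule U.universal_coalgebra_iso[OF d e V d' e'])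
  have "fan_isomorphic (total_cat (HomCat \<C> i i)) A A\<^sub>0"
    using T.universal_unique[OF S(1) V.univ U.univ] unfolding fan_isomorphic_def by (metis map_hom_cats_simps(1))
  \<comment> \<open>The representative A' is \<open>A\<^sub>0\<close>, with the classes of d and e
    over the whole category as its structure.\<close>
  moreover note U.universal_coalgebra[OF d e] t
  moreover have "homogeneous_zero (HomCat \<C> i i) A\<^sub>0 (fan_HComp ?C i A\<^sub>0 A\<^sub>0)
      (fan_class (HomCat ?C i i) A\<^sub>0 (fan_HComp ?C i A\<^sub>0 A\<^sub>0) d)"
    "homogeneous_zero (HomCat \<C> i i) A\<^sub>0 (fan_unit ?C i) (fan_class (HomCat ?C i i) A\<^sub>0 (fan_unit ?C i) e)"
    using hd he U.fan_AA U.fan_unit_in by simp_all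
  ultimately show ?thesis by blast
qed

end
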